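(* Let $F$ be a free group, $N\triangleleft F$ a normal subgroup, $G=F/N$, and let $R$ be a domain. If $G$ is right orderable and the $R$-relation module $R\otimes_{\mathbb{Z}}N_{\mathrm{ab}}$ is generated as an $RG$-module by a single element of the form $1\otimes r$ with $r\in N_{\mathrm{ab}}$, then there is an element $w\in N$ and a positive integer $k$ such that $$1\otimes w^k[N,N]=1\otimes r\quad\text{and}\quad\langle\!\langle w\rangle\!\rangle=N.$$ In particular, $G$ is a one-relator group.
   Context: $N_{\mathrm{ab}}=N/[N,N]$ is a left $\mathbb{Z}G$-module via the action induced by conjugation by $F$, and $R\otimes_{\mathbb{Z}}N_{\mathrm{ab}}$ is correspondingly a left $RG$-module. $\langle\!\langle w\rangle\!\rangle$ denotes the normal closure of $w$ in $F$. A domain is a ring with $1\neq0$ and no zero-divisors. A group $G$ is right orderable if it has a total order such that $a<b$ implies $ag<bg$ for all $a,b,g\in G$. *)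

theory Defs
  imports "HOL-Algebra.Algebra" "HOL-Library.Poly_Mapping"
begin

text \<open>A letter \<open>(x, True)\<close> stands for \<open>x\<close>, a letter \<open>(x, False)\<close> for the inverse of \<open>x\<close>.\<close>

definition letter_value :: "('a, 'b) monoid_scheme \<Rightarrow> 'a \<times> bool \<Rightarrow> 'a"
  where "letter_value G l = (if snd l then fst l else inv\<^bsub>G\<^esub> (fst l))"

primrec word_value :: "('a, 'b) monoid_scheme \<Rightarrow> ('a \<times> bool) list \<Rightarrow> 'a" where
  "word_value G [] = \<one>\<^bsub>G\<^esub>"
| "word_value G (l # u) = letter_value G l \<otimes>\<^bsub>G\<^esub> word_value G u"

definition reduced_word :: "('a \<times> bool) list \<Rightarrow> bool"
  where "reduced_word = successively (\<lambda>l l'. \<not> (fst l = fst l' \<and> snd l \<noteq> snd l'))"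

text \<open>Freeness is expressed by the normal form property: every element is the value of exactly
  one reduced word in the basis.\<close>

definition free_basis :: "('a, 'b) monoid_scheme \<Rightarrow> 'a set \<Rightarrow> bool"
  where "free_basis F S \<longleftrightarrow> S \<subseteq> carrier F \<and>
    bij_betw (word_value F) {u \<in> lists (S \<times> UNIV). reduced_word u} (carrier F)"

definition free_group :: "('a, 'b) monoid_scheme \<Rightarrow> bool"
  where "free_group F \<longleftrightarrow> group F \<and> (\<exists>S. free_basis F S)"

definition normal_closure :: "('a, 'b) monoid_scheme \<Rightarrow> 'a set \<Rightarrow> 'a set"
  where "normal_closure G S = \<Inter> {H. H \<lhd> G \<and> S \<subseteq> H}"

text \<open>HOL cannot quantify over types, so the type in which the presenting free group lives is a
  parameter.\<close>

definition one_relator_group :: "'x itself \<Rightarrow> ('g, 'b) monoid_scheme \<Rightarrow> bool"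
  where "one_relator_group _ G \<longleftrightarrow>
    (\<exists>(F :: 'x monoid) w. free_group F \<and> w \<in> carrier F \<and> G \<cong> F Mod normal_closure F {w})"

definition right_orderable :: "('g, 'b) monoid_scheme \<Rightarrow> bool"
  where "right_orderable G \<longleftrightarrow>
    (\<exists>less. strict_linear_order_on (carrier G) less \<and>
      (\<forall>a \<in> carrier G. \<forall>b \<in> carrier G. \<forall>g \<in> carrier G.
        (a, b) \<in> less \<longrightarrow> (a \<otimes>\<^bsub>G\<^esub> g, b \<otimes>\<^bsub>G\<^esub> g) \<in> less))"

text \<open>The library locale \<open>domain\<close> assumes commutativity; here the ring may be noncommutative.\<close>

locale nc_domain = ring R for R (structure) +
  assumes one_not_zero: "\<one> \<noteq> \<zero>"
    and no_zero_divisors: "\<lbrakk>a \<in> carrier R; b \<in> carrier R; a \<otimes> b = \<zero>\<rbrakk> \<Longrightarrow> a = \<zero> \<or> b = \<zero>"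

text \<open>Elements of the group ring are finitely supported functions that vanish outside the group.\<close>

definition group_ring :: "('r, 'c) ring_scheme \<Rightarrow> ('g, 'b) monoid_scheme \<Rightarrow> ('g \<Rightarrow> 'r) ring"
  where "group_ring R G =
   \<lparr>carrier = {a. (\<forall>g \<in> carrier G. a g \<in> carrier R) \<and> (\<forall>g. g \<notin> carrier G \<longrightarrow> a g = \<zero>\<^bsub>R\<^esub>) \<and>
                  finite {g. a g \<noteq> \<zero>\<^bsub>R\<^esub>}},
    monoid.mult = (\<lambda>a b g. if g \<in> carrier G
       then \<Oplus>\<^bsub>R\<^esub>h \<in> {h. a h \<noteq> \<zero>\<^bsub>R\<^esub>}. a h \<otimes>\<^bsub>R\<^esub> b (inv\<^bsub>G\<^esub> h \<otimes>\<^bsub>G\<^esub> g) else \<zero>\<^bsub>R\<^esub>),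
    one = (\<lambda>g. if g = \<one>\<^bsub>G\<^esub> then \<one>\<^bsub>R\<^esub> else \<zero>\<^bsub>R\<^esub>),
    ring.zero = (\<lambda>_. \<zero>\<^bsub>R\<^esub>),
    ring.add = (\<lambda>a b g. a g \<oplus>\<^bsub>R\<^esub> b g)\<rparr>"

definition abelianization :: "('a, 'b) monoid_scheme \<Rightarrow> 'a set \<Rightarrow> 'a set monoid"
  where "abelianization F N = F\<lparr>carrier := N\<rparr> Mod derived F N"

text \<open>The conjugation action of a coset \<open>g = N f\<close> on \<open>m = [N,N] n\<close>. For each single \<open>f \<in> g\<close> the set
  \<open>f m f\<inverse>\<close> is the same coset of \<open>[N,N]\<close> (see \<open>coset_conj_eq\<close> below), so the union is that coset.\<close>

definition coset_conj :: "('a, 'b) monoid_scheme \<Rightarrow> 'a set \<Rightarrow> 'a set \<Rightarrow> 'a set"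
  where "coset_conj F g m = (\<Union>f \<in> g. \<Union>n \<in> m. {f \<otimes>\<^bsub>F\<^esub> n \<otimes>\<^bsub>F\<^esub> inv\<^bsub>F\<^esub> f})"

text \<open>The tensor product over the integers of the additive group of \<open>R\<close> with a multiplicatively
  written abelian group \<open>A\<close>, as the free abelian group on pairs modulo biadditivity.\<close>

abbreviation tensor_free :: "('r, 'c) ring_scheme \<Rightarrow> ('m, 'b) monoid_scheme \<Rightarrow> ('r \<times> 'm \<Rightarrow>\<^sub>0 int) monoid"
  where "tensor_free R A \<equiv> free_Abelian_group (carrier R \<times> carrier A)"

definition tensor_relators :: "('r, 'c) ring_scheme \<Rightarrow> ('m, 'b) monoid_scheme \<Rightarrow> ('r \<times> 'm \<Rightarrow>\<^sub>0 int) set"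
  where "tensor_relators R A =
    {frag_of (s \<oplus>\<^bsub>R\<^esub> t, m) - frag_of (s, m) - frag_of (t, m) | s t m.
       s \<in> carrier R \<and> t \<in> carrier R \<and> m \<in> carrier A} \<union>
    {frag_of (s, m \<otimes>\<^bsub>A\<^esub> n) - frag_of (s, m) - frag_of (s, n) | s m n.
       s \<in> carrier R \<and> m \<in> carrier A \<and> n \<in> carrier A}"

definition tensor_kernel :: "('r, 'c) ring_scheme \<Rightarrow> ('m, 'b) monoid_scheme \<Rightarrow> ('r \<times> 'm \<Rightarrow>\<^sub>0 int) set"
  where "tensor_kernel R A = generate (tensor_free R A) (tensor_relators R A)"

definition tensor_group :: "('r, 'c) ring_scheme \<Rightarrow> ('m, 'b) monoid_scheme \<Rightarrow> ('r \<times> 'm \<Rightarrow>\<^sub>0 int) set monoid"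
  where "tensor_group R A = tensor_free R A Mod tensor_kernel R A"

definition pure_tensor :: "('r, 'c) ring_scheme \<Rightarrow> ('m, 'b) monoid_scheme \<Rightarrow> 'r \<Rightarrow> 'm \<Rightarrow> ('r \<times> 'm \<Rightarrow>\<^sub>0 int) set"
  where "pure_tensor R A s m = tensor_kernel R A #>\<^bsub>tensor_free R A\<^esub> frag_of (s, m)"

text \<open>\<open>tensor_lift_action R act a\<close> is the endomorphism of the free abelian group on pairs that sends
  \<open>(s, m)\<close> to the sum of the pairs \<open>(a g s, act g m)\<close> over the support of \<open>a\<close>.\<close>

definition tensor_lift_action ::
    "('r, 'c) ring_scheme \<Rightarrow> ('g \<Rightarrow> 'm \<Rightarrow> 'm) \<Rightarrow> ('g \<Rightarrow> 'r) \<Rightarrow> ('r \<times> 'm \<Rightarrow>\<^sub>0 int) \<Rightarrow> ('r \<times> 'm \<Rightarrow>\<^sub>0 int)"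
  where "tensor_lift_action R act a =
    frag_extend (\<lambda>(s, m). \<Sum>g \<in> {g. a g \<noteq> \<zero>\<^bsub>R\<^esub>}. frag_of (a g \<otimes>\<^bsub>R\<^esub> s, act g m))"

text \<open>The relation module: the tensor product of \<open>R\<close> with the abelianization of \<open>N\<close>, as a left module
  over the group ring of \<open>F Mod N\<close>. Scalar multiplication is the map that \<open>tensor_lift_action\<close> induces
  on cosets of the tensor kernel (see \<open>relation_module_smult_pure\<close> below). The ring multiplication
  and unit fields of the library's module record carry no meaning for a module.\<close>

definition relation_module ::
    "('r, 'c) ring_scheme \<Rightarrow> ('a, 'b) monoid_scheme \<Rightarrow> 'a set \<Rightarrow>
      ('a set \<Rightarrow> 'r, ('r \<times> 'a set \<Rightarrow>\<^sub>0 int) set) module"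
  where "relation_module R F N = (let A = abelianization F N in
   \<lparr>carrier = carrier (tensor_group R A),
    monoid.mult = undefined,
    one = undefined,
    ring.zero = \<one>\<^bsub>tensor_group R A\<^esub>,
    ring.add = (\<lambda>x y. x \<otimes>\<^bsub>tensor_group R A\<^esub> y),
    smult = (\<lambda>a x. \<Union>c \<in> x. tensor_kernel R A #>\<^bsub>tensor_free R A\<^esub>
                              tensor_lift_action R (coset_conj F) a c)\<rparr>)"

definition generated_submodule ::
    "('s, 'c) ring_scheme \<Rightarrow> ('s, 'm, 'b) module_scheme \<Rightarrow> 'm set \<Rightarrow> 'm set"
  where "generated_submodule S M Y = \<Inter> {U. submodule U S M \<and> Y \<subseteq> U}"

lemma (in group) inv_cancel_left:
  assumes "x \<in> carrier G" "y \<in> carrier G"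
  shows "inv x \<otimes> (x \<otimes> y) = y" and "x \<otimes> (inv x \<otimes> y) = y"
  using assms by (simp_all add: m_assoc[symmetric])

lemma coset_conj_eq:
  assumes "N \<lhd> F" "f \<in> carrier F" "n \<in> N"
  shows "coset_conj F (N #>\<^bsub>F\<^esub> f) (derived F N #>\<^bsub>F\<^esub> n) =
    derived F N #>\<^bsub>F\<^esub> (f \<otimes>\<^bsub>F\<^esub> n \<otimes>\<^bsub>F\<^esub> inv\<^bsub>F\<^esub> f)"
proof -
  interpret N: normal N F by fact
  define D where "D = derived F N"
  interpret D: normal D F unfolding D_def by (rule N.derived_is_normal[OF assms(1)])
  have DN: "D \<subseteq> N" unfolding D_def by (rule N.derived_incl[OF subset_refl N.subgroup_axioms])
  have com: "x \<otimes>\<^bsub>F\<^esub> y \<otimes>\<^bsub>F\<^esub> inv\<^bsub>F\<^esub> x \<otimes>\<^bsub>F\<^esub> inv\<^bsub>F\<^esub> y \<in> D" if "x \<in> N" "y \<in> N" for x y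
    unfolding D_def derived_def using that by (intro generate.incl) blast
  have yN: "f \<otimes>\<^bsub>F\<^esub> n \<otimes>\<^bsub>F\<^esub> inv\<^bsub>F\<^esub> f \<in> N" (is "?y \<in> N") using assms N.inv_op_closed2 by simp
  have nc: "n \<in> carrier F" using assms(3) by simp
  show ?thesis unfolding D_def[symmetric]
  proof (rule Set.set_eqI, rule iffI)
    fix z assume "z \<in> coset_conj F (N #>\<^bsub>F\<^esub> f) (D #>\<^bsub>F\<^esub> n)"
    then obtain x d where x: "x \<in> N" and d: "d \<in> D"
      and z: "z = x \<otimes>\<^bsub>F\<^esub> f \<otimes>\<^bsub>F\<^esub> (d \<otimes>\<^bsub>F\<^esub> n) \<otimes>\<^bsub>F\<^esub> inv\<^bsub>F\<^esub> (x \<otimes>\<^bsub>F\<^esub> f)"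
      unfolding coset_conj_def r_coset_def by auto
    have xc: "x \<in> carrier F" and dc: "d \<in> carrier F" using x d by auto
    have d': "x \<otimes>\<^bsub>F\<^esub> (f \<otimes>\<^bsub>F\<^esub> d \<otimes>\<^bsub>F\<^esub> inv\<^bsub>F\<^esub> f) \<otimes>\<^bsub>F\<^esub> inv\<^bsub>F\<^esub> x \<in> D"
      using d xc assms(2) D.inv_op_closed2 by simp
    have "z = (x \<otimes>\<^bsub>F\<^esub> (f \<otimes>\<^bsub>F\<^esub> d \<otimes>\<^bsub>F\<^esub> inv\<^bsub>F\<^esub> f) \<otimes>\<^bsub>F\<^esub> inv\<^bsub>F\<^esub> x) \<otimes>\<^bsub>F\<^esub>
        (x \<otimes>\<^bsub>F\<^esub> ?y \<otimes>\<^bsub>F\<^esub> inv\<^bsub>F\<^esub> x \<otimes>\<^bsub>F\<^esub> inv\<^bsub>F\<^esub> ?y) \<otimes>\<^bsub>F\<^esub> ?y"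
      unfolding z using xc dc nc assms(2)
      by (simp add: N.inv_mult_group N.m_assoc N.inv_cancel_left)
    then show "z \<in> D #>\<^bsub>F\<^esub> ?y" unfolding r_coset_def using subgroup.m_closed[OF D.subgroup_axioms d' com[OF x yN]] by auto
  next
    fix z assume "z \<in> D #>\<^bsub>F\<^esub> ?y"
    then obtain d where d: "d \<in> D" and z: "z = d \<otimes>\<^bsub>F\<^esub> ?y" unfolding r_coset_def by auto
    have dc: "d \<in> carrier F" using d by auto
    have "inv\<^bsub>F\<^esub> f \<otimes>\<^bsub>F\<^esub> d \<otimes>\<^bsub>F\<^esub> f \<in> D" using D.inv_op_closed1 d assms(2) by simp
    then have 1: "inv\<^bsub>F\<^esub> f \<otimes>\<^bsub>F\<^esub> d \<otimes>\<^bsub>F\<^esub> f \<otimes>\<^bsub>F\<^esub> n \<in> D #>\<^bsub>F\<^esub> n" unfolding r_coset_def by auto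
    have 2: "f \<in> N #>\<^bsub>F\<^esub> f" using N.rcos_self[OF assms(2)] N.subgroup_axioms by auto
    have "z = f \<otimes>\<^bsub>F\<^esub> (inv\<^bsub>F\<^esub> f \<otimes>\<^bsub>F\<^esub> d \<otimes>\<^bsub>F\<^esub> f \<otimes>\<^bsub>F\<^esub> n) \<otimes>\<^bsub>F\<^esub> inv\<^bsub>F\<^esub> f"
      unfolding z using dc nc assms(2) by (simp add: N.m_assoc N.inv_cancel_left)
    then show "z \<in> coset_conj F (N #>\<^bsub>F\<^esub> f) (D #>\<^bsub>F\<^esub> n)" unfolding coset_conj_def using 1 2 by blast
  qed
qed

lemma carrier_abelianization:
  "carrier (abelianization F N) = (\<lambda>n. derived F N #>\<^bsub>F\<^esub> n) ` N"
  by (auto simp: abelianization_def FactGroup_def RCOSETS_def r_coset_def)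

lemma abelianization_mult:
  assumes "N \<lhd> F" "m \<in> N" "n \<in> N"
  shows "(derived F N #>\<^bsub>F\<^esub> m) \<otimes>\<^bsub>abelianization F N\<^esub> (derived F N #>\<^bsub>F\<^esub> n) =
    derived F N #>\<^bsub>F\<^esub> (m \<otimes>\<^bsub>F\<^esub> n)"
proof -
  interpret N: normal N F by fact
  interpret D: normal "derived F N" F by (rule N.derived_is_normal[OF assms(1)])
  have "(derived F N #>\<^bsub>F\<^esub> m) <#>\<^bsub>F\<^esub> (derived F N #>\<^bsub>F\<^esub> n) = derived F N #>\<^bsub>F\<^esub> (m \<otimes>\<^bsub>F\<^esub> n)"
    using D.rcos_sum assms by simp
  then show ?thesis by (simp add: abelianization_def FactGroup_def set_mult_def)
qed

lemma coset_conj_closed_mult: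
  assumes N: "N \<lhd> F" and g: "g \<in> carrier (F Mod N)"
    and m: "m \<in> carrier (abelianization F N)" and n: "n \<in> carrier (abelianization F N)"
  shows "coset_conj F g m \<in> carrier (abelianization F N)"
    and "coset_conj F g (m \<otimes>\<^bsub>abelianization F N\<^esub> n) =
      coset_conj F g m \<otimes>\<^bsub>abelianization F N\<^esub> coset_conj F g n"
proof -
  interpret N: normal N F by fact
  obtain f where f: "f \<in> carrier F" "g = N #>\<^bsub>F\<^esub> f" using g by (auto simp: FactGroup_def RCOSETS_def)
  obtain a b where a: "a \<in> N" "m = derived F N #>\<^bsub>F\<^esub> a" and b: "b \<in> N" "n = derived F N #>\<^bsub>F\<^esub> b"
    using m n by (auto simp: carrier_abelianization)
  have ca: "f \<otimes>\<^bsub>F\<^esub> a \<otimes>\<^bsub>F\<^esub> inv\<^bsub>F\<^esub> f \<in> N" and cb: "f \<otimes>\<^bsub>F\<^esub> b \<otimes>\<^bsub>F\<^esub> inv\<^bsub>F\<^esub> f \<in> N"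
    using f a b N.inv_op_closed2 by auto
  show "coset_conj F g m \<in> carrier (abelianization F N)"
    using ca coset_conj_eq[OF N f(1) a(1)] by (auto simp: carrier_abelianization f a)
  have "f \<otimes>\<^bsub>F\<^esub> (a \<otimes>\<^bsub>F\<^esub> b) \<otimes>\<^bsub>F\<^esub> inv\<^bsub>F\<^esub> f =
      (f \<otimes>\<^bsub>F\<^esub> a \<otimes>\<^bsub>F\<^esub> inv\<^bsub>F\<^esub> f) \<otimes>\<^bsub>F\<^esub> (f \<otimes>\<^bsub>F\<^esub> b \<otimes>\<^bsub>F\<^esub> inv\<^bsub>F\<^esub> f)"
    using f a b by (simp add: N.m_assoc N.inv_cancel_left)
  then show "coset_conj F g (m \<otimes>\<^bsub>abelianization F N\<^esub> n) =
      coset_conj F g m \<otimes>\<^bsub>abelianization F N\<^esub> coset_conj F g n"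
    using f a b ca cb N by (simp add: abelianization_mult coset_conj_eq)
qed

lemma tensor_relators_closed:
  assumes "ring R" "monoid A"
  shows "tensor_relators R A \<subseteq> carrier (tensor_free R A)"
proof -
  interpret ring R by fact
  interpret A: monoid A by fact
  show ?thesis unfolding tensor_relators_def
    by (safe, simp_all) (intro order.trans[OF keys_diff] Un_least; simp)+
qed

lemma group_abelianization:
  assumes "N \<lhd> F"
  shows "group (abelianization F N)"
proof -
  interpret N: normal N F by fact
  show ?thesis unfolding abelianization_def
    by (intro normal.factorgroup_is_group N.normal_restrict_supergroup N.derived_is_normal assms
        N.derived_incl N.subgroup_axioms subset_refl)
qed

lemma tensor_kernel_normal:
  assumes "ring R" "monoid A"
  shows "tensor_kernel R A \<lhd> tensor_free R A"
  unfolding tensor_kernel_def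
  by (intro comm_group.subgroup_imp_normal abelian_free_Abelian_group group.generate_is_subgroup
      group_free_Abelian_group tensor_relators_closed assms)

lemma abelian_group_relation_module:
  assumes R: "ring R" and N: "N \<lhd> F"
  shows "abelian_group (relation_module R F N)"
proof -
  define A where "A = abelianization F N"
  interpret A: group A unfolding A_def by (rule group_abelianization[OF N])
  interpret K: normal "tensor_kernel R A" "tensor_free R A"
    by (rule tensor_kernel_normal[OF R A.monoid_axioms])
  interpret T: comm_group "tensor_group R A" unfolding tensor_group_def
    using comm_group.abelian_FactGroup[OF abelian_free_Abelian_group K.subgroup_axioms] .
  show ?thesis
    by (rule abelian_groupI; simp only: relation_module_def Let_def A_def[symmetric] partial_object.simps
        monoid.simps ring.simps)
      (simp_all add: T.m_assoc T.l_inv_ex, simp add: T.m_comm)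
qed

lemma tensor_lift_action_kernel:
  assumes R: "ring R" and N: "N \<lhd> F" and a: "a \<in> carrier (group_ring R (F Mod N))"
    and c: "c \<in> tensor_kernel R (abelianization F N)"
  shows "tensor_lift_action R (coset_conj F) a c \<in> tensor_kernel R (abelianization F N)"
proof -
  interpret ring R by fact
  define A where "A = abelianization F N"
  interpret A: group A unfolding A_def by (rule group_abelianization[OF N])
  define K where "K = tensor_kernel R A"
  define \<phi> where "\<phi> = tensor_lift_action R (coset_conj F) a"
  interpret K: normal K "tensor_free R A" unfolding K_def
    by (rule tensor_kernel_normal[OF R A.monoid_axioms])
  have K0: "0 \<in> K" using subgroup.one_closed[OF K.subgroup_axioms] by simp
  have Kp: "x + y \<in> K" if "x \<in> K" "y \<in> K" for x y using subgroup.m_closed[OF K.subgroup_axioms that] by simp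
  have Kc: "Poly_Mapping.keys x \<subseteq> carrier R \<times> carrier A" if "x \<in> K" for x using subsetD[OF K.subset that] by simp
  have Km: "- x \<in> K" if "x \<in> K" for x using subgroup.m_inv_closed[OF K.subgroup_axioms that] Kc[OF that] by simp
  have Ks: "sum f I \<in> K" if "\<And>i. i \<in> I \<Longrightarrow> f i \<in> K" for f and I :: "'c set set"
    using that by (induction I rule: infinite_finite_induct) (auto intro: K0 Kp)
  have ag: "g \<in> carrier (F Mod N)" "a g \<in> carrier R" if "a g \<noteq> \<zero>\<^bsub>R\<^esub>" for g
    using a that by (auto simp: group_ring_def)
  note cc = coset_conj_closed_mult[OF N, folded A_def]
  have rel: "x \<in> tensor_relators R A \<Longrightarrow> x \<in> K" for x
    unfolding K_def tensor_kernel_def by (rule generate.incl)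
  have phi_rel: "\<phi> x \<in> K" if "x \<in> tensor_relators R A" for x
    using that unfolding tensor_relators_def
  proof safe
    fix s t m assume st: "s \<in> carrier R" "t \<in> carrier R" "m \<in> carrier A"
    have "\<phi> (frag_of (s \<oplus>\<^bsub>R\<^esub> t, m) - frag_of (s, m) - frag_of (t, m)) =
      (\<Sum>g \<in> {g. a g \<noteq> \<zero>\<^bsub>R\<^esub>}. frag_of (a g \<otimes>\<^bsub>R\<^esub> (s \<oplus>\<^bsub>R\<^esub> t), coset_conj F g m)
        - frag_of (a g \<otimes>\<^bsub>R\<^esub> s, coset_conj F g m) - frag_of (a g \<otimes>\<^bsub>R\<^esub> t, coset_conj F g m))"
      unfolding \<phi>_def tensor_lift_action_def by (simp add: frag_extend_diff sum_subtractf)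
    also have "\<dots> \<in> K"
    proof (rule Ks, rule rel)
      fix g assume "g \<in> {g. a g \<noteq> \<zero>\<^bsub>R\<^esub>}"
      then show "frag_of (a g \<otimes>\<^bsub>R\<^esub> (s \<oplus>\<^bsub>R\<^esub> t), coset_conj F g m)
        - frag_of (a g \<otimes>\<^bsub>R\<^esub> s, coset_conj F g m) - frag_of (a g \<otimes>\<^bsub>R\<^esub> t, coset_conj F g m)
        \<in> tensor_relators R A"
        unfolding tensor_relators_def using ag[of g] st cc(1)[of g m m]
        by (intro UnI1 CollectI exI[of _ "a g \<otimes>\<^bsub>R\<^esub> s"] exI[of _ "a g \<otimes>\<^bsub>R\<^esub> t"]
            exI[of _ "coset_conj F g m"]) (simp add: r_distr)
    qed
    finally show "\<phi> (frag_of (s \<oplus>\<^bsub>R\<^esub> t, m) - frag_of (s, m) - frag_of (t, m)) \<in> K" .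
  next
    fix s m n assume st: "s \<in> carrier R" "m \<in> carrier A" "n \<in> carrier A"
    have "\<phi> (frag_of (s, m \<otimes>\<^bsub>A\<^esub> n) - frag_of (s, m) - frag_of (s, n)) =
      (\<Sum>g \<in> {g. a g \<noteq> \<zero>\<^bsub>R\<^esub>}. frag_of (a g \<otimes>\<^bsub>R\<^esub> s, coset_conj F g (m \<otimes>\<^bsub>A\<^esub> n))
        - frag_of (a g \<otimes>\<^bsub>R\<^esub> s, coset_conj F g m) - frag_of (a g \<otimes>\<^bsub>R\<^esub> s, coset_conj F g n))"
      unfolding \<phi>_def tensor_lift_action_def by (simp add: frag_extend_diff sum_subtractf)
    also have "\<dots> \<in> K"
    proof (rule Ks, rule rel)
      fix g assume "g \<in> {g. a g \<noteq> \<zero>\<^bsub>R\<^esub>}"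
      then show "frag_of (a g \<otimes>\<^bsub>R\<^esub> s, coset_conj F g (m \<otimes>\<^bsub>A\<^esub> n))
        - frag_of (a g \<otimes>\<^bsub>R\<^esub> s, coset_conj F g m) - frag_of (a g \<otimes>\<^bsub>R\<^esub> s, coset_conj F g n)
        \<in> tensor_relators R A"
        unfolding tensor_relators_def using ag[of g] st cc[of g m n] cc(1)[of g n n]
        by (intro UnI2 CollectI exI[of _ "a g \<otimes>\<^bsub>R\<^esub> s"] exI[of _ "coset_conj F g m"]
            exI[of _ "coset_conj F g n"]) simp
    qed
    finally show "\<phi> (frag_of (s, m \<otimes>\<^bsub>A\<^esub> n) - frag_of (s, m) - frag_of (s, n)) \<in> K" .
  qed
  have "c \<in> generate (tensor_free R A) (tensor_relators R A)"
    using c by (simp add: tensor_kernel_def A_def)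
  then have "\<phi> c \<in> K"
  proof (induction rule: generate.induct)
    case one
    then show ?case using K0 by (simp add: \<phi>_def tensor_lift_action_def)
  next
    case (incl h)
    then show ?case by (rule phi_rel)
  next
    case (inv h)
    have "inv\<^bsub>tensor_free R A\<^esub> h = - h"
      using Kc[OF rel[OF inv]] by simp
    then show ?case using Km[OF phi_rel[OF inv]]
      by (simp add: \<phi>_def tensor_lift_action_def frag_extend_minus)
  next
    case (eng x y)
    then show ?case using Kp by (simp add: \<phi>_def tensor_lift_action_def frag_extend_add)
  qed
  then show ?thesis by (simp add: \<phi>_def K_def A_def)
qed

lemma relation_module_smult_pure:
  assumes R: "ring R" and N: "N \<lhd> F" and a: "a \<in> carrier (group_ring R (F Mod N))"
    and s: "s \<in> carrier R" and m: "m \<in> carrier (abelianization F N)"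
  shows "a \<odot>\<^bsub>relation_module R F N\<^esub> pure_tensor R (abelianization F N) s m =
    (\<Oplus>\<^bsub>relation_module R F N\<^esub>g \<in> {g. a g \<noteq> \<zero>\<^bsub>R\<^esub>}.
      pure_tensor R (abelianization F N) (a g \<otimes>\<^bsub>R\<^esub> s) (coset_conj F g m))"
proof -
  interpret ring R by fact
  define A where "A = abelianization F N"
  interpret A: group A unfolding A_def by (rule group_abelianization[OF N])
  define K where "K = tensor_kernel R A"
  define \<phi> where "\<phi> = tensor_lift_action R (coset_conj F) a"
  interpret K: normal K "tensor_free R A" unfolding K_def
    by (rule tensor_kernel_normal[OF R A.monoid_axioms])
  interpret M: abelian_group "relation_module R F N" by (rule abelian_group_relation_module[OF R N])
  have zero_M: "\<zero>\<^bsub>relation_module R F N\<^esub> = K"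
    and add_M: "x \<oplus>\<^bsub>relation_module R F N\<^esub> y = x <#>\<^bsub>tensor_free R A\<^esub> y" for x y
    by (simp_all add: relation_module_def Let_def A_def K_def tensor_group_def)
  have ag: "g \<in> carrier (F Mod N)" "a g \<in> carrier R" if "a g \<noteq> \<zero>\<^bsub>R\<^esub>" for g
    using a that by (auto simp: group_ring_def)
  have fin: "finite {g. a g \<noteq> \<zero>\<^bsub>R\<^esub>}" using a by (simp add: group_ring_def)
  have phi: "\<phi> (frag_of (s, m)) =
      (\<Sum>g \<in> {g. a g \<noteq> \<zero>\<^bsub>R\<^esub>}. frag_of (a g \<otimes>\<^bsub>R\<^esub> s, coset_conj F g m))"
    by (simp add: \<phi>_def tensor_lift_action_def)
  have closed: "(a g \<otimes>\<^bsub>R\<^esub> s, coset_conj F g m) \<in> carrier R \<times> carrier A" if "a g \<noteq> \<zero>\<^bsub>R\<^esub>" for g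
    using ag[OF that] s coset_conj_closed_mult(1)[OF N _ m m] by (simp add: A_def)
  have phic: "\<phi> (frag_of (s, m)) \<in> carrier (tensor_free R A)"
    unfolding phi by (rule sum_closed_free_Abelian_group) (use closed in auto)
  have "a \<odot>\<^bsub>relation_module R F N\<^esub> pure_tensor R A s m =
      (\<Union>c \<in> K #>\<^bsub>tensor_free R A\<^esub> frag_of (s, m). K #>\<^bsub>tensor_free R A\<^esub> \<phi> c)"
    by (simp add: relation_module_def Let_def A_def K_def \<phi>_def pure_tensor_def)
  also have "\<dots> = K #>\<^bsub>tensor_free R A\<^esub> \<phi> (frag_of (s, m))"
  proof -
    have "K #>\<^bsub>tensor_free R A\<^esub> \<phi> c = K #>\<^bsub>tensor_free R A\<^esub> \<phi> (frag_of (s, m))"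
      if c: "c \<in> K #>\<^bsub>tensor_free R A\<^esub> frag_of (s, m)" for c
    proof -
      obtain k where k: "k \<in> K" "c = k + frag_of (s, m)" using c by (auto simp: r_coset_def)
      have pk: "\<phi> k \<in> K"
        using tensor_lift_action_kernel[OF R N a] k by (simp add: \<phi>_def K_def A_def)
      have "\<phi> c = \<phi> k \<otimes>\<^bsub>tensor_free R A\<^esub> \<phi> (frag_of (s, m))"
        by (simp add: k \<phi>_def tensor_lift_action_def frag_extend_add)
      then have "\<phi> c \<in> K #>\<^bsub>tensor_free R A\<^esub> \<phi> (frag_of (s, m))" using pk by (auto simp: r_coset_def)
      then show ?thesis using K.repr_independence[OF _ phic K.subgroup_axioms] by blast
    qed
    moreover have "frag_of (s, m) \<in> K #>\<^bsub>tensor_free R A\<^esub> frag_of (s, m)"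
      by (rule K.rcos_self[OF _ K.subgroup_axioms]) (use s m in \<open>simp add: A_def\<close>)
    ultimately show ?thesis by blast
  qed
  also have "\<dots> = (\<Oplus>\<^bsub>relation_module R F N\<^esub>g \<in> {g. a g \<noteq> \<zero>\<^bsub>R\<^esub>}.
      pure_tensor R A (a g \<otimes>\<^bsub>R\<^esub> s) (coset_conj F g m))"
  proof -
    have "I \<subseteq> {g. a g \<noteq> \<zero>\<^bsub>R\<^esub>} \<Longrightarrow>
      K #>\<^bsub>tensor_free R A\<^esub> (\<Sum>g \<in> I. frag_of (a g \<otimes>\<^bsub>R\<^esub> s, coset_conj F g m)) =
      (\<Oplus>\<^bsub>relation_module R F N\<^esub>g \<in> I. pure_tensor R A (a g \<otimes>\<^bsub>R\<^esub> s) (coset_conj F g m))"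
      if "finite I" for I using that
    proof (induction I rule: finite_induct)
      case empty
      show ?case using K.coset_mult_one[OF K.subset] by (simp add: zero_M)
    next
      case (insert h I)
      have pt: "pure_tensor R A (a g \<otimes>\<^bsub>R\<^esub> s) (coset_conj F g m) \<in> carrier (relation_module R F N)"
        if "g \<in> insert h I" for g
      proof -
        have "frag_of (a g \<otimes>\<^bsub>R\<^esub> s, coset_conj F g m) \<in> carrier (tensor_free R A)"
          using closed[of g] that insert.prems by auto
        then show ?thesis
          unfolding relation_module_def Let_def A_def[symmetric] pure_tensor_def tensor_group_def
            FactGroup_def RCOSETS_def partial_object.simps by blast
      qed
      have 1: "frag_of (a h \<otimes>\<^bsub>R\<^esub> s, coset_conj F h m) \<in> carrier (tensor_free R A)"
        using closed insert.prems by auto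
      have 2: "(\<Sum>g \<in> I. frag_of (a g \<otimes>\<^bsub>R\<^esub> s, coset_conj F g m)) \<in> carrier (tensor_free R A)"
        by (rule sum_closed_free_Abelian_group) (use closed insert.prems in auto)
      show ?case
        using insert pt K.rcos_sum[OF 1 2]
        by (simp add: M.finsum_insert Pi_def add_M)
          (simp add: pure_tensor_def K_def)
    qed
    from this[OF fin subset_refl] show ?thesis by (simp only: phi)
  qed
  finally show ?thesis by (simp only: A_def)
qed

end

theory Submission
  imports Defs
begin

text \<open>Let \<open>\<Gamma>\<close> be the Cayley graph of \<open>G = F/N\<close>. Fox derivatives identify the abelianization of \<open>N\<close> with the
  integral cycles of \<open>\<Gamma>\<close>, and \<open>1 \<otimes> r\<close> becomes an integral cycle \<open>z\<close> whose \<open>G\<close>-translates generate all cycles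
  over \<open>R\<close>. Write a simple cycle in the support of \<open>z\<close> as \<open>a z\<close> with \<open>a\<close> in the group ring. The largest and
  the smallest element of the support of \<open>a\<close> would move edges of \<open>z\<close> out of its support unless
  both are \<open>1\<close>, so \<open>z\<close> is an invertible multiple of the simple cycle. A word \<open>w\<close> read along
  that cycle is the required element. Comparing extreme coefficients once more, the translates of the simple
  cycle span all integral cycles modulo the characteristic \<open>n\<close> of \<open>R\<close>.

  To see that every closed path is a product of conjugates of \<open>w\<close>, consider a subgroup \<open>H\<close> such that the
  cycles inside the union of the \<open>H\<close>-translates of the simple cycle are spanned, modulo \<open>n\<close>, by these
  translates, and induct on the number of elements of \<open>H\<close> that map some vertex of the simple
  cycle to another one. We may assume that the union is connected and \<open>H \<noteq> 1\<close>. Its quotient by \<open>H\<close> has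
  more edges than vertices, hence a nonzero circulation orthogonal to the simple cycle; as this vanishes on
  all cycles upstairs, it defines a nonzero homomorphism \<open>H \<rightarrow> \<int>\<close>. Its kernel satisfies the same hypotheses
  with fewer such elements, and a Mayer-Vietoris argument glues the cosets of the kernel together, one
  level after the other.\<close>

text \<open>Translates span the integral cycles only up to \<open>n\<close> times a further integral
  cycle, so integral homology is never computed. Each topological fact (a component is separated, an
  edge lies on no cycle, a circulation kills cycles) is instead phrased as the vanishing of an
  integer functional on cycles. Spanning shows that its values can be divided by \<open>n\<close>
  again and again; as \<open>n\<close> is no unit, they are zero, and \<open>n = 0\<close> takes one
  step. Products of conjugates are not manipulated either. A word is read in the quotient of
  \<open>F\<close> by a normal subgroup containing \<open>w\<close>, and a subgraph counts as good
  if its closed paths have trivial value there. This property passes to translates and glues. The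
  order enters in two strengths. That the coefficient linking \<open>z\<close> to the simple cycle
  is supported at the identity uses the order itself; the other extremal arguments use a product
  attained only once, because left multiplication need not be monotone. The exponent
  \<open>k\<close> arises from comparing \<open>z\<close> with the simple cycle at one edge: modulo
  \<open>n\<close>, \<open>z\<close> is an integer multiple of that cycle, \<open>k\<close> is the
  absolute value of this integer and its sign goes into \<open>w\<close>.\<close>

abbreviation lookup :: "('a \<Rightarrow>\<^sub>0 'b::zero) \<Rightarrow> 'a \<Rightarrow> 'b"
  where "lookup \<equiv> Poly_Mapping.lookup"

abbreviation keys :: "('a \<Rightarrow>\<^sub>0 'b::zero) \<Rightarrow> 'a set"
  where "keys \<equiv> Poly_Mapping.keys"

subsection \<open>Integer functionals on free abelian groups\<close>

definition lin :: "('a \<Rightarrow> int) \<Rightarrow> ('a \<Rightarrow>\<^sub>0 int) \<Rightarrow> int"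
  where "lin c z = (\<Sum>e \<in> keys z. lookup z e * c e)"

lemma lookup_frag_extend: "lookup (frag_extend f z) e = lin (\<lambda>i. lookup (f i) e) z"
  by (simp add: frag_extend_def lin_def lookup_sum)

text \<open>The value is read off as the coefficient of a chain over a one-point basis, so linearity
  is inherited from \<open>frag_extend\<close> and no sums over varying supports have to be
  compared.\<close>

lemma lin_eq_lookup: "lin c z = lookup (frag_extend (\<lambda>e. frag_cmul (c e) (frag_of ())) z) ()"
  by (simp add: lookup_frag_extend)

lemma lin_0 [simp]: "lin c 0 = 0"
  and lin_frag_of [simp]: "lin c (frag_of e) = c e"
  and lin_add: "lin c (y + z) = lin c y + lin c z"
  and lin_diff: "lin c (y - z) = lin c y - lin c z"
  and lin_cmul: "lin c (frag_cmul k z) = k * lin c z"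
  by (simp_all add: lin_eq_lookup frag_extend_add frag_extend_diff frag_extend_minus frag_extend_cmul
      lookup_add lookup_minus)

lemma lin_superset:
  assumes "finite A" "keys z \<subseteq> A"
  shows "lin c z = (\<Sum>e \<in> A. lookup z e * c e)"
  unfolding lin_def by (rule sum.mono_neutral_left[OF assms]) (simp add: in_keys_iff)

lemma lin_cong: "(\<And>e. e \<in> keys z \<Longrightarrow> c e = d e) \<Longrightarrow> lin c z = lin d z"
  by (simp add: lin_def)

lemma lin_zero: "(\<And>e. e \<in> keys z \<Longrightarrow> c e = 0) \<Longrightarrow> lin c z = 0"
  by (simp add: lin_def)

lemma lin_frag_extend: "lin c (frag_extend f z) = lin (\<lambda>i. lin c (f i)) z"
proof (induction z rule: frag_induction[OF subset_UNIV])
  case (3 a b)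
  then show ?case by (simp add: frag_extend_diff lin_diff)
qed auto

definition frag_restrict :: "'a set \<Rightarrow> ('a \<Rightarrow>\<^sub>0 int) \<Rightarrow> ('a \<Rightarrow>\<^sub>0 int)"
  where "frag_restrict A z = frag_extend (\<lambda>e. if e \<in> A then frag_of e else 0) z"

lemma lookup_frag_restrict [simp]: "lookup (frag_restrict A z) e = (if e \<in> A then lookup z e else 0)"
proof -
  have "lookup (frag_restrict A z) e = lin (\<lambda>i. if i = e then (if e \<in> A then 1 else 0) else 0) z"
    unfolding frag_restrict_def lookup_frag_extend by (rule lin_cong) auto
  also have "\<dots> = (\<Sum>i \<in> insert e (keys z). lookup z i * (if i = e then (if e \<in> A then 1 else 0) else 0))"
    by (rule lin_superset) auto
  also have "\<dots> = (\<Sum>i \<in> insert e (keys z). if i = e then (if e \<in> A then lookup z e else 0) else 0)"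
    by (rule sum.cong) auto
  also have "\<dots> = (if e \<in> A then lookup z e else 0)" by (subst sum.delta) auto
  finally show ?thesis .
qed

lemma keys_frag_restrict: "keys (frag_restrict A z) = keys z \<inter> A"
  by (auto simp: in_keys_iff split: if_splits)

lemma frag_divide:
  assumes "\<And>e. (n::int) dvd lookup z e"
  obtains y where "z = frag_cmul n y" "keys y \<subseteq> keys z"
proof
  \<comment> \<open>The argument has coefficient one at every key of \<open>z\<close>, so each key
    contributes exactly its own quotient.\<close>
  let ?y = "frag_extend (\<lambda>e. frag_cmul (lookup z e div n) (frag_of e)) (\<Sum>e\<in>keys z. frag_of e)"
  have y: "?y = (\<Sum>e\<in>keys z. frag_cmul (lookup z e div n) (frag_of e))"
    by (simp add: frag_extend_sum o_def)
  have l: "lookup ?y e = lookup z e div n" for e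
    unfolding y lookup_sum by (simp add: if_distrib sum.delta in_keys_iff cong: if_cong)
  show "z = frag_cmul n ?y"
    by (rule poly_mapping_eqI) (simp only: lookup_frag_cmul l dvd_mult_div_cancel[OF assms])
  show "keys ?y \<subseteq> keys z"
    by (auto simp: in_keys_iff l)
qed

text \<open>A nonzero value would have a strictly smaller nonzero value as its quotient by
  \<open>n\<close>, without end; for \<open>n = 0\<close> one step already gives zero. This turns
  spanning modulo \<open>n\<close> into exact vanishing.\<close>

lemma int_functional_zero_descent:
  assumes n: "\<not> (n::int) dvd 1"
    and step: "\<And>z. z \<in> Z \<Longrightarrow> \<exists>z' \<in> Z. \<theta> z = n * \<theta> z'"
    and "z \<in> Z"
  shows "\<theta> z = 0"
  using \<open>z \<in> Z\<close>
proof (induction "nat \<bar>\<theta> z\<bar>" arbitrary: z rule: less_induct)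
  case less
  obtain z' where z': "z' \<in> Z" "\<theta> z = n * \<theta> z'" using step less.prems by blast
  show ?case
  proof (rule ccontr)
    assume nz: "\<theta> z \<noteq> 0"
    have "\<bar>n\<bar> \<noteq> 1" using n by auto
    moreover have "n \<noteq> 0" "\<theta> z' \<noteq> 0" using nz z' by auto
    ultimately have "\<bar>n\<bar> \<ge> 2" "\<bar>\<theta> z'\<bar> > 0" by linarith+
    then have "\<bar>n\<bar> * \<bar>\<theta> z'\<bar> > 1 * \<bar>\<theta> z'\<bar>" by (intro mult_strict_right_mono) auto
    then have "nat \<bar>\<theta> z'\<bar> < nat \<bar>\<theta> z\<bar>" unfolding z' by (simp add: abs_mult)
    from less.hyps[OF this z'(1)] show False using \<open>\<theta> z' \<noteq> 0\<close> by simp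
  qed
qed

subsection \<open>Paths and chains in Cayley graphs\<close>

text \<open>Letters come from an abstract alphabet and get their values through
  \<open>\<sigma>\<close>, so that one word can be read in several groups;
  \<open>letter_value\<close> ties the alphabet to the group itself.\<close>

definition lval :: "('g, 'b) monoid_scheme \<Rightarrow> ('x \<Rightarrow> 'g) \<Rightarrow> 'x \<times> bool \<Rightarrow> 'g"
  where "lval G \<sigma> l = (if snd l then \<sigma> (fst l) else inv\<^bsub>G\<^esub> (\<sigma> (fst l)))"

primrec wval :: "('g, 'b) monoid_scheme \<Rightarrow> ('x \<Rightarrow> 'g) \<Rightarrow> ('x \<times> bool) list \<Rightarrow> 'g" where
  "wval G \<sigma> [] = \<one>\<^bsub>G\<^esub>"
| "wval G \<sigma> (l # u) = lval G \<sigma> l \<otimes>\<^bsub>G\<^esub> wval G \<sigma> u"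

definition linv :: "'x \<times> bool \<Rightarrow> 'x \<times> bool"
  where "linv l = (fst l, \<not> snd l)"

definition winv :: "('x \<times> bool) list \<Rightarrow> ('x \<times> bool) list"
  where "winv u = rev (map linv u)"

lemma linv_linv [simp]: "linv (linv l) = l" and fst_linv [simp]: "fst (linv l) = fst l"
  and snd_linv [simp]: "snd (linv l) = (\<not> snd l)"
  by (simp_all add: linv_def)

lemma winv_Nil [simp]: "winv [] = []" and winv_Cons: "winv (l # u) = winv u @ [linv l]"
  by (simp_all add: winv_def)

text \<open>The marking is total on the type, which spares side conditions on letters; in the
  application, letters outside the basis go to the identity.\<close>

locale marked_group = group G for G (structure) +
  fixes \<sigma> :: "'x \<Rightarrow> 'a"
  assumes \<sigma>_closed [simp, intro]: "\<sigma> x \<in> carrier G"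
begin

abbreviation lv where "lv \<equiv> lval G \<sigma>"
abbreviation wv where "wv \<equiv> wval G \<sigma>"

lemma lv_closed [simp, intro]: "lv l \<in> carrier G"
  by (simp add: lval_def)

lemma wv_closed [simp, intro]: "wv u \<in> carrier G"
  by (induction u) auto

lemma lv_linv [simp]: "lv (linv l) = inv (lv l)"
  by (simp add: lval_def)

lemma wv_append: "wv (u @ u') = wv u \<otimes> wv u'"
  by (induction u) (auto simp: m_assoc)

lemma wv_winv: "wv (winv u) = inv (wv u)"
  by (induction u) (auto simp: winv_Cons wv_append inv_mult_group)

text \<open>Vertices of the Cayley graph are group elements; an edge \<open>(g, x)\<close> runs from \<open>g\<close> to
  \<open>g \<otimes> \<sigma> x\<close>. A path that reads an inverse letter traverses its edge backwards.\<close>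

definition edge :: "'a \<Rightarrow> 'x \<times> bool \<Rightarrow> 'a \<times> 'x"
  where "edge v l = (if snd l then v else v \<otimes> inv (\<sigma> (fst l)), fst l)"

definition sg :: "'x \<times> bool \<Rightarrow> int"
  where "sg l = (if snd l then 1 else -1)"

definition tip :: "'a \<times> 'x \<Rightarrow> 'a"
  where "tip e = fst e \<otimes> \<sigma> (snd e)"

primrec ch :: "'a \<Rightarrow> ('x \<times> bool) list \<Rightarrow> ('a \<times> 'x \<Rightarrow>\<^sub>0 int)" where
  "ch v [] = 0"
| "ch v (l # u) = frag_cmul (sg l) (frag_of (edge v l)) + ch (v \<otimes> lv l) u"

text \<open>Kept apart from \<open>keys (ch v u)\<close>: an edge traversed in both directions may
  cancel in the chain, yet the path does not avoid it.\<close>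

primrec edges :: "'a \<Rightarrow> ('x \<times> bool) list \<Rightarrow> ('a \<times> 'x) set" where
  "edges v [] = {}"
| "edges v (l # u) = insert (edge v l) (edges (v \<otimes> lv l) u)"

definition bd :: "('a \<times> 'x \<Rightarrow>\<^sub>0 int) \<Rightarrow> ('a \<Rightarrow>\<^sub>0 int)"
  where "bd z = frag_extend (\<lambda>e. frag_of (tip e) - frag_of (fst e)) z"

definition shift :: "'a \<Rightarrow> 'a \<times> 'x \<Rightarrow> 'a \<times> 'x"
  where "shift g e = (g \<otimes> fst e, snd e)"

definition shc :: "'a \<Rightarrow> ('a \<times> 'x \<Rightarrow>\<^sub>0 int) \<Rightarrow> ('a \<times> 'x \<Rightarrow>\<^sub>0 int)"
  where "shc g z = frag_extend (\<lambda>e. frag_of (shift g e)) z"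

text \<open>The action of the integral group ring on chains; the values \<open>conv b z\<close> are
  the integral combinations of translates of \<open>z\<close>.\<close>

definition conv :: "('a \<Rightarrow>\<^sub>0 int) \<Rightarrow> ('a \<times> 'x \<Rightarrow>\<^sub>0 int) \<Rightarrow> ('a \<times> 'x \<Rightarrow>\<^sub>0 int)"
  where "conv b z = frag_extend (\<lambda>g. shc g z) b"

lemma sg_linv [simp]: "sg (linv l) = - sg l" and sg_cases: "sg l = 1 \<or> sg l = -1"
  by (simp_all add: sg_def)

lemma snd_edge [simp]: "snd (edge v l) = fst l"
  by (simp add: edge_def)

lemma edge_closed [simp]: "v \<in> carrier G \<Longrightarrow> fst (edge v l) \<in> carrier G"
  by (simp add: edge_def)

lemma edge_linv [simp]: "v \<in> carrier G \<Longrightarrow> edge (v \<otimes> lv l) (linv l) = edge v l"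
  by (simp add: edge_def lval_def m_assoc)

lemma tip_closed [simp]: "fst e \<in> carrier G \<Longrightarrow> tip e \<in> carrier G"
  by (simp add: tip_def)

lemma tip_edge: "v \<in> carrier G \<Longrightarrow> tip (edge v l) = (if snd l then v \<otimes> lv l else v)"
  and fst_edge: "v \<in> carrier G \<Longrightarrow> fst (edge v l) = (if snd l then v else v \<otimes> lv l)"
  by (simp_all add: tip_def edge_def lval_def m_assoc)

lemma finite_edges [simp]: "finite (edges v u)"
  by (induction u arbitrary: v) auto

lemma edges_append: "v \<in> carrier G \<Longrightarrow> edges v (u @ u') = edges v u \<union> edges (v \<otimes> wv u) u'"
  by (induction u arbitrary: v) (auto simp: m_assoc)

lemma ch_append: "v \<in> carrier G \<Longrightarrow> ch v (u @ u') = ch v u + ch (v \<otimes> wv u) u'"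
  by (induction u arbitrary: v) (auto simp: m_assoc algebra_simps)

lemma edges_winv: "v \<in> carrier G \<Longrightarrow> edges (v \<otimes> wv u) (winv u) = edges v u"
proof (induction u arbitrary: v)
  case (Cons l u)
  have 1: "v \<otimes> wv (l # u) = v \<otimes> lv l \<otimes> wv u" using Cons.prems by (simp add: m_assoc)
  have 2: "v \<otimes> lv l \<otimes> wv u \<otimes> wv (winv u) = v \<otimes> lv l" using Cons.prems by (simp add: m_assoc wv_winv)
  show ?case unfolding 1 winv_Cons using Cons 2 by (subst edges_append) auto
qed auto

lemma edges_closed: "v \<in> carrier G \<Longrightarrow> fst ` edges v u \<subseteq> carrier G"
  by (induction u arbitrary: v) auto

lemma snd_edges: "snd ` edges v u = fst ` set u"
  by (induction u arbitrary: v) auto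

lemma edges_subset: "v \<in> carrier G \<Longrightarrow> fst ` set u \<subseteq> S \<Longrightarrow> edges v u \<subseteq> carrier G \<times> S"
  by (induction u arbitrary: v) (auto simp: mem_Times_iff)

lemma keys_ch: "keys (ch v u) \<subseteq> edges v u"
proof (induction u arbitrary: v)
  case (Cons l u)
  show ?case using keys_add[of "frag_cmul (sg l) (frag_of (edge v l))" "ch (v \<otimes> lv l) u"] Cons[of "v \<otimes> lv l"]
    by (auto dest!: subsetD[OF keys_cmul])
qed auto

lemma bd_add: "bd (y + z) = bd y + bd z" and bd_diff: "bd (y - z) = bd y - bd z"
  and bd_0 [simp]: "bd 0 = 0"
  and bd_cmul: "bd (frag_cmul k z) = frag_cmul k (bd z)"
  by (simp_all add: bd_def frag_extend_add frag_extend_diff frag_extend_minus frag_extend_cmul)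

lemma bd_ch: "v \<in> carrier G \<Longrightarrow> bd (ch v u) = frag_of (v \<otimes> wv u) - frag_of v"
proof (induction u arbitrary: v)
  case (Cons l u)
  then show ?case
    by (auto simp: bd_add bd_cmul m_assoc) (auto simp: bd_def tip_edge fst_edge sg_def)
qed auto

text \<open>Chains form a torsion-free group, so the boundary may be divided as well. For
  \<open>n = 0\<close> nothing can be divided, but then \<open>z = 0\<close> and the cycle
  \<open>0\<close> serves.\<close>

lemma divisible_cycle:
  assumes "bd z = 0" "\<And>e. (n::int) dvd lookup z e"
  obtains z' where "bd z' = 0" "keys z' \<subseteq> keys z" "z = frag_cmul n z'"
proof (cases "n = 0")
  case True
  then have "z = 0" using assms(2) by (auto intro: poly_mapping_eqI)
  then show thesis using that[of 0] by simp
next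
  case False
  obtain y where y: "z = frag_cmul n y" "keys y \<subseteq> keys z" using frag_divide assms(2) by blast
  then have "frag_cmul n (bd y) = 0" using assms(1) by (simp add: bd_cmul)
  then show thesis using that y False by auto
qed

section \<open>Translation of chains and the action of the integral group ring\<close>

lemma shift_shift: "g \<in> carrier G \<Longrightarrow> h \<in> carrier G \<Longrightarrow> fst e \<in> carrier G \<Longrightarrow> shift g (shift h e) = shift (g \<otimes> h) e"
  by (simp add: shift_def m_assoc)

lemma shift_one [simp]: "fst e \<in> carrier G \<Longrightarrow> shift \<one> e = e"
  by (simp add: shift_def)

lemma shift_edge: "g \<in> carrier G \<Longrightarrow> v \<in> carrier G \<Longrightarrow> edge (g \<otimes> v) l = shift g (edge v l)"
  by (simp add: shift_def edge_def m_assoc)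

lemma shc_add: "shc g (y + z) = shc g y + shc g z" and shc_diff: "shc g (y - z) = shc g y - shc g z"
  and shc_0 [simp]: "shc g 0 = 0" and shc_of [simp]: "shc g (frag_of e) = frag_of (shift g e)"
  and shc_cmul: "shc g (frag_cmul k z) = frag_cmul k (shc g z)"
  by (simp_all add: shc_def frag_extend_add frag_extend_diff frag_extend_minus frag_extend_cmul)

lemma edges_shift: "g \<in> carrier G \<Longrightarrow> v \<in> carrier G \<Longrightarrow> edges (g \<otimes> v) u = shift g ` edges v u"
  by (induction u arbitrary: v) (auto simp: shift_edge m_assoc)

lemma ch_shift: "g \<in> carrier G \<Longrightarrow> v \<in> carrier G \<Longrightarrow> ch (g \<otimes> v) u = shc g (ch v u)"
  by (induction u arbitrary: v) (auto simp: shift_edge m_assoc shc_add shc_cmul)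

lemma lookup_shc:
  assumes "g \<in> carrier G" "fst ` keys z \<subseteq> carrier G" "fst e \<in> carrier G"
  shows "lookup (shc g z) e = lookup z (shift (inv g) e)"
proof -
  have s: "shift g i = e \<longleftrightarrow> i = shift (inv g) e" if "fst i \<in> carrier G" for i
    using assms that by (auto simp: shift_def prod_eq_iff inv_solve_left m_assoc[symmetric])
  have "lookup (shc g z) e = lin (\<lambda>i. if i = shift (inv g) e then 1 else 0) z"
    unfolding shc_def lookup_frag_extend by (rule lin_cong) (use s assms(2) in \<open>auto\<close>)
  also have "\<dots> = (\<Sum>i \<in> insert (shift (inv g) e) (keys z). lookup z i * (if i = shift (inv g) e then 1 else 0))"
    by (rule lin_superset) auto
  also have "\<dots> = (\<Sum>i \<in> insert (shift (inv g) e) (keys z). if i = shift (inv g) e then lookup z (shift (inv g) e) else 0)"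
    by (rule sum.cong) auto
  also have "\<dots> = lookup z (shift (inv g) e)" by (subst sum.delta) auto
  finally show ?thesis .
qed

lemma keys_shc:
  shows "keys (shc g z) \<subseteq> shift g ` keys z"
  unfolding shc_def using keys_frag_extend[of "\<lambda>e. frag_of (shift g e)" z] by auto

lemma bd_shc:
  assumes "g \<in> carrier G" "fst ` keys z \<subseteq> carrier G"
  shows "bd (shc g z) = frag_extend (\<lambda>v. frag_of (g \<otimes> v)) (bd z)"
proof -
  have "keys z \<subseteq> {e. fst e \<in> carrier G}" using assms by auto
  then show ?thesis
  proof (induction z rule: frag_induction)
    case (one e)
    then show ?case using assms(1) by (simp add: bd_def frag_extend_diff shift_def tip_def m_assoc)
  next
    case (diff a b)
    then show ?case by (simp add: shc_diff bd_diff frag_extend_diff)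
  qed auto
qed

lemma conv_add: "conv (a + b) z = conv a z + conv b z" and conv_diff: "conv (a - b) z = conv a z - conv b z"
  and conv_0 [simp]: "conv 0 z = 0" and conv_of [simp]: "conv (frag_of g) z = shc g z"
  and conv_cmul: "conv (frag_cmul k a) z = frag_cmul k (conv a z)"
  by (simp_all add: conv_def frag_extend_add frag_extend_diff frag_extend_minus frag_extend_cmul)

lemma keys_conv: "keys (conv b z) \<subseteq> (\<Union>g \<in> keys b. shift g ` keys z)"
  unfolding conv_def using keys_frag_extend[of "\<lambda>g. shc g z" b] keys_shc by fastforce

lemma lookup_conv:
  assumes "keys b \<subseteq> carrier G" "fst ` keys z \<subseteq> carrier G" "fst e \<in> carrier G"
  shows "lookup (conv b z) e = lin (\<lambda>g. lookup z (shift (inv g) e)) b"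
  unfolding conv_def lookup_frag_extend
  by (rule lin_cong) (use assms in \<open>auto simp: lookup_shc\<close>)

lemma bd_conv_cycle:
  assumes "keys b \<subseteq> carrier G" "fst ` keys z \<subseteq> carrier G" "bd z = 0"
  shows "bd (conv b z) = 0"
  using assms(1)
proof (induction b rule: frag_induction)
  case (one g)
  then show ?case using assms by (simp add: bd_shc)
next
  case (diff a b)
  then show ?case by (simp add: conv_diff bd_diff)
qed auto

end

subsection \<open>Gluing along a cut\<close>

context marked_group
begin

text \<open>The clause on closed subwords also excludes backtracking inside longer words. The word
  \<open>[l, linv l]\<close> satisfies it if \<open>l\<close> does not close up, hence the separate
  exclusion. Single letters of trivial value, that is loops, are allowed.\<close>

definition simple :: "('x \<times> bool) list \<Rightarrow> bool"
  where "simple w \<longleftrightarrow> w \<noteq> [] \<and> wv w = \<one> \<and> (\<forall>l. w \<noteq> [l, linv l]) \<and>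
    (\<forall>a b c. w = a @ b @ c \<longrightarrow> wv b = \<one> \<longrightarrow> b = [] \<or> a @ c = [])"

lemma edge_eq_cases:
  assumes "v \<in> carrier G" "p \<in> carrier G" "edge p l' = edge v l"
  shows "l' = l \<and> p = v \<or> l' = linv l \<and> p = v \<otimes> lv l"
proof (cases "snd l' = snd l")
  case True
  with assms have "l' = l" by (auto simp: edge_def prod_eq_iff)
  moreover have "p = v" using assms True by (auto simp: edge_def lval_def prod_eq_iff split: if_splits)
  ultimately show ?thesis by simp
next
  case False
  with assms have 1: "l' = linv l" by (auto simp: edge_def prod_eq_iff linv_def)
  have "p = v \<otimes> lv l" using assms False unfolding 1
    by (cases "snd l") (auto simp: edge_def lval_def m_assoc)
  then show ?thesis using 1 by simp
qed

text \<open>If the edge were traversed again in the same direction, \<open>l # c\<close> would be a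
  closed proper subword. In the opposite direction \<open>c\<close> would be closed, hence empty,
  which leaves the backtracking \<open>[l, l']\<close>.\<close>

lemma simple_edge_neq:
  assumes s: "simple w" and w: "w = a @ l # c @ l' # d" and v: "v \<in> carrier G"
  shows "edge (v \<otimes> wv (a @ l # c)) l' \<noteq> edge (v \<otimes> wv a) l"
proof
  assume "edge (v \<otimes> wv (a @ l # c)) l' = edge (v \<otimes> wv a) l"
  then consider "l' = l" "v \<otimes> wv (a @ l # c) = v \<otimes> wv a" |
      "l' = linv l" "v \<otimes> wv (a @ l # c) = v \<otimes> wv a \<otimes> lv l"
    using edge_eq_cases v by blast
  then show False
  proof cases
    case 1
    then have "wv (l # c) = \<one>" using v by (simp add: wv_append m_assoc)
    moreover have "w = a @ (l # c) @ (l' # d)" using w by simp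
    ultimately show False using s unfolding simple_def by blast
  next
    case 2
    then have "wv c = \<one>" using v by (simp add: wv_append m_assoc)
    moreover have "w = (a @ [l]) @ c @ (l' # d)" using w by simp
    ultimately have c: "c = []" using s unfolding simple_def by blast
    have "wv [l, l'] = \<one>" using 2 by simp
    moreover have "w = a @ [l, l'] @ d" using w c by simp
    ultimately have "a @ d = []" using s unfolding simple_def by blast
    then show False using s 2 w c unfolding simple_def by auto
  qed
qed

lemma edges_split_ex: "v \<in> carrier G \<Longrightarrow> e \<in> edges v u \<Longrightarrow> \<exists>a l b. u = a @ l # b \<and> e = edge (v \<otimes> wv a) l"
proof (induction u arbitrary: v)
  case (Cons l u)
  show ?case
  proof (cases "e = edge v l")
    case True
    then show ?thesis using Cons.prems by (intro exI[of _ "[]"] exI[of _ l] exI[of _ u]) simp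
  next
    case False
    then have "\<exists>a l' b. u = a @ l' # b \<and> e = edge (v \<otimes> lv l \<otimes> wv a) l'"
      using Cons.IH[of "v \<otimes> lv l"] Cons.prems by simp
    then obtain a l' b where "u = a @ l' # b" "e = edge (v \<otimes> lv l \<otimes> wv a) l'" by blast
    then show ?thesis using Cons.prems
      by (intro exI[of _ "l # a"] exI[of _ l'] exI[of _ b]) (simp add: m_assoc)
  qed
qed simp

lemma edges_split:
  assumes "v \<in> carrier G" "e \<in> edges v u"
  obtains a l b where "u = a @ l # b" "e = edge (v \<otimes> wv a) l"
  using edges_split_ex[OF assms] by blast

text \<open>No edge is repeated, so no other letter contributes to this coefficient.\<close>

lemma simple_lookup:
  assumes s: "simple w" and w: "w = a @ l # b" and v: "v \<in> carrier G"
  shows "lookup (ch v w) (edge (v \<otimes> wv a) l) = sg l"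
proof -
  let ?e = "edge (v \<otimes> wv a) l"
  have "?e \<notin> edges v a"
  proof
    assume "?e \<in> edges v a"
    then obtain c l' d where "a = c @ l' # d" "?e = edge (v \<otimes> wv c) l'" using edges_split v by blast
    then show False using simple_edge_neq[OF s, of c l' d l b v] w v by auto
  qed
  moreover have "?e \<notin> edges (v \<otimes> wv a \<otimes> lv l) b"
  proof
    assume "?e \<in> edges (v \<otimes> wv a \<otimes> lv l) b"
    then obtain c l' d where 1: "b = c @ l' # d" "?e = edge (v \<otimes> wv a \<otimes> lv l \<otimes> wv c) l'"
      using edges_split[of "v \<otimes> wv a \<otimes> lv l"] v by blast
    then show False using simple_edge_neq[OF s, of a l c l' d v] w v by (auto simp: wv_append m_assoc)
  qed
  ultimately have "lookup (ch v a) ?e = 0" "lookup (ch (v \<otimes> wv a \<otimes> lv l) b) ?e = 0"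
    using keys_ch by (auto simp flip: not_in_keys_iff_lookup_eq_zero)
  then show ?thesis using v by (simp add: w ch_append lookup_add)
qed

lemma simple_lookup_cases:
  assumes "simple w" "v \<in> carrier G" "e \<in> edges v w"
  shows "lookup (ch v w) e = 1 \<or> lookup (ch v w) e = -1"
  using assms simple_lookup sg_cases by (metis edges_split)

lemma keys_simple:
  assumes "simple w" "v \<in> carrier G"
  shows "keys (ch v w) = edges v w"
proof
  show "edges v w \<subseteq> keys (ch v w)"
  proof
    fix e assume "e \<in> edges v w"
    from simple_lookup_cases[OF assms this] show "e \<in> keys (ch v w)" by (auto simp: in_keys_iff)
  qed
qed (rule keys_ch)

end

section \<open>Closed paths evaluated in a second group\<close>

locale marked_pair = marked_group G \<sigma> + Q: marked_group Q \<rho>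
  for G :: "('a, 'c) monoid_scheme" (structure) and \<sigma> :: "'x \<Rightarrow> 'a"
    and Q :: "('q, 'd) monoid_scheme" and \<rho> :: "'x \<Rightarrow> 'q"
begin

text \<open>In topological terms: the fundamental groups of all components of \<open>U\<close> have
  trivial image in \<open>Q\<close>. In the applications \<open>Q\<close> is a quotient of the free
  group in which the relator dies, or the free group itself.\<close>

definition good :: "('a \<times> 'x) set \<Rightarrow> bool"
  where "good U \<longleftrightarrow> (\<forall>v \<in> carrier G. \<forall>u. edges v u \<subseteq> U \<longrightarrow> wv u = \<one> \<longrightarrow> Q.wv u = \<one>\<^bsub>Q\<^esub>)"

lemma goodD: "good U \<Longrightarrow> v \<in> carrier G \<Longrightarrow> edges v u \<subseteq> U \<Longrightarrow> wv u = \<one> \<Longrightarrow> Q.wv u = \<one>\<^bsub>Q\<^esub>"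
  by (auto simp: good_def)

text \<open>A proper closed subword can be cut out and both parts are shorter. A closed word without
  such a subword is empty, a backtracking, or simple; a simple one would give a nonzero
  cycle.\<close>

lemma good_forest:
  assumes forest: "\<And>z. bd z = 0 \<Longrightarrow> keys z \<subseteq> V \<Longrightarrow> z = 0"
  shows "good V"
proof -
  have "Q.wv u = \<one>\<^bsub>Q\<^esub>" if "v \<in> carrier G" "edges v u \<subseteq> V" "wv u = \<one>" for v u
    using that
  proof (induction "length u" arbitrary: u v rule: less_induct)
    case less
    show ?case
    proof (cases "\<exists>a b c. u = a @ b @ c \<and> wv b = \<one> \<and> b \<noteq> [] \<and> a @ c \<noteq> []")
      case True
      then obtain a b c where u: "u = a @ b @ c" "wv b = \<one>" "b \<noteq> []" "a @ c \<noteq> []" by blast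
      have ed: "edges v a \<subseteq> V" "edges (v \<otimes> wv a) b \<subseteq> V" "edges (v \<otimes> wv a) c \<subseteq> V"
        using less.prems u by (auto simp: edges_append m_assoc)
      have "Q.wv b = \<one>\<^bsub>Q\<^esub>" using less.hyps[of b "v \<otimes> wv a"] u ed less.prems by auto
      moreover have "Q.wv (a @ c) = \<one>\<^bsub>Q\<^esub>"
        using less.hyps[of "a @ c" v] u ed less.prems by (auto simp: edges_append wv_append)
      ultimately show ?thesis by (simp add: u Q.wv_append)
    next
      case False
      show ?thesis
      proof (cases "u = [] \<or> (\<exists>l. u = [l, linv l])")
        case True
        then show ?thesis by auto
      next
        case nt: False
        then have s: "simple u" using False less.prems unfolding simple_def by blast
        have "bd (ch v u) = 0" using less.prems by (simp add: bd_ch)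
        then have 0: "ch v u = 0" using forest keys_ch less.prems by blast
        obtain l b where "u = [] @ l # b" using nt by (cases u) auto
        from simple_lookup[OF s this less.prems(1)] have "sg l = 0" by (simp add: 0)
        then show ?thesis using sg_cases[of l] by simp
      qed
    qed
  qed
  then show ?thesis by (auto simp: good_def)
qed

text \<open>Cut a closed path into pieces \<open>a\<^sub>1, b\<^sub>1, a\<^sub>2, b\<^sub>2, \<dots>\<close> lying alternately in \<open>U\<close> and in \<open>V\<close>, and let
  \<open>C\<close> be the component of \<open>U \<inter> V\<close> that contains its start. For a sum of a cycle in \<open>U\<close> and a cycle in
  \<open>V\<close>, the part outside \<open>V\<close> has no boundary in \<open>C\<close>; by descent modulo powers of \<open>n\<close> this holds for
  every cycle in \<open>U \<union> V\<close>. Hence some \<open>a\<^sub>i\<close> ends in \<open>C\<close>, and joining this end to the start inside \<open>C\<close>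
  splits the path into two closed paths with fewer pieces.\<close>

lemma good_merge:
  fixes n :: int
  assumes U: "fst ` U \<subseteq> carrier G" and V: "fst ` V \<subseteq> carrier G" and n: "\<not> n dvd 1"
    and sep: "\<And>z. bd z = 0 \<Longrightarrow> keys z \<subseteq> U \<union> V \<Longrightarrow> \<exists>z1 z2 z'. bd z1 = 0 \<and> bd z2 = 0 \<and> bd z' = 0 \<and>
      keys z1 \<subseteq> U \<and> keys z2 \<subseteq> V \<and> keys z' \<subseteq> U \<union> V \<and> z = z1 + z2 + frag_cmul n z'"
    and gU: "good U" and gV: "good V"
  shows "good (U \<union> V)"
proof -
  \<comment> \<open>\<open>bs\<close> lists the pairs of consecutive pieces. Either member of a pair
    may be empty, so every path in \<open>U \<union> V\<close> has this form.\<close>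
  define cc :: "(('x \<times> bool) list \<times> ('x \<times> bool) list) list \<Rightarrow> ('x \<times> bool) list"
    where "cc bs = concat (map (\<lambda>(a, b). a @ b) bs)" for bs
  define ok where "ok v bs \<longleftrightarrow> (\<forall>bs1 a b bs2. bs = bs1 @ (a, b) # bs2 \<longrightarrow>
    edges (v \<otimes> wv (cc bs1)) a \<subseteq> U \<and> edges (v \<otimes> wv (cc bs1) \<otimes> wv a) b \<subseteq> V)" for v bs
  have cc_simps [simp]: "cc [] = []" "cc ((a, b) # bs) = a @ b @ cc bs" "cc (bs @ bs') = cc bs @ cc bs'"
    for a b bs bs' by (simp_all add: cc_def)
  have ok_Nil: "ok v []" for v by (simp add: ok_def)
  have ok_Cons: "ok v ((a, b) # bs) \<longleftrightarrow> edges v a \<subseteq> U \<and> edges (v \<otimes> wv a) b \<subseteq> V \<and> ok (v \<otimes> wv a \<otimes> wv b) bs"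
    if v: "v \<in> carrier G" for v a b bs
  proof
    assume L: "ok v ((a, b) # bs)"
    show "edges v a \<subseteq> U \<and> edges (v \<otimes> wv a) b \<subseteq> V \<and> ok (v \<otimes> wv a \<otimes> wv b) bs"
    proof (intro conjI)
      show "edges v a \<subseteq> U" "edges (v \<otimes> wv a) b \<subseteq> V"
        using L[unfolded ok_def, rule_format, of "[]" a b bs] v by auto
      show "ok (v \<otimes> wv a \<otimes> wv b) bs" unfolding ok_def
      proof (intro allI impI)
        fix bs1 c d bs2 assume "bs = bs1 @ (c, d) # bs2"
        then show "edges (v \<otimes> wv a \<otimes> wv b \<otimes> wv (cc bs1)) c \<subseteq> U \<and>
            edges (v \<otimes> wv a \<otimes> wv b \<otimes> wv (cc bs1) \<otimes> wv c) d \<subseteq> V"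
          using L[unfolded ok_def, rule_format, of "(a, b) # bs1" c d bs2] v
          by (simp add: wv_append m_assoc)
      qed
    qed
  next
    assume R: "edges v a \<subseteq> U \<and> edges (v \<otimes> wv a) b \<subseteq> V \<and> ok (v \<otimes> wv a \<otimes> wv b) bs"
    show "ok v ((a, b) # bs)" unfolding ok_def
    proof (intro allI impI)
      fix bs1 c d bs2 assume eq: "(a, b) # bs = bs1 @ (c, d) # bs2"
      show "edges (v \<otimes> wv (cc bs1)) c \<subseteq> U \<and> edges (v \<otimes> wv (cc bs1) \<otimes> wv c) d \<subseteq> V"
      proof (cases bs1)
        case Nil then show ?thesis using eq R v by auto
      next
        case (Cons x bs1')
        then have "bs = bs1' @ (c, d) # bs2" "x = (a, b)" using eq by auto
        then show ?thesis using R[unfolded ok_def] v Cons by (simp add: wv_append m_assoc)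
      qed
    qed
  qed
  have ok_append: "ok v (bs @ bs') \<longleftrightarrow> ok v bs \<and> ok (v \<otimes> wv (cc bs)) bs'" if "v \<in> carrier G" for v bs bs'
    using that by (induction bs arbitrary: v) (auto simp: ok_Nil ok_Cons wv_append m_assoc)
  have theta: "\<exists>bs1 a b bs2. bs = bs1 @ (a, b) # bs2 \<and> (\<exists>t. edges (v \<otimes> wv (cc bs1 @ a)) t \<subseteq> U \<inter> V \<and> wv (cc bs1 @ a @ t) = \<one>)"
    if v: "v \<in> carrier G" and ok: "ok v bs" and cl: "wv (cc bs) = \<one>" and ne: "bs \<noteq> []" for v bs
  proof -
    define C where "C = {v \<otimes> wv t | t. edges v t \<subseteq> U \<inter> V}"
    \<comment> \<open>\<open>c'\<close> is the coboundary of the indicator function of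
      \<open>C\<close>. Setting it to zero on \<open>V\<close> kills cycles in \<open>V\<close>; on
      \<open>U\<close> nothing changes, because \<open>C\<close> is closed under the edges of
      \<open>U \<inter> V\<close>.\<close>
    define c' :: "'a \<times> 'x \<Rightarrow> int" where "c' e = (if tip e \<in> C then 1 else 0) - (if fst e \<in> C then 1 else 0)" for e
    define c :: "'a \<times> 'x \<Rightarrow> int" where "c e = (if e \<in> V then 0 else c' e)" for e
    have c'_bd: "lin c' z = lin (\<lambda>v. if v \<in> C then 1 else 0) (bd z)" for z
      unfolding bd_def lin_frag_extend by (rule lin_cong) (simp add: c'_def lin_diff)
    have C_ext: "tip e \<in> C \<longleftrightarrow> fst e \<in> C" if e: "e \<in> U \<inter> V" for e
    proof
      have ec: "fst e \<in> carrier G" using e U by auto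
      { assume "fst e \<in> C"
        then obtain t where t: "fst e = v \<otimes> wv t" "edges v t \<subseteq> U \<inter> V" by (auto simp: C_def)
        have "edge (v \<otimes> wv t) (snd e, True) = e" using t by (auto simp: edge_def prod_eq_iff)
        then have "edges v (t @ [(snd e, True)]) \<subseteq> U \<inter> V" using t e v by (auto simp: edges_append)
        moreover have "tip e = v \<otimes> wv (t @ [(snd e, True)])" using t v by (simp add: tip_def wv_append lval_def m_assoc)
        ultimately show "tip e \<in> C" unfolding C_def by blast }
      { assume "tip e \<in> C"
        then obtain t where t: "tip e = v \<otimes> wv t" "edges v t \<subseteq> U \<inter> V" by (auto simp: C_def)
        have f: "fst e = v \<otimes> wv t \<otimes> inv (\<sigma> (snd e))" using t(1)[symmetric] ec by (simp add: tip_def m_assoc)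
        then have "edge (v \<otimes> wv t) (snd e, False) = e" by (auto simp: edge_def prod_eq_iff)
        then have "edges v (t @ [(snd e, False)]) \<subseteq> U \<inter> V" using t e v by (auto simp: edges_append)
        moreover have "fst e = v \<otimes> wv (t @ [(snd e, False)])" using f v by (simp add: wv_append lval_def m_assoc)
        ultimately show "fst e \<in> C" unfolding C_def by blast }
    qed
    have cU: "c e = c' e" if "e \<in> U" for e
      using C_ext that by (auto simp: c_def c'_def)
    have zero: "lin c z = 0" if "bd z = 0" "keys z \<subseteq> U \<union> V" for z
    proof (rule int_functional_zero_descent[OF n, of "{z. bd z = 0 \<and> keys z \<subseteq> U \<union> V}" "lin c"])
      fix z assume "z \<in> {z. bd z = 0 \<and> keys z \<subseteq> U \<union> V}"
      then obtain z1 z2 z' where z: "bd z1 = 0" "bd z' = 0" "keys z1 \<subseteq> U" "keys z2 \<subseteq> V"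
        "keys z' \<subseteq> U \<union> V" "z = z1 + z2 + frag_cmul n z'" using sep by blast
      have "lin c z1 = lin c' z1" by (rule lin_cong) (use cU z in auto)
      also have "\<dots> = 0" using z by (simp add: c'_bd)
      finally have 1: "lin c z1 = 0" .
      have 2: "lin c z2 = 0" by (rule lin_zero) (use z in \<open>auto simp: c_def\<close>)
      show "\<exists>z' \<in> {z. bd z = 0 \<and> keys z \<subseteq> U \<union> V}. lin c z = n * lin c z'"
        using z 1 2 by (auto simp: lin_add lin_cmul)
    qed (use that in auto)
    have edges_cc: "edges v (cc bs) \<subseteq> U \<union> V" if "ok v bs" "v \<in> carrier G" for v bs
      using that
    proof (induction bs arbitrary: v)
      case (Cons ab bs)
      obtain a b where ab: "ab = (a, b)" by (cases ab)
      have e: "edges v a \<subseteq> U" "edges (v \<otimes> wv a) b \<subseteq> V" "ok (v \<otimes> wv a \<otimes> wv b) bs"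
        using Cons.prems by (simp_all add: ab ok_Cons)
      have "edges (v \<otimes> wv a \<otimes> wv b) (cc bs) \<subseteq> U \<union> V"
        using Cons.IH[OF e(3)] Cons.prems(2) by simp
      moreover have "edges v (cc (ab # bs)) = edges v a \<union> (edges (v \<otimes> wv a) b \<union> edges (v \<otimes> wv a \<otimes> wv b) (cc bs))"
        using Cons.prems(2) by (simp add: ab edges_append)
      ultimately show ?case using e by blast
    qed simp
    \<comment> \<open>If no piece in \<open>U\<close> ends in \<open>C\<close>, each of them
      contributes only minus the indicator at its start. All contributions have the same sign, so
      that of the base point cannot cancel.\<close>
    have count: "lin c (ch p (cc bs)) = 0 - (\<Sum>i<length bs. if p \<otimes> wv (cc (take i bs)) \<in> C then 1 else 0)"
      if "ok p bs" "p \<in> carrier G" "\<And>bs1 a b bs2. bs = bs1 @ (a, b) # bs2 \<Longrightarrow> p \<otimes> wv (cc bs1) \<otimes> wv a \<notin> C" for p bs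
      using that
    proof (induction bs arbitrary: p)
      case (Cons ab bs)
      obtain a b where ab: "ab = (a, b)" by (cases ab)
      have e: "edges p a \<subseteq> U" "edges (p \<otimes> wv a) b \<subseteq> V" "ok (p \<otimes> wv a \<otimes> wv b) bs"
        using Cons.prems by (auto simp: ab ok_Cons)
      have "lin c (ch p a) = lin c' (ch p a)"
        by (rule lin_cong) (use cU keys_ch[of p a] e in blast)
      also have "\<dots> = (if p \<otimes> wv a \<in> C then 1 else 0) - (if p \<in> C then 1 else 0)"
        using Cons.prems by (simp add: c'_bd bd_ch lin_diff)
      finally have 0: "lin c (ch p a) = (if p \<otimes> wv a \<in> C then 1 else 0) - (if p \<in> C then 1 else 0)" .
      have "p \<otimes> wv a \<notin> C" using Cons.prems(3)[of "[]" a b bs] Cons.prems(2) by (simp add: ab)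
      with 0 have 1: "lin c (ch p a) = 0 - (if p \<in> C then 1 else 0)" by simp
      have 2: "lin c (ch (p \<otimes> wv a) b) = 0"
        by (rule lin_zero) (use keys_ch[of "p \<otimes> wv a" b] e in \<open>auto simp: c_def\<close>)
      have 3: "lin c (ch (p \<otimes> wv a \<otimes> wv b) (cc bs)) =
          0 - (\<Sum>i<length bs. if p \<otimes> wv a \<otimes> wv b \<otimes> wv (cc (take i bs)) \<in> C then 1 else 0)"
      proof (rule Cons.IH[OF e(3)])
        fix bs1 c d bs2 assume "bs = bs1 @ (c, d) # bs2"
        then show "p \<otimes> wv a \<otimes> wv b \<otimes> wv (cc bs1) \<otimes> wv c \<notin> C"
          using Cons.prems(3)[of "(a, b) # bs1" c d bs2] Cons.prems(2) by (simp add: ab wv_append m_assoc)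
      qed (use Cons.prems in auto)
      show ?case using Cons.prems(2) 1 2 3
        by (simp add: ab ch_append lin_add sum.lessThan_Suc_shift wv_append m_assoc del: sum.lessThan_Suc)
    qed simp
    show ?thesis
    proof (rule ccontr)
      assume no: "\<not> ?thesis"
      have "v \<otimes> wv (cc bs1) \<otimes> wv a \<notin> C" if bs: "bs = bs1 @ (a, b) # bs2" for bs1 a b bs2
      proof
        assume "v \<otimes> wv (cc bs1) \<otimes> wv a \<in> C"
        then obtain t where t: "v \<otimes> wv (cc bs1) \<otimes> wv a = v \<otimes> wv t" "edges v t \<subseteq> U \<inter> V" by (auto simp: C_def)
        have q: "wv (cc bs1 @ a) = wv t" using t(1) v by (simp add: m_assoc wv_append)
        have "edges (v \<otimes> wv (cc bs1 @ a)) (winv t) \<subseteq> U \<inter> V" using q t v by (simp add: edges_winv)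
        moreover have "wv (cc bs1 @ a @ winv t) = \<one>" using q by (simp add: wv_append wv_winv m_assoc[symmetric])
        ultimately show False using no bs by blast
      qed
      from count[OF ok v this] have "lin c (ch v (cc bs)) = 0 - (\<Sum>i<length bs. if v \<otimes> wv (cc (take i bs)) \<in> C then 1 else 0)" .
      moreover have "lin c (ch v (cc bs)) = 0"
        using zero keys_ch[of v "cc bs"] edges_cc[OF ok v] cl v by (auto simp: bd_ch)
      ultimately have "(\<Sum>i<length bs. if v \<otimes> wv (cc (take i bs)) \<in> C then 1 else 0 :: int) = 0" by simp
      then have "\<forall>i \<in> {..<length bs}. (if v \<otimes> wv (cc (take i bs)) \<in> C then 1 else 0 :: int) = 0"
        by (subst (asm) sum_nonneg_eq_0_iff) auto
      then have "v \<notin> C" using ne v by (force dest: bspec[of _ _ 0] split: if_splits)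
      moreover have "v \<in> C" unfolding C_def using v by (auto intro!: exI[of _ "[]"])
      ultimately show False by simp
    qed
  qed
  have main: "Q.wv (cc bs) = \<one>\<^bsub>Q\<^esub>" if "v \<in> carrier G" "ok v bs" "wv (cc bs) = \<one>" for v bs
    using that
  proof (induction "length bs" arbitrary: v bs rule: less_induct)
    case less
    show ?case
    proof (cases "bs = []")
      case False
      obtain bs1 a b bs2 t where bs: "bs = bs1 @ (a, b) # bs2"
        and t: "edges (v \<otimes> wv (cc bs1 @ a)) t \<subseteq> U \<inter> V" "wv (cc bs1 @ a @ t) = \<one>"
        using theta[OF less.prems False] by blast
      have v: "v \<in> carrier G" by fact
      have ok: "ok v bs1" "edges (v \<otimes> wv (cc bs1)) a \<subseteq> U" "edges (v \<otimes> wv (cc bs1 @ a)) b \<subseteq> V"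
        "ok (v \<otimes> wv (cc bs1 @ a @ b)) bs2"
        using less.prems(2) v unfolding bs by (auto simp: ok_append ok_Cons wv_append m_assoc)
      have t2: "wv (cc bs1 @ a) = wv (winv t)"
        using t(2) inv_equality[of "wv (cc bs1 @ a)" "wv t"] by (simp add: wv_append wv_winv m_assoc)
      \<comment> \<open>Rotation attaches \<open>a @ t\<close>, which lies in \<open>U\<close>, to
        the leading piece of \<open>bs1\<close>. No new pair arises, so this loop has fewer pairs
        than \<open>bs\<close>.\<close>
      have first: "Q.wv (cc bs1 @ a @ t) = \<one>\<^bsub>Q\<^esub>"
      proof (cases bs1)
        case Nil
        have "edges v (a @ t) \<subseteq> U" using t ok v Nil by (auto simp: edges_append)
        then show ?thesis using goodD[OF gU v] t Nil by simp
      next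
        case (Cons cd bs1')
        obtain c d where cd: "cd = (c, d)" by (cases cd)
        define p where "p = v \<otimes> wv (cc bs1)"
        have p: "p \<in> carrier G" using v by (simp add: p_def)
        have pat: "p \<otimes> wv (a @ t) = v" using t(2) v by (simp add: p_def wv_append m_assoc)
        have okc: "edges v c \<subseteq> U" "edges (v \<otimes> wv c) d \<subseteq> V" "ok (v \<otimes> wv c \<otimes> wv d) bs1'"
          using ok(1) v by (auto simp: Cons cd ok_Cons)
        have "edges p (a @ t @ c) \<subseteq> U"
          using ok(2) t(1) okc(1) p pat v by (auto simp: edges_append p_def m_assoc wv_append)
        moreover have "p \<otimes> wv (a @ t @ c) = v \<otimes> wv c"
          using pat[symmetric] p by (simp add: wv_append m_assoc)
        ultimately have "ok p ((a @ t @ c, d) # bs1')" using okc p by (simp add: ok_Cons)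
        moreover have "wv (cc ((a @ t @ c, d) # bs1')) = \<one>"
        proof -
          have "wv (a @ t) \<otimes> wv (cc bs1) = \<one>"
            by (rule inv_comm[OF _ wv_closed wv_closed]) (use t(2) in \<open>simp add: wv_append m_assoc\<close>)
          then show ?thesis by (simp add: Cons cd wv_append m_assoc)
        qed
        ultimately have "Q.wv (cc ((a @ t @ c, d) # bs1')) = \<one>\<^bsub>Q\<^esub>"
          using less.hyps[of "(a @ t @ c, d) # bs1'" p] p by (simp add: bs Cons)
        then have "Q.wv (a @ t) \<otimes>\<^bsub>Q\<^esub> Q.wv (cc bs1) = \<one>\<^bsub>Q\<^esub>" by (simp add: Cons cd Q.wv_append Q.m_assoc)
        then have "Q.wv (cc bs1) \<otimes>\<^bsub>Q\<^esub> Q.wv (a @ t) = \<one>\<^bsub>Q\<^esub>" by (rule Q.inv_comm[OF _ Q.wv_closed Q.wv_closed])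
        then show ?thesis by (simp add: Q.wv_append)
      qed
      define q where "q = v \<otimes> wv (cc bs1 @ a @ b)"
      have q: "q \<in> carrier G" using v by (simp add: q_def)
      have tot: "wv (winv t) \<otimes> wv b \<otimes> wv (cc bs2) = \<one>"
        using less.prems(3) t2 by (simp add: bs wv_append m_assoc[symmetric])
      have rot: "wv (cc bs2) \<otimes> (wv (winv t) \<otimes> wv b) = \<one>"
        by (rule inv_comm[OF _ m_closed[OF wv_closed wv_closed] wv_closed]) (use tot in \<open>simp add: m_assoc\<close>)
      have eb: "edges (q \<otimes> wv (cc bs2)) (winv t @ b) \<subseteq> V"
      proof -
        have "q \<otimes> wv (cc bs2) = v" using less.prems(3) v by (simp add: q_def bs wv_append m_assoc)
        moreover have "v = v \<otimes> wv (cc bs1 @ a) \<otimes> wv t" using t(2) v by (simp add: wv_append m_assoc)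
        ultimately have "edges (q \<otimes> wv (cc bs2)) (winv t) \<subseteq> U \<inter> V"
          using t(1) edges_winv[of "v \<otimes> wv (cc bs1 @ a)" t] v by simp
        then show ?thesis using ok(3) v t2 \<open>q \<otimes> wv (cc bs2) = v\<close> by (auto simp: edges_append)
      qed
      \<comment> \<open>Symmetrically, \<open>winv t @ b\<close> lies in \<open>V\<close> and is
        absorbed by the last piece of \<open>bs2\<close>.\<close>
      have second: "Q.wv (winv t @ b @ cc bs2) = \<one>\<^bsub>Q\<^esub>"
      proof (cases bs2 rule: rev_cases)
        case Nil
        have "edges q (winv t @ b) \<subseteq> V" using eb q Nil by simp
        then show ?thesis using goodD[OF gV q, of "winv t @ b"] tot Nil by (simp add: wv_append)
      next
        case (snoc bs2' cd)
        obtain c d where cd: "cd = (c, d)" by (cases cd)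
        have okc: "ok q bs2'" "edges (q \<otimes> wv (cc bs2')) c \<subseteq> U" "edges (q \<otimes> wv (cc bs2') \<otimes> wv c) d \<subseteq> V"
          using ok(4) q by (auto simp: q_def[symmetric] snoc cd ok_append ok_Cons)
        have "edges (q \<otimes> wv (cc bs2') \<otimes> wv c) (d @ winv t @ b) \<subseteq> V"
          using okc(3) eb q by (simp add: edges_append snoc cd wv_append m_assoc)
        then have "ok q (bs2' @ [(c, d @ winv t @ b)])" using okc q by (simp add: ok_append ok_Cons ok_Nil)
        moreover have "wv (cc (bs2' @ [(c, d @ winv t @ b)])) = \<one>"
          using rot by (simp add: snoc cd wv_append m_assoc)
        ultimately have "Q.wv (cc (bs2' @ [(c, d @ winv t @ b)])) = \<one>\<^bsub>Q\<^esub>"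
          using less.hyps[of "bs2' @ [(c, d @ winv t @ b)]" q] q by (simp add: bs snoc)
        then have "Q.wv (cc bs2) \<otimes>\<^bsub>Q\<^esub> Q.wv (winv t @ b) = \<one>\<^bsub>Q\<^esub>"
          by (simp add: snoc cd Q.wv_append Q.m_assoc)
        then have "Q.wv (winv t @ b) \<otimes>\<^bsub>Q\<^esub> Q.wv (cc bs2) = \<one>\<^bsub>Q\<^esub>" by (rule Q.inv_comm[OF _ Q.wv_closed Q.wv_closed])
        then show ?thesis by (simp add: Q.wv_append Q.m_assoc)
      qed
      have "Q.wv (cc bs) = Q.wv (cc bs1 @ a @ t) \<otimes>\<^bsub>Q\<^esub> Q.wv (winv t @ b @ cc bs2)"
        by (simp add: bs Q.wv_append Q.wv_winv Q.m_assoc Q.inv_cancel_left)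
      then show ?thesis using first second by simp
    qed simp
  qed
  have dec: "\<exists>bs. u = cc bs \<and> ok v bs" if "v \<in> carrier G" "edges v u \<subseteq> U \<union> V" for u v
    using that
  proof (induction u arbitrary: v)
    case Nil
    then show ?case by (intro exI[of _ "[]"]) (simp add: ok_Nil)
  next
    case (Cons l u)
    then have "\<exists>bs. u = cc bs \<and> ok (v \<otimes> lv l) bs" by (intro Cons.IH) auto
    then obtain bs where bs: "u = cc bs" "ok (v \<otimes> lv l) bs" by blast
    show ?case
    proof (cases "edge v l \<in> U")
      case True
      then show ?thesis using bs Cons.prems by (intro exI[of _ "([l], []) # bs"]) (simp add: ok_Cons)
    next
      case False
      then show ?thesis using bs Cons.prems by (intro exI[of _ "([], [l]) # bs"]) (simp add: ok_Cons)
    qed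
  qed
  show ?thesis unfolding good_def using main dec by blast
qed

end

subsection \<open>Translates of a simple cycle\<close>

text \<open>The form in which extreme coefficients are compared: some product of \<open>A\<close>
  and \<open>P\<close> is attained by a single pair, so nothing can cancel there.\<close>

definition unique_products :: "('g, 'b) monoid_scheme \<Rightarrow> bool"
  where "unique_products G \<longleftrightarrow> (\<forall>A P. finite A \<longrightarrow> finite P \<longrightarrow> A \<noteq> {} \<longrightarrow> P \<noteq> {} \<longrightarrow>
    A \<subseteq> carrier G \<longrightarrow> P \<subseteq> carrier G \<longrightarrow>
    (\<exists>g \<in> A. \<exists>p \<in> P. \<forall>g' \<in> A. \<forall>p' \<in> P. g' \<otimes>\<^bsub>G\<^esub> p' = g \<otimes>\<^bsub>G\<^esub> p \<longrightarrow> g' = g \<and> p' = p))"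

text \<open>In the application \<open>n\<close> is the characteristic of the coefficient ring,
  possibly \<open>0\<close>, and \<open>Q\<close> is the quotient by a normal subgroup containing
  the value of \<open>w\<close>. The cycle is read from the identity.\<close>

locale cell_system = marked_pair G \<sigma> Q \<rho>
  for G :: "('a, 'c) monoid_scheme" (structure) and \<sigma> :: "'x \<Rightarrow> 'a"
    and Q :: "('q, 'd) monoid_scheme" and \<rho> :: "'x \<Rightarrow> 'q" +
  fixes w :: "('x \<times> bool) list" and n :: int
  assumes simple_w: "simple w" and Q_w: "Q.wv w = \<one>\<^bsub>Q\<^esub>"
    and up: "unique_products G" and n: "\<not> n dvd 1"
begin

definition \<omega> where "\<omega> = ch \<one> w"

definition Vw where "Vw = {wv a | a b. w = a @ b}"

definition cells :: "'a set \<Rightarrow> ('a \<times> 'x) set"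
  where "cells A = (\<Union>g \<in> A. shift g ` keys \<omega>)"

text \<open>The elements whose translate of the simple cycle shares a vertex with it. There are
  finitely many, which makes \<open>card (\<Delta> \<inter> H)\<close> a measure even for infinite
  \<open>H\<close>.\<close>

definition \<Delta> where "\<Delta> = {p \<otimes> inv q | p q. p \<in> Vw \<and> q \<in> Vw}"

text \<open>The support of \<open>b\<close> is confined to \<open>A\<close> itself, so a partition
  of \<open>A\<close> splits a cycle modulo \<open>n\<close> into cycles of the parts.\<close>

definition spanned :: "'a set \<Rightarrow> bool"
  where "spanned A \<longleftrightarrow> (\<forall>z. bd z = 0 \<longrightarrow> keys z \<subseteq> cells A \<longrightarrow>
    (\<exists>b. keys b \<subseteq> A \<and> (\<forall>e. n dvd lookup (z - conv b \<omega>) e)))"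

lemma wv_w [simp]: "wv w = \<one>" and w_ne: "w \<noteq> []"
  using simple_w by (auto simp: simple_def)

lemma keys_\<omega>: "keys \<omega> = edges \<one> w"
  unfolding \<omega>_def by (rule keys_simple[OF simple_w]) simp

lemma keys_\<omega>_ne: "keys \<omega> \<noteq> {}"
  using w_ne unfolding keys_\<omega> by (cases w) auto

lemma lookup_\<omega>: "e \<in> keys \<omega> \<Longrightarrow> lookup \<omega> e = 1 \<or> lookup \<omega> e = -1"
  unfolding keys_\<omega> unfolding \<omega>_def by (rule simple_lookup_cases[OF simple_w]) auto

lemma bd_\<omega> [simp]: "bd \<omega> = 0"
  by (simp add: \<omega>_def bd_ch)

lemma \<omega>_closed: "e \<in> keys \<omega> \<Longrightarrow> fst e \<in> carrier G" and \<omega>_closed': "fst ` keys \<omega> \<subseteq> carrier G"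
  using edges_closed[of \<one> w] by (auto simp: keys_\<omega>)

lemma Vw_closed: "p \<in> Vw \<Longrightarrow> p \<in> carrier G"
  by (auto simp: Vw_def)

lemma finite_Vw: "finite Vw"
proof -
  have "Vw \<subseteq> (\<lambda>i. wv (take i w)) ` {..length w}"
  proof
    fix p assume "p \<in> Vw"
    then obtain a b where "p = wv a" "w = a @ b" by (auto simp: Vw_def)
    then show "p \<in> (\<lambda>i. wv (take i w)) ` {..length w}" by (intro image_eqI[of _ _ "length a"]) auto
  qed
  then show ?thesis by (rule finite_subset) simp
qed

lemma one_Vw: "\<one> \<in> Vw"
  unfolding Vw_def by (rule CollectI, rule exI[of _ "[]"], rule exI[of _ w]) simp

lemma edge_Vw: "w = a @ l # b \<Longrightarrow> wv a \<in> Vw \<and> wv a \<otimes> lv l \<in> Vw"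
proof (intro conjI)
  assume w: "w = a @ l # b"
  show "wv a \<in> Vw" unfolding Vw_def using w by blast
  have "w = (a @ [l]) @ b" using w by simp
  then have "wv (a @ [l]) \<in> Vw" unfolding Vw_def by blast
  then show "wv a \<otimes> lv l \<in> Vw" by (simp add: wv_append)
qed

lemma \<omega>_Vw: assumes "e \<in> keys \<omega>" shows "fst e \<in> Vw" "tip e \<in> Vw"
proof -
  obtain a l b where "w = a @ l # b" "e = edge (\<one> \<otimes> wv a) l"
    using edges_split[of \<one> e w] assms unfolding keys_\<omega> by blast
  then show "fst e \<in> Vw" "tip e \<in> Vw" using edge_Vw[of a l b] by (auto simp: tip_edge fst_edge)
qed

lemma cells_closed: "A \<subseteq> carrier G \<Longrightarrow> fst ` cells A \<subseteq> carrier G"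
  using \<omega>_closed by (fastforce simp: cells_def shift_def)

lemma cellsI: "g \<in> A \<Longrightarrow> e \<in> keys \<omega> \<Longrightarrow> shift g e \<in> cells A"
  by (auto simp: cells_def)

lemma cellsE:
  assumes "x \<in> cells A" obtains g e where "g \<in> A" "e \<in> keys \<omega>" "x = shift g e"
  using assms unfolding cells_def by blast

lemma cells_Un: "cells (A \<union> B) = cells A \<union> cells B" and cells_mono: "A \<subseteq> B \<Longrightarrow> cells A \<subseteq> cells B"
  by (auto simp: cells_def)

lemma keys_conv_cells: "keys b \<subseteq> A \<Longrightarrow> keys (conv b \<omega>) \<subseteq> cells A"
  using keys_conv[of b \<omega>] unfolding cells_def by blast

text \<open>Splitting the coefficients along the partition yields the two cycles that
  \<open>good_merge\<close> asks for; the remainder is \<open>n\<close> times a cycle supported in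
  the union.\<close>

lemma good_merge_cells:
  assumes A: "A \<subseteq> carrier G" and B: "B \<subseteq> carrier G" and disj: "A \<inter> B = {}"
    and sp: "spanned (A \<union> B)" and good: "good (cells A)" "good (cells B)"
  shows "good (cells (A \<union> B))"
  unfolding cells_Un
proof (rule good_merge[OF cells_closed[OF A] cells_closed[OF B] n _ good])
  fix z assume z: "bd z = 0" "keys z \<subseteq> cells A \<union> cells B"
  then obtain b where b: "keys b \<subseteq> A \<union> B" "\<And>e. n dvd lookup (z - conv b \<omega>) e"
    using sp by (auto simp: spanned_def cells_Un)
  define b1 b2 where "b1 = frag_restrict A b" and "b2 = frag_restrict B b"
  have b12: "b = b1 + b2"
    by (rule poly_mapping_eqI) (use b(1) disj in \<open>auto simp: b1_def b2_def lookup_add in_keys_iff subset_eq\<close>)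
  have k: "keys b1 \<subseteq> A" "keys b2 \<subseteq> B" by (auto simp: b1_def b2_def keys_frag_restrict)
  have c: "bd (conv b1 \<omega>) = 0" "bd (conv b2 \<omega>) = 0" using k A B \<omega>_closed' by (auto intro!: bd_conv_cycle)
  have kc: "keys (conv b1 \<omega>) \<subseteq> cells A" "keys (conv b2 \<omega>) \<subseteq> cells B" using k keys_conv_cells by auto
  have "bd (z - conv b \<omega>) = 0" using z c by (simp add: b12 conv_add bd_diff bd_add)
  then obtain z' where z': "bd z' = 0" "keys z' \<subseteq> keys (z - conv b \<omega>)" "z - conv b \<omega> = frag_cmul n z'"
    using divisible_cycle b(2) by blast
  have "keys (conv b \<omega>) \<subseteq> cells A \<union> cells B" using keys_conv_cells[OF b(1)] by (simp add: cells_Un)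
  then have "keys z' \<subseteq> cells A \<union> cells B" using z'(2) keys_diff[of z "conv b \<omega>"] z(2) by blast
  moreover have "z = conv b1 \<omega> + conv b2 \<omega> + frag_cmul n z'"
    using z'(3) by (simp add: b12 conv_add algebra_simps)
  ultimately show "\<exists>z1 z2 z'. bd z1 = 0 \<and> bd z2 = 0 \<and> bd z' = 0 \<and> keys z1 \<subseteq> cells A \<and> keys z2 \<subseteq> cells B \<and>
      keys z' \<subseteq> cells A \<union> cells B \<and> z = z1 + z2 + frag_cmul n z'"
    using c kc z'(1) by blast
qed

section \<open>Translates, and the simple cycle alone\<close>

lemma good_translate:
  assumes A: "A \<subseteq> carrier G" and t: "t \<in> carrier G" and g: "good (cells A)"
  shows "good (cells ((\<otimes>) t ` A))"
  unfolding good_def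
proof (intro ballI allI impI)
  fix v u assume v: "v \<in> carrier G" and e: "edges v u \<subseteq> cells ((\<otimes>) t ` A)" and c: "wv u = \<one>"
  have "edges (inv t \<otimes> v) u \<subseteq> cells A"
  proof -
    have "shift (inv t) e \<in> cells A" if ee: "e \<in> edges v u" for e
    proof -
      have "e \<in> cells ((\<otimes>) t ` A)" using e ee by blast
      then obtain g i where gi: "g \<in> A" "i \<in> keys \<omega>" "e = shift (t \<otimes> g) i"
        by (blast elim: cellsE)
      then have "shift (inv t) e = shift g i"
        using A t \<omega>_closed[of i] by (auto simp: shift_def m_assoc inv_cancel_left)
      then show ?thesis using gi cellsI by simp
    qed
    then show ?thesis using edges_shift[of "inv t" v u] t v by auto
  qed
  then show "Q.wv u = \<one>\<^bsub>Q\<^esub>" using goodD[OF g _ _ c, of "inv t \<otimes> v"] t v by simp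
qed

text \<open>Two prefixes with the same end point differ by a closed subword, which is empty or all
  of \<open>w\<close>, and \<open>w\<close> is trivial in \<open>Q\<close>.\<close>

lemma prefix_value_eq:
  assumes "w = a @ b" "w = c @ d" "wv a = wv c"
  shows "Q.wv a = Q.wv c"
proof -
  have main: "Q.wv a = Q.wv c" if w: "w = a @ b" "w = c @ d" "wv a = wv c" and m: "c = a @ m" for a b c d m
  proof -
    have "wv m = \<one>" using w m by (simp add: wv_append)
    moreover have "w = a @ m @ d" using w m by simp
    ultimately have "m = [] \<or> a @ d = []" using simple_w unfolding simple_def by blast
    then show ?thesis
    proof
      assume "a @ d = []"
      then show ?thesis using w m Q_w by simp
    qed (use m in simp)
  qed
  consider m where "c = a @ m" | m where "a = c @ m"
    using assms(1,2) by (metis append_eq_append_conv2)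
  then show ?thesis using main assms by cases metis+
qed

text \<open>Values of prefixes in \<open>Q\<close> give a well defined function on the vertices of
  the cycle. Every letter read along the cycle multiplies this function accordingly, so a closed
  path returns to the same value.\<close>

lemma good_single: "good (cells {\<one>})"
proof -
  have E: "cells {\<one>} = keys \<omega>" using \<omega>_closed by (auto simp: cells_def)
  have step: "\<exists>c d c' d'. w = c @ d \<and> w = c' @ d' \<and> v = wv c \<and> v \<otimes> lv l = wv c' \<and> Q.wv c \<otimes>\<^bsub>Q\<^esub> Q.lv l = Q.wv c'"
    if v: "v \<in> carrier G" and e: "edge v l \<in> keys \<omega>" for v l
  proof -
    obtain c l' d where w: "w = c @ l' # d" "edge v l = edge (\<one> \<otimes> wv c) l'"
      using edges_split[of \<one> "edge v l" w] e unfolding keys_\<omega> by blast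
    then consider "l = l'" "v = wv c" | "l = linv l'" "v = wv c \<otimes> lv l'"
      using edge_eq_cases[of "wv c" v l l'] v by auto
    then show ?thesis
    proof cases
      case 1
      show ?thesis
        by (rule exI[of _ c], rule exI[of _ "l' # d"], rule exI[of _ "c @ [l']"], rule exI[of _ d])
          (use 1 w in \<open>simp add: wv_append Q.wv_append\<close>)
    next
      case 2
      show ?thesis
        by (rule exI[of _ "c @ [l']"], rule exI[of _ "d"], rule exI[of _ c], rule exI[of _ "l' # d"])
          (use 2 w in \<open>simp add: wv_append Q.wv_append m_assoc Q.m_assoc\<close>)
    qed
  qed
  have path: "\<exists>c d. w = c @ d \<and> v \<otimes> wv u = wv c \<and> Q.wv a \<otimes>\<^bsub>Q\<^esub> Q.wv u = Q.wv c"
    if "w = a @ b" "v = wv a" "edges v u \<subseteq> keys \<omega>" for a b v u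
    using that
  proof (induction u arbitrary: a b v)
    case Nil
    then show ?case by auto
  next
    case (Cons l u)
    then obtain c d c' d' where 1: "w = c @ d" "w = c' @ d'" "v = wv c" "v \<otimes> lv l = wv c'"
      "Q.wv c \<otimes>\<^bsub>Q\<^esub> Q.lv l = Q.wv c'" using step[of v l] wv_closed[of a] by (metis edges.simps(2) insert_subset)
    obtain c2 d2 where 2: "w = c2 @ d2" "v \<otimes> lv l \<otimes> wv u = wv c2" "Q.wv c' \<otimes>\<^bsub>Q\<^esub> Q.wv u = Q.wv c2"
      using Cons.IH[OF 1(2,4)] Cons.prems(3) by (metis edges.simps(2) insert_subset)
    have "Q.wv a = Q.wv c" using prefix_value_eq Cons.prems 1 by metis
    then have "Q.wv a \<otimes>\<^bsub>Q\<^esub> Q.wv (l # u) = Q.wv c2" using 1(5) 2(3) by (simp add: Q.m_assoc[symmetric])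
    moreover have "v \<otimes> wv (l # u) = wv c2" using 1(3) 2(2) by (simp add: m_assoc)
    ultimately show ?case using 2(1) by blast
  qed
  show ?thesis unfolding good_def E
  proof (intro ballI allI impI)
    fix v u assume v: "v \<in> carrier G" and e: "edges v u \<subseteq> keys \<omega>" and c: "wv u = \<one>"
    show "Q.wv u = \<one>\<^bsub>Q\<^esub>"
    proof (cases u)
      case (Cons l u')
      then have "edge v l \<in> keys \<omega>" using e by simp
      then obtain a b where ab: "w = a @ b" "v = wv a" using step[OF v, of l] by blast
      obtain a' b' where 1: "w = a' @ b'" "v \<otimes> wv u = wv a'" "Q.wv a \<otimes>\<^bsub>Q\<^esub> Q.wv u = Q.wv a'"
        using path[OF ab e] by blast
      have "Q.wv a' = Q.wv a" using prefix_value_eq[OF 1(1) ab(1)] 1(2) ab c v by simp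
      then show ?thesis using 1(3) Q.l_cancel_one[of "Q.wv a" "Q.wv u"] by simp
    qed simp
  qed
qed

section \<open>Translates that meet\<close>

lemma \<Delta>_closed: "\<Delta> \<subseteq> carrier G"
  by (auto simp: \<Delta>_def Vw_closed)

lemma finite_\<Delta>: "finite \<Delta>"
proof -
  have "\<Delta> = (\<lambda>(p, q). p \<otimes> inv q) ` (Vw \<times> Vw)" by (auto simp: \<Delta>_def)
  then show ?thesis by (simp add: finite_Vw)
qed

lemma \<Delta>_vertex:
  assumes "g \<in> carrier G" "h \<in> carrier G" "p \<in> Vw" "q \<in> Vw" "g \<otimes> p = h \<otimes> q"
  shows "inv g \<otimes> h \<in> \<Delta>"
proof -
  have "h = g \<otimes> p \<otimes> inv q" using assms Vw_closed by (simp add: m_assoc)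
  then have "inv g \<otimes> h = p \<otimes> inv q" using assms(1,3,4) Vw_closed by (simp add: m_assoc inv_cancel_left)
  then show ?thesis using assms by (auto simp: \<Delta>_def)
qed

lemma \<Delta>_edge:
  assumes "g \<in> carrier G" "h \<in> carrier G" "e \<in> keys \<omega>" "i \<in> keys \<omega>" "shift g e = shift h i"
  shows "inv g \<otimes> h \<in> \<Delta>"
  by (rule \<Delta>_vertex[of g h "fst e" "fst i"]) (use assms \<omega>_Vw in \<open>auto simp: shift_def\<close>)

lemma edge_in_cell:
  assumes v: "v \<in> carrier G" and g: "g \<in> carrier G" and e: "e \<in> keys \<omega>" and eq: "edge v l = shift g e"
  obtains p q where "p \<in> Vw" "q \<in> Vw" "v = g \<otimes> p" "v \<otimes> lv l = g \<otimes> q"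
proof (cases "snd l")
  case True
  then have "v = g \<otimes> fst e" "v \<otimes> lv l = g \<otimes> tip e"
    using eq tip_edge[OF v, of l] fst_edge[OF v, of l] g \<omega>_closed[OF e] by (auto simp: shift_def tip_def m_assoc)
  then show thesis using that \<omega>_Vw[OF e] by blast
next
  case False
  then have "v = g \<otimes> tip e" "v \<otimes> lv l = g \<otimes> fst e"
    using eq tip_edge[OF v, of l] fst_edge[OF v, of l] g \<omega>_closed[OF e] by (auto simp: shift_def tip_def m_assoc)
  then show thesis using that \<omega>_Vw[OF e] by blast
qed

section \<open>Components of a union of translates\<close>

context
  fixes H H' assumes H: "subgroup H G" and H': "H' = generate G (\<Delta> \<inter> H)"
begin

lemma component_subgroup: "subgroup H' G" and component_subset: "H' \<subseteq> H"
  and component_\<Delta>: "\<Delta> \<inter> H' = \<Delta> \<inter> H"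
proof -
  show 1: "subgroup H' G" unfolding H' using \<Delta>_closed by (intro generate_is_subgroup) auto
  show 2: "H' \<subseteq> H" unfolding H' by (intro generate_subgroup_incl H) auto
  have "\<Delta> \<inter> H \<subseteq> H'" unfolding H' by (auto intro: generate.incl)
  then show "\<Delta> \<inter> H' = \<Delta> \<inter> H" using 2 by auto
qed

text \<open>Consecutive edges of a path lie in translates by \<open>k\<close> and \<open>g\<close>
  with a common vertex, so \<open>inv k \<otimes> g\<close> is in
  \<open>\<Delta> \<inter> H\<close>. Hence a path never leaves the translates by one left coset of
  \<open>H'\<close>.\<close>

lemma good_component:
  assumes "good (cells H')"
  shows "good (cells H)"
  unfolding good_def
proof (intro ballI allI impI)
  interpret H: subgroup H G by (rule H)
  interpret H': subgroup H' G by (rule component_subgroup)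
  have stay: "edges v u \<subseteq> cells ((\<otimes>) h ` H')"
    if "h \<in> H" "k \<in> (\<otimes>) h ` H'" "v = k \<otimes> p" "p \<in> Vw" "edges v u \<subseteq> cells H" for h k p v u
    using that(2-5)
  proof (induction u arbitrary: k v p)
    case (Cons l u)
    obtain x where x: "x \<in> H'" "k = h \<otimes> x" using Cons.prems by auto
    have k: "k \<in> carrier G" "k \<in> H" using x that(1) component_subset by auto
    have v: "v \<in> carrier G" using k Cons.prems Vw_closed by auto
    obtain g e where g: "g \<in> H" "e \<in> keys \<omega>" "edge v l = shift g e" 
      using Cons.prems(4) cellsE[of "edge v l" H] by (metis edges.simps(2) insert_subset)
    obtain p' q where p': "p' \<in> Vw" "q \<in> Vw" "v = g \<otimes> p'" "v \<otimes> lv l = g \<otimes> q"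
      using edge_in_cell[OF v _ g(2,3)] g(1) by auto
    have "inv k \<otimes> g \<in> \<Delta>" using \<Delta>_vertex[OF k(1) _ Cons.prems(3) p'(1)] g(1) p'(3) Cons.prems(2) by auto
    then have "inv k \<otimes> g \<in> H'" unfolding H' using k g by (intro generate.incl) auto
    then have "x \<otimes> (inv k \<otimes> g) \<in> H'" using x by auto
    moreover have "h \<otimes> (x \<otimes> (inv k \<otimes> g)) = g" using x that(1) g k by (simp add: m_assoc[symmetric])
    ultimately have gh: "g \<in> (\<otimes>) h ` H'" by force
    have "edges (v \<otimes> lv l) u \<subseteq> cells ((\<otimes>) h ` H')"
      using Cons.IH[OF gh p'(4) p'(2)] Cons.prems(4) by auto
    moreover have "edge v l \<in> cells ((\<otimes>) h ` H')" using cellsI[OF gh g(2)] g(3) by simp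
    ultimately show ?case by simp
  qed simp
  fix v u assume v: "v \<in> carrier G" and e: "edges v u \<subseteq> cells H" and c: "wv u = \<one>"
  show "Q.wv u = \<one>\<^bsub>Q\<^esub>"
  proof (cases u)
    case (Cons l u')
    then obtain h i where h: "h \<in> H" "i \<in> keys \<omega>" "edge v l = shift h i" 
      using e cellsE[of "edge v l" H] Cons by (metis edges.simps(2) insert_subset)
    then obtain p where p: "p \<in> Vw" "v = h \<otimes> p" using edge_in_cell[OF v _ h(2,3)] by auto
    have "h \<in> (\<otimes>) h ` H'" using h by (intro image_eqI[of _ _ \<one>]) auto
    then have "edges v u \<subseteq> cells ((\<otimes>) h ` H')" using stay[OF h(1) _ p(2,1) e] by blast
    then show ?thesis using goodD[OF good_translate[OF H'.subset _ assms, of h] v _ c] h(1) H.mem_carrier by blast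
  qed simp
qed

lemma spanned_component:
  assumes "spanned H"
  shows "spanned H'"
  unfolding spanned_def
proof (intro allI impI)
  interpret H: subgroup H G by (rule H)
  interpret H': subgroup H' G by (rule component_subgroup)
  fix z assume z: "bd z = 0" "keys z \<subseteq> cells H'"
  then obtain b where b: "keys b \<subseteq> H" "\<And>e. n dvd lookup (z - conv b \<omega>) e"
    using assms cells_mono[OF component_subset] unfolding spanned_def by blast
  define b1 b2 where "b1 = frag_restrict H' b" and "b2 = frag_restrict (- H') b"
  have b12: "b = b1 + b2" by (rule poly_mapping_eqI) (auto simp: b1_def b2_def lookup_add)
  have k1: "keys b1 \<subseteq> H'" and k2: "keys b2 \<subseteq> H - H'" using b(1) by (auto simp: b1_def b2_def keys_frag_restrict)
  have disj: "cells H' \<inter> cells (H - H') = {}"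
  proof (rule ccontr)
    assume "cells H' \<inter> cells (H - H') \<noteq> {}"
    then obtain x where "x \<in> cells H'" "x \<in> cells (H - H')" by blast
    then obtain g h e i where gh: "g \<in> H'" "h \<in> H - H'" "e \<in> keys \<omega>" "i \<in> keys \<omega>" "shift g e = shift h i"
      by (metis cellsE)
    then have "inv g \<otimes> h \<in> \<Delta>" by (intro \<Delta>_edge) auto
    then have "inv g \<otimes> h \<in> H'" unfolding H' using gh component_subset by (intro generate.incl) auto
    then have "g \<otimes> (inv g \<otimes> h) \<in> H'" using gh by auto
    moreover have "g \<otimes> (inv g \<otimes> h) = h" using gh by (simp add: inv_cancel_left)
    ultimately show False using gh by simp
  qed
  have "n dvd lookup (z - conv b1 \<omega>) e" for e
  proof (cases "e \<in> cells H'")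
    case True
    then have "e \<notin> keys (conv b2 \<omega>)" using disj keys_conv_cells[OF k2] by blast
    then have "lookup (z - conv b1 \<omega>) e = lookup (z - conv b \<omega>) e"
      by (simp add: b12 conv_add lookup_minus lookup_add not_in_keys_iff_lookup_eq_zero)
    then show ?thesis using b(2) by simp
  next
    case False
    then have "e \<notin> keys z" "e \<notin> keys (conv b1 \<omega>)" using z keys_conv_cells[OF k1] by auto
    then show ?thesis by (simp add: lookup_minus not_in_keys_iff_lookup_eq_zero)
  qed
  then show "\<exists>b. keys b \<subseteq> H' \<and> (\<forall>e. n dvd lookup (z - conv b \<omega>) e)" using k1 by blast
qed

end

section \<open>Coefficients modulo \<open>n\<close> and extreme levels\<close>

lemma spanned_reduced:
  assumes "spanned A" "bd z = 0" "keys z \<subseteq> cells A"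
  obtains b where "keys b \<subseteq> A" "\<And>e. n dvd lookup (z - conv b \<omega>) e" "\<And>g. g \<in> keys b \<Longrightarrow> \<not> n dvd lookup b g"
proof -
  obtain b where b: "keys b \<subseteq> A" "\<And>e. n dvd lookup (z - conv b \<omega>) e" using assms unfolding spanned_def by blast
  define b0 where "b0 = frag_restrict {g. \<not> n dvd lookup b g} b"
  have "n dvd lookup (b - b0) g" for g by (auto simp: b0_def lookup_minus)
  then obtain y where y: "b - b0 = frag_cmul n y" using frag_divide by metis
  have "b = b0 + frag_cmul n y" using y by (simp add: algebra_simps)
  then have c: "conv b0 \<omega> = conv b \<omega> - frag_cmul n (conv y \<omega>)" by (simp add: conv_add conv_cmul)
  have "n dvd lookup (z - conv b0 \<omega>) e" for e
  proof -
    have "lookup (z - conv b0 \<omega>) e = lookup (z - conv b \<omega>) e + n * lookup (conv y \<omega>) e"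
      by (simp add: c lookup_minus)
    then show ?thesis using b(2)[of e] by simp
  qed
  moreover have "keys b0 \<subseteq> A" "\<And>g. g \<in> keys b0 \<Longrightarrow> \<not> n dvd lookup b0 g"
    using b(1) by (auto simp: b0_def keys_frag_restrict)
  ultimately show thesis using that by blast
qed

text \<open>Only one translate from the support of \<open>b\<close> contains this edge, so there is
  no second summand.\<close>

lemma lookup_conv_unique:
  assumes b: "keys b \<subseteq> carrier G" and g: "g \<in> keys b" and e: "e \<in> keys \<omega>"
    and uniq: "\<And>h i. h \<in> keys b \<Longrightarrow> i \<in> keys \<omega> \<Longrightarrow> shift h i = shift g e \<Longrightarrow> h = g"
  shows "lookup (conv b \<omega>) (shift g e) = lookup b g * lookup \<omega> e"
proof -
  have gc: "g \<in> carrier G" and ec: "fst e \<in> carrier G" using b g \<omega>_closed e by auto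
  have "lookup (conv b \<omega>) (shift g e) = lin (\<lambda>h. lookup \<omega> (shift (inv h) (shift g e))) b"
    by (rule lookup_conv[OF b \<omega>_closed']) (use gc ec in \<open>simp add: shift_def\<close>)
  also have "\<dots> = (\<Sum>h \<in> keys b. if h = g then lookup b g * lookup \<omega> e else 0)"
    unfolding lin_def
  proof (rule sum.cong[OF refl])
    fix h assume h: "h \<in> keys b"
    show "lookup b h * lookup \<omega> (shift (inv h) (shift g e)) = (if h = g then lookup b g * lookup \<omega> e else 0)"
    proof (cases "h = g")
      case True
      then show ?thesis using gc ec by (simp add: shift_shift)
    next
      case False
      have hc: "h \<in> carrier G" using h b by auto
      have "shift h (shift (inv h) (shift g e)) = shift g e"
        using hc gc ec by (simp add: shift_def inv_cancel_left)
      then have "shift (inv h) (shift g e) \<notin> keys \<omega>" using uniq[OF h] False by blast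
      then show ?thesis using False by (simp add: not_in_keys_iff_lookup_eq_zero)
    qed
  qed
  also have "\<dots> = lookup b g * lookup \<omega> e" using g by simp
  finally show ?thesis .
qed

text \<open>A product of a coefficient of top level and an edge of top level that is unique among such
  products survives in \<open>conv b \<omega>\<close>.\<close>

lemma top_level_bound:
  fixes \<phi> f :: "'a \<Rightarrow> int"
  assumes H: "subgroup H G" and f: "\<And>h p. h \<in> H \<Longrightarrow> p \<in> Vw \<Longrightarrow> f (h \<otimes> p) = \<phi> h + f p"
    and z: "keys z \<subseteq> cells {h \<in> H. \<phi> h \<le> j}"
    and b: "keys b \<subseteq> H" "\<And>e. n dvd lookup (z - conv b \<omega>) e" "\<And>g. g \<in> keys b \<Longrightarrow> \<not> n dvd lookup b g"
    and g: "g \<in> keys b"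
  shows "\<phi> g \<le> j"
proof (rule ccontr)
  interpret H: subgroup H G by (rule H)
  assume "\<not> \<phi> g \<le> j"
  define J where "J = Max (\<phi> ` keys b)"
  have J: "\<phi> h \<le> J" if "h \<in> keys b" for h using that by (simp add: J_def)
  have "J > j" using J[OF g] \<open>\<not> \<phi> g \<le> j\<close> by simp
  \<comment> \<open>Translation preserves labels, so one label is fixed and edges are compared
    through their origins.\<close>
  obtain p0 x where px: "(p0, x) \<in> keys \<omega>" using keys_\<omega>_ne by fastforce
  define P where "P = {p. (p, x) \<in> keys \<omega>}"
  have finP: "finite P" using finite_subset[of P "fst ` keys \<omega>"] by (force simp: P_def)
  have Pne: "P \<noteq> {}" using px by (auto simp: P_def)
  have PV: "P \<subseteq> Vw" using \<omega>_Vw by (force simp: P_def)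
  define M where "M = Max (f ` P)"
  have M: "f p \<le> M" if "p \<in> P" for p using that finP by (simp add: M_def)
  define A where "A = {h \<in> keys b. \<phi> h = J}"
  define P' where "P' = {p \<in> P. f p = M}"
  have "J \<in> \<phi> ` keys b" unfolding J_def using g by (intro Max_in) auto
  then have "A \<noteq> {}" by (auto simp: A_def)
  have "M \<in> f ` P" unfolding M_def using finP Pne by (intro Max_in) auto
  then have "P' \<noteq> {}" by (auto simp: P'_def)
  have "finite A" "finite P'" using finP by (auto simp: A_def P'_def)
  moreover have "A \<subseteq> carrier G" using b(1) by (auto simp: A_def)
  moreover have "P' \<subseteq> carrier G" using PV Vw_closed by (auto simp: P'_def)
  ultimately obtain g0 p where gp: "g0 \<in> A" "p \<in> P'"
    and u: "\<And>g' p'. g' \<in> A \<Longrightarrow> p' \<in> P' \<Longrightarrow> g' \<otimes> p' = g0 \<otimes> p \<Longrightarrow> g' = g0"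
    using up[unfolded unique_products_def, rule_format, of A P'] \<open>A \<noteq> {}\<close> \<open>P' \<noteq> {}\<close> by metis
  have g0: "g0 \<in> keys b" "\<phi> g0 = J" "g0 \<in> H" and p: "(p, x) \<in> keys \<omega>" "f p = M" "p \<in> Vw"
    using gp b(1) PV by (auto simp: A_def P'_def P_def)
  \<comment> \<open>Levels add up, so a product equal to one of top factors has top factors itself.
    Uniqueness among top factors is thus uniqueness among all factors that can occur.\<close>
  have level: "\<phi> h = J \<and> f q = M" if "h \<in> H" "\<phi> h \<le> J" "(q, x) \<in> keys \<omega>" "h \<otimes> q = g0 \<otimes> p" for h q
  proof -
    have "q \<in> P" using that by (simp add: P_def)
    moreover have "\<phi> h + f q = J + M" using f[of h q] f[of g0 p] that g0 p \<open>q \<in> P\<close> PV by auto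
    ultimately show ?thesis using M[of q] that(2) by linarith
  qed
  have l: "lookup (conv b \<omega>) (shift g0 (p, x)) = lookup b g0 * lookup \<omega> (p, x)"
  proof (rule lookup_conv_unique[OF _ g0(1) p(1)])
    fix h i assume hi: "h \<in> keys b" "i \<in> keys \<omega>" "shift h i = shift g0 (p, x)"
    then obtain q where q: "i = (q, x)" "h \<otimes> q = g0 \<otimes> p" by (cases i) (auto simp: shift_def)
    then have "\<phi> h = J \<and> f q = M" using level[of h q] hi b(1) J by auto
    then show "h = g0" using u[of h q] hi q by (auto simp: A_def P'_def P_def)
  qed (use b(1) in auto)
  have "shift g0 (p, x) \<notin> keys z"
  proof
    assume "shift g0 (p, x) \<in> keys z"
    then have "shift g0 (p, x) \<in> cells {h \<in> H. \<phi> h \<le> j}" using z by blast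
    then obtain h i where "h \<in> {h \<in> H. \<phi> h \<le> j}" "i \<in> keys \<omega>" "shift g0 (p, x) = shift h i"
      by (rule cellsE)
    then have hi: "h \<in> H" "\<phi> h \<le> j" "i \<in> keys \<omega>" "shift h i = shift g0 (p, x)" by simp_all
    then obtain q where q: "i = (q, x)" "h \<otimes> q = g0 \<otimes> p" by (cases i) (auto simp: shift_def)
    then show False using level[of h q] hi \<open>J > j\<close> by auto
  qed
  then have "lookup (z - conv b \<omega>) (shift g0 (p, x)) = - (lookup b g0 * lookup \<omega> (p, x))"
    using l by (simp add: lookup_minus not_in_keys_iff_lookup_eq_zero)
  then have "n dvd lookup b g0 * lookup \<omega> (p, x)" using b(2)[of "shift g0 (p, x)"] by simp
  then have "n dvd lookup b g0" using lookup_\<omega>[OF p(1)] by auto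
  then show False using b(3)[OF g0(1)] by simp
qed

text \<open>Reduced coefficients for spanning in \<open>H\<close> already have their support in the
  interval: \<open>top_level_bound\<close> for \<open>\<phi>\<close> bounds it above, for
  \<open>- \<phi>\<close> below.\<close>

lemma spanned_interval:
  fixes \<phi> f :: "'a \<Rightarrow> int"
  assumes H: "subgroup H G" and f: "\<And>h p. h \<in> H \<Longrightarrow> p \<in> Vw \<Longrightarrow> f (h \<otimes> p) = \<phi> h + f p" and sp: "spanned H"
  shows "spanned {h \<in> H. i \<le> \<phi> h \<and> \<phi> h \<le> j}"
  unfolding spanned_def
proof (intro allI impI)
  fix z assume z: "bd z = 0" "keys z \<subseteq> cells {h \<in> H. i \<le> \<phi> h \<and> \<phi> h \<le> j}"
  have "keys z \<subseteq> cells H" using z(2) cells_mono[of "{h \<in> H. i \<le> \<phi> h \<and> \<phi> h \<le> j}" H] by auto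
  then obtain b where b: "keys b \<subseteq> H" "\<And>e. n dvd lookup (z - conv b \<omega>) e" "\<And>g. g \<in> keys b \<Longrightarrow> \<not> n dvd lookup b g"
    using spanned_reduced[OF sp z(1)] by blast
  have "\<phi> g \<le> j" if "g \<in> keys b" for g
    by (rule top_level_bound[OF H f _ b that])
      (use z(2) cells_mono[of "{h \<in> H. i \<le> \<phi> h \<and> \<phi> h \<le> j}" "{h \<in> H. \<phi> h \<le> j}"] in \<open>auto\<close>)
  moreover have "- \<phi> g \<le> - i" if "g \<in> keys b" for g
    by (rule top_level_bound[OF H _ _ b that, of "\<lambda>v. - f v" "\<lambda>h. - \<phi> h"])
      (use f z(2) cells_mono[of "{h \<in> H. i \<le> \<phi> h \<and> \<phi> h \<le> j}" "{h \<in> H. - \<phi> h \<le> - i}"] in \<open>auto\<close>)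
  ultimately have "keys b \<subseteq> {h \<in> H. i \<le> \<phi> h \<and> \<phi> h \<le> j}" using b(1) by fastforce
  then show "\<exists>b. keys b \<subseteq> {h \<in> H. i \<le> \<phi> h \<and> \<phi> h \<le> j} \<and> (\<forall>e. n dvd lookup (z - conv b \<omega>) e)" using b(2) by blast
qed

end

subsection \<open>A homomorphism to the integers\<close>

text \<open>Gaussian elimination: equation \<open>j\<close> eliminates the unknown \<open>k\<close>.
  Cross-multiplication keeps the coefficients integral, and \<open>y\<close> rescales the other
  unknowns by \<open>A j k\<close> to make up for it.\<close>

lemma underdetermined_system:
  fixes A :: "'j \<Rightarrow> 'i \<Rightarrow> int"
  assumes "finite J" "finite I" "card J < card I"
  shows "\<exists>x. (\<exists>i \<in> I. x i \<noteq> 0) \<and> (\<forall>j \<in> J. (\<Sum>i \<in> I. A j i * x i) = 0)"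
  using assms
proof (induction J arbitrary: I A rule: finite_induct)
  case empty
  then obtain i where "i \<in> I" by fastforce
  then show ?case by (intro exI[of _ "\<lambda>_. 1"]) auto
next
  case (insert j J)
  show ?case
  proof (cases "\<forall>i \<in> I. A j i = 0")
    case True
    have "card J < card I" using insert by simp
    then obtain x where "\<exists>i \<in> I. x i \<noteq> 0" "\<forall>j \<in> J. (\<Sum>i \<in> I. A j i * x i) = 0"
      using insert.IH[OF insert.prems(1)] by blast
    then show ?thesis using True by (intro exI[of _ x]) simp
  next
    case False
    then obtain k where k: "k \<in> I" "A j k \<noteq> 0" by blast
    define I' where "I' = I - {k}"
    have I: "I = insert k I'" "k \<notin> I'" "finite I'" using k insert.prems by (auto simp: I'_def)
    have "card J < card I'" using insert k by (simp add: I'_def)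
    from insert.IH[OF I(3) this, of "\<lambda>j' i. A j k * A j' i - A j' k * A j i"]
    obtain x where x: "\<exists>i \<in> I'. x i \<noteq> 0"
      "\<And>j'. j' \<in> J \<Longrightarrow> (\<Sum>i \<in> I'. (A j k * A j' i - A j' k * A j i) * x i) = 0" by blast
    define y where "y i = (if i = k then - (\<Sum>i \<in> I'. A j i * x i) else A j k * x i)" for i
    have sum: "(\<Sum>i \<in> I. A j' i * y i) = (\<Sum>i \<in> I'. (A j k * A j' i - A j' k * A j i) * x i)" for j'
    proof -
      have "(\<Sum>i \<in> I. A j' i * y i) = - (A j' k * (\<Sum>i \<in> I'. A j i * x i)) + (\<Sum>i \<in> I'. A j' i * (A j k * x i))"
        using I(2,3) unfolding I(1) by (auto simp: y_def intro!: sum.cong)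
      also have "\<dots> = (\<Sum>i \<in> I'. (A j k * A j' i - A j' k * A j i) * x i)"
        by (simp add: sum_distrib_left sum_subtractf algebra_simps)
      finally show ?thesis .
    qed
    have "(\<Sum>i \<in> I. A j' i * y i) = 0" if "j' \<in> insert j J" for j'
      using that x(2) unfolding sum by auto
    moreover have "\<exists>i \<in> I. y i \<noteq> 0"
    proof -
      obtain i where "i \<in> I'" "x i \<noteq> 0" using x(1) by blast
      then show ?thesis using k I by (intro bexI[of _ i]) (auto simp: y_def)
    qed
    ultimately show ?thesis by blast
  qed
qed

section \<open>Directions at the vertices of the simple cycle\<close>

context cell_system
begin

text \<open>The ends of edges of the simple cycle at \<open>p\<close>; a loop counts twice, once for
  each way of reading it.\<close>

definition dirs :: "'a \<Rightarrow> ('x \<times> bool) set"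
  where "dirs p = {l. edge p l \<in> keys \<omega>}"

lemma dirs_step: "p \<in> carrier G \<Longrightarrow> l \<in> dirs p \<Longrightarrow> p \<otimes> lv l \<in> Vw"
  using \<omega>_Vw[of "edge p l"] by (auto simp: dirs_def tip_edge fst_edge split: if_splits)

lemma finite_dirs: "finite (dirs p)"
proof (rule finite_subset)
  show "dirs p \<subseteq> (snd ` keys \<omega>) \<times> UNIV"
    by (force simp: dirs_def)
qed simp

lemma dirs_forward: "w = a @ l # b \<Longrightarrow> l \<in> dirs (wv a)"
  and dirs_backward: "w = a @ l # b \<Longrightarrow> linv l \<in> dirs (wv a \<otimes> lv l)"
proof -
  assume "w = a @ l # b"
  then have "edge (wv a) l \<in> edges \<one> w" by (simp add: edges_append)
  then show "l \<in> dirs (wv a)" "linv l \<in> dirs (wv a \<otimes> lv l)" by (simp_all add: dirs_def keys_\<omega>)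
qed

text \<open>One direction continues \<open>w\<close>, the other is the inverse of the preceding
  letter, which at the base point is the last letter of \<open>w\<close>. They differ because a
  simple word does not backtrack, not even cyclically.\<close>

lemma two_dirs:
  assumes "p \<in> Vw"
  obtains l l' where "l \<in> dirs p" "l' \<in> dirs p" "l \<noteq> l'"
proof -
  obtain a b where ab: "p = wv a" "w = a @ b" using assms unfolding Vw_def by blast
  show thesis
  proof (cases "a = [] \<or> b = []")
    case True
    then have p: "p = \<one>" using ab wv_w by (metis append_Nil2 wval.simps(1))
    obtain l c where lc: "w = [] @ l # c" using w_ne by (cases w) auto
    obtain c' m where cm: "w = c' @ m # []" using w_ne by (metis append_butlast_last_id)
    have "wv c' \<otimes> lv m = \<one>" using wv_w unfolding cm by (simp add: wv_append)
    then have 1: "l \<in> dirs p" "linv m \<in> dirs p" using dirs_forward[OF lc] dirs_backward[OF cm] p by simp_all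
    have "l \<noteq> linv m"
    proof
      assume lm: "l = linv m"
      show False
      proof (cases c')
        case Nil
        then have "l = m" using lc cm by simp
        then show False using lm by (auto simp: linv_def prod_eq_iff)
      next
        case (Cons l2 c2)
        then have w: "w = [l] @ c2 @ [linv l]" using lc cm lm by simp
        then have "lv l \<otimes> (wv c2 \<otimes> inv (lv l)) = \<one>" using wv_w by (simp add: wv_append)
        then have "wv c2 = \<one>"
          using inv_comm[of "lv l" "wv c2 \<otimes> inv (lv l)"] by (simp add: m_assoc)
        then have "c2 = [] \<or> [l] @ [linv l] = []" using w simple_w unfolding simple_def by blast
        then show False using w simple_w unfolding simple_def by auto
      qed
    qed
    then show thesis using that 1 by blast
  next
    case False
    then obtain a' m l b' where w: "a = a' @ [m]" "b = l # b'" by (metis append_butlast_last_id neq_Nil_conv)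
    have "w = a @ l # b'" "w = a' @ m # b" using ab w by auto
    then have 1: "l \<in> dirs p" "linv m \<in> dirs p" using dirs_forward[of a l b'] dirs_backward[of a' m b] ab w
      by (simp_all add: wv_append)
    have "l \<noteq> linv m"
    proof
      assume lm: "l = linv m"
      have "w = a' @ [m, linv m] @ b'" using ab w lm by simp
      moreover have "wv [m, linv m] = \<one>" by simp
      ultimately have "[m, linv m] = [] \<or> a' @ b' = []" using simple_w unfolding simple_def by blast
      then show False using simple_w ab w lm unfolding simple_def by auto
    qed
    then show thesis using that 1 by blast
  qed
qed

text \<open>If \<open>h\<close> permuted \<open>Vw\<close>, each of its elements would be a product
  of \<open>\<one>\<close> and of \<open>h\<close> with elements of \<open>Vw\<close>, so no product
  of \<open>{\<one>, h}\<close> and \<open>Vw\<close> would be unique.\<close>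

lemma Vw_not_invariant:
  assumes h: "h \<in> carrier G" "h \<noteq> \<one>" and inv: "\<And>p. p \<in> Vw \<Longrightarrow> h \<otimes> p \<in> Vw"
  shows False
proof -
  have "inj_on ((\<otimes>) h) Vw" using h Vw_closed by (auto simp: inj_on_def)
  then have eq: "(\<otimes>) h ` Vw = Vw" using finite_Vw inv by (intro endo_inj_surj) auto
  have "\<exists>g \<in> {\<one>, h}. \<exists>p \<in> Vw. \<forall>g' \<in> {\<one>, h}. \<forall>p' \<in> Vw. g' \<otimes> p' = g \<otimes> p \<longrightarrow> g' = g \<and> p' = p"
  proof (rule up[unfolded unique_products_def, rule_format])
    show "Vw \<noteq> {}" using one_Vw by blast
    show "Vw \<subseteq> carrier G" using Vw_closed by blast
  qed (use h finite_Vw in auto)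
  then obtain g p where gp: "g \<in> {\<one>, h}" "p \<in> Vw"
    and u: "\<And>g' p'. g' \<in> {\<one>, h} \<Longrightarrow> p' \<in> Vw \<Longrightarrow> g' \<otimes> p' = g \<otimes> p \<Longrightarrow> g' = g" by metis
  show False
  proof (cases "g = h")
    case True
    have "\<one> = g" by (rule u[of \<one> "h \<otimes> p"]) (use True gp inv[of p] h Vw_closed[of p] in simp_all)
    then show False using True h by simp
  next
    case False
    then have g: "g = \<one>" using gp by simp
    obtain q where "q \<in> Vw" "h \<otimes> q = p" using eq gp(2) by (metis imageE)
    have "h = g" by (rule u[of h q]) (use g \<open>q \<in> Vw\<close> \<open>h \<otimes> q = p\<close> Vw_closed[OF gp(2)] in simp_all)
    then show False using False by simp
  qed
qed

section \<open>Orbits of a subgroup and a circulation on the quotient graph\<close>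

context
  fixes H assumes H: "subgroup H G"
begin

interpretation H: subgroup H G by (rule H)

definition eorb :: "'a \<times> 'x \<Rightarrow> ('a \<times> 'x) set" where "eorb e = (\<lambda>h. shift h e) ` H"

definition vorb :: "'a \<Rightarrow> 'a set" where "vorb v = (\<lambda>h. h \<otimes> v) ` H"

lemma eorb_shift: "h \<in> H \<Longrightarrow> fst e \<in> carrier G \<Longrightarrow> eorb (shift h e) = eorb e"
proof -
  assume h: "h \<in> H" and e: "fst e \<in> carrier G"
  have 1: "shift g (shift h e) = shift (g \<otimes> h) e" if "g \<in> H" for g using h e that by (simp add: shift_shift)
  have 2: "shift g e = shift (g \<otimes> inv h) (shift h e)" if "g \<in> H" for g
    using h e that by (simp add: shift_shift m_assoc)
  show ?thesis unfolding eorb_def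
  proof (intro equalityI image_subsetI)
    fix g assume g: "g \<in> H"
    show "shift g (shift h e) \<in> (\<lambda>h. shift h e) ` H" unfolding 1[OF g] using g h by blast
    show "shift g e \<in> (\<lambda>k. shift k (shift h e)) ` H" using 2[OF g] g h H.m_closed[OF g H.m_inv_closed[OF h]] by blast
  qed
qed

lemma vorb_mult: "h \<in> H \<Longrightarrow> v \<in> carrier G \<Longrightarrow> vorb (h \<otimes> v) = vorb v"
proof -
  assume h: "h \<in> H" and v: "v \<in> carrier G"
  have 1: "g \<otimes> (h \<otimes> v) = (g \<otimes> h) \<otimes> v" if "g \<in> H" for g using h v that by (simp add: m_assoc)
  have 2: "g \<otimes> v = (g \<otimes> inv h) \<otimes> (h \<otimes> v)" if "g \<in> H" for g
    using h v that by (simp add: m_assoc inv_cancel_left)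
  show ?thesis unfolding vorb_def
  proof (intro equalityI image_subsetI)
    fix g assume g: "g \<in> H"
    show "g \<otimes> (h \<otimes> v) \<in> (\<lambda>h. h \<otimes> v) ` H" unfolding 1[OF g] using g h by blast
    show "g \<otimes> v \<in> (\<lambda>k. k \<otimes> (h \<otimes> v)) ` H" using 2[OF g] g h H.m_closed[OF g H.m_inv_closed[OF h]] by blast
  qed
qed

lemma eorb_eqD: assumes "fst e \<in> carrier G" "eorb e = eorb i" shows "\<exists>h \<in> H. e = shift h i"
proof -
  have "e \<in> eorb e" using assms(1) by (auto simp: eorb_def intro!: image_eqI[of _ _ \<one>])
  then show ?thesis unfolding assms(2) by (auto simp: eorb_def)
qed

text \<open>Every vertex orbit carries at least two ends of edge orbits. If there are at most as many edge
  orbits as vertex orbits, it carries exactly two, and then \<open>h\<close> maps the simple cycle to itself.\<close>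

lemma more_edges_than_vertices:
  assumes h: "h \<in> H" "h \<in> \<Delta>" "h \<noteq> \<one>"
  shows "card (vorb ` Vw) < card (eorb ` keys \<omega>)"
proof (rule ccontr)
  assume "\<not> ?thesis"
  then have le: "card (eorb ` keys \<omega>) \<le> card (vorb ` Vw)" by simp
  \<comment> \<open>All directions seen at some vertex of the orbit. Translation preserves letters,
    so directions at different vertices of an orbit are comparable.\<close>
  define T where "T \<nu> = (\<Union>p \<in> {p \<in> Vw. vorb p = \<nu>}. dirs p)" for \<nu>
  have finT: "finite (T \<nu>)" for \<nu> using finite_Vw finite_dirs by (simp add: T_def)
  have T2: "2 \<le> card (T \<nu>)" if \<nu>: "\<nu> \<in> vorb ` Vw" for \<nu>
  proof -
    obtain p where p: "p \<in> Vw" "vorb p = \<nu>" using \<nu> by blast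
    obtain l l' where l: "l \<in> dirs p" "l' \<in> dirs p" "l \<noteq> l'" using two_dirs p by blast
    have "{l, l'} \<subseteq> T \<nu>" using l p by (auto simp: T_def)
    then show ?thesis using card_mono[OF finT, of "{l, l'}" \<nu>] l by simp
  qed
  \<comment> \<open>A direction at a vertex orbit determines an edge orbit with an orientation.
    Injectivity bounds the number of all directions by twice the number of edge orbits.\<close>
  define D where "D = (\<lambda>(\<nu>, l). (eorb (edge (SOME p. p \<in> Vw \<and> vorb p = \<nu> \<and> l \<in> dirs p) l), snd l))"
  have D: "\<exists>p. p \<in> Vw \<and> vorb p = \<nu> \<and> l \<in> dirs p \<and> D (\<nu>, l) = (eorb (edge p l), snd l)"
    if "(\<nu>, l) \<in> Sigma (vorb ` Vw) T" for \<nu> l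
  proof -
    have "\<exists>p. p \<in> Vw \<and> vorb p = \<nu> \<and> l \<in> dirs p" using that by (auto simp: T_def)
    from someI_ex[OF this] show ?thesis unfolding D_def by auto
  qed
  have "inj_on D (Sigma (vorb ` Vw) T)"
  proof (rule inj_onI)
    fix x y assume xy: "x \<in> Sigma (vorb ` Vw) T" "y \<in> Sigma (vorb ` Vw) T" "D x = D y"
    obtain \<nu> l \<nu>' l' where e: "x = (\<nu>, l)" "y = (\<nu>', l')" by (metis surj_pair)
    obtain p where p: "p \<in> Vw" "vorb p = \<nu>" "l \<in> dirs p" "D x = (eorb (edge p l), snd l)" using D xy e by blast
    obtain q where q: "q \<in> Vw" "vorb q = \<nu>'" "l' \<in> dirs q" "D y = (eorb (edge q l'), snd l')" using D xy e by blast
    have pc: "p \<in> carrier G" "q \<in> carrier G" using p q Vw_closed by auto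
    obtain k where k: "k \<in> H" "edge p l = shift k (edge q l')" using eorb_eqD[of "edge p l" "edge q l'"] p q xy pc by auto
    have "edge p l = edge (k \<otimes> q) l'" using k pc by (simp add: shift_edge)
    then have "l' = l" "k \<otimes> q = p"
      using edge_eq_cases[of p "k \<otimes> q" l' l] pc k(1) p(4) q(4) xy(3) by auto
    then show "x = y" using e p q k pc vorb_mult[of k q] by simp
  qed
  moreover have "D ` Sigma (vorb ` Vw) T \<subseteq> (eorb ` keys \<omega>) \<times> UNIV"
  proof
    fix y assume "y \<in> D ` Sigma (vorb ` Vw) T"
    then obtain x where "x \<in> Sigma (vorb ` Vw) T" "y = D x" by blast
    moreover obtain \<nu> l where "x = (\<nu>, l)" by (metis surj_pair)
    ultimately obtain p where "l \<in> dirs p" "y = (eorb (edge p l), snd l)" using D by blast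
    then show "y \<in> (eorb ` keys \<omega>) \<times> UNIV" by (simp add: dirs_def)
  qed
  ultimately have "card (Sigma (vorb ` Vw) T) \<le> card ((eorb ` keys \<omega>) \<times> (UNIV :: bool set))"
    by (intro card_inj_on_le) auto
  then have "(\<Sum>\<nu> \<in> vorb ` Vw. card (T \<nu>)) \<le> 2 * card (eorb ` keys \<omega>)"
    using finite_Vw finT by (simp add: card_SigmaI card_cartesian_product)
  then have up2: "(\<Sum>\<nu> \<in> vorb ` Vw. card (T \<nu>)) \<le> (\<Sum>\<nu> \<in> vorb ` Vw. 2)" using le by simp
  have T_eq: "card (T \<nu>) = 2" if "\<nu> \<in> vorb ` Vw" for \<nu>
  proof (rule ccontr)
    assume "card (T \<nu>) \<noteq> 2"
    then have "2 < card (T \<nu>)" using T2[OF that] by simp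
    then have "(\<Sum>\<nu> \<in> vorb ` Vw. 2) < (\<Sum>\<nu> \<in> vorb ` Vw. card (T \<nu>))"
      using T2 that finite_Vw by (intro sum_strict_mono_ex1) auto
    then show False using up2 by simp
  qed
  \<comment> \<open>As \<open>T\<close> has size two on every orbit and each vertex has two
    directions, every vertex already shows all directions of its orbit.\<close>
  have dirs_T: "dirs p = T (vorb p)" if p: "p \<in> Vw" for p
  proof -
    obtain l l' where l: "l \<in> dirs p" "l' \<in> dirs p" "l \<noteq> l'" using two_dirs p by blast
    have sub: "dirs p \<subseteq> T (vorb p)" using p by (auto simp: T_def)
    have "card {l, l'} \<le> card (dirs p)" using l finite_dirs by (intro card_mono) auto
    then have "card (T (vorb p)) \<le> card (dirs p)" using T_eq p l by simp
    then show ?thesis using card_seteq[OF finT sub] by simp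
  qed
  have dirs_mult: "dirs (k \<otimes> p) = dirs p" if "k \<in> H" "p \<in> Vw" "k \<otimes> p \<in> Vw" for k p
    using dirs_T that vorb_mult[of k p] Vw_closed by simp
  define k where "k = inv h"
  have k: "k \<in> H" "k \<in> carrier G" "k \<noteq> \<one>" using h by (auto simp: k_def)
  have step: "k \<otimes> wv (a @ [l]) \<in> Vw" if w: "w = a @ l # b" and a: "k \<otimes> wv a \<in> Vw" for a l b
  proof -
    have "wv a \<in> Vw" using edge_Vw[OF w] by simp
    then have "l \<in> dirs (k \<otimes> wv a)" using dirs_forward[OF w] dirs_mult[OF k(1) _ a] by simp
    then have "k \<otimes> wv a \<otimes> lv l \<in> Vw" using k by (intro dirs_step) auto
    then show ?thesis using k by (simp add: wv_append m_assoc)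
  qed
  have walk: "k \<otimes> wv (a @ c) \<in> Vw" if "w = a @ c @ b" "k \<otimes> wv a \<in> Vw" for a c b
    using that
  proof (induction c arbitrary: a)
    case (Cons l c)
    then have "k \<otimes> wv (a @ [l]) \<in> Vw" using step[of a l "c @ b"] by simp
    then show ?case using Cons.IH[of "a @ [l]"] Cons.prems by simp
  qed simp
  \<comment> \<open>\<open>k\<close> sends the vertex \<open>p\<close> to the vertex
    \<open>q\<close>. Reading \<open>w\<close> from \<open>p\<close> to its end and then again from
    its beginning keeps the image under \<open>k\<close> on the cycle.\<close>
  obtain p q where pq: "p \<in> Vw" "q \<in> Vw" "h = p \<otimes> inv q" using h(2) by (auto simp: \<Delta>_def)
  have pqc: "p \<in> carrier G" "q \<in> carrier G" using pq Vw_closed by auto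
  have "k \<otimes> p = q" using pqc by (simp add: k_def pq(3) inv_mult_group m_assoc)
  moreover obtain a b where ab: "w = a @ b" "p = wv a" using pq(1) unfolding Vw_def by blast
  ultimately have "k \<otimes> wv (a @ b) \<in> Vw" using walk[of a b "[]"] pq(2) by simp
  then have k1: "k \<otimes> wv [] \<in> Vw" using ab(1)[symmetric] by simp
  have "k \<otimes> p \<in> Vw" if pV: "p \<in> Vw" for p
  proof -
    obtain a b where ab: "w = a @ b" "p = wv a" using pV unfolding Vw_def by blast
    then show ?thesis using walk[of "[]" a b] k1 by simp
  qed
  then show False using Vw_not_invariant[of k] k by blast
qed

text \<open>A circulation on the quotient graph that is orthogonal to \<open>\<omega>\<close> cannot be a coboundary:
  it would be orthogonal to itself.\<close>

lemma exists_height: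
  assumes gen: "H = generate G (\<Delta> \<inter> H)" and ne: "H \<noteq> {\<one>}" and sp: "spanned H"
  shows "\<exists>f :: 'a \<Rightarrow> int. (\<forall>h \<in> H. \<forall>k \<in> H. f (h \<otimes> k) = f h + f k) \<and>
    (\<forall>h \<in> H. \<forall>p \<in> Vw. f (h \<otimes> p) = f h + f p) \<and> (\<exists>h \<in> H. f h \<noteq> 0)"
proof -
  have "\<exists>h. h \<in> \<Delta> \<inter> H \<and> h \<noteq> \<one>"
  proof (rule ccontr)
    assume "\<not> ?thesis"
    then have "\<Delta> \<inter> H \<subseteq> {\<one>}" by auto
    then have "generate G (\<Delta> \<inter> H) \<subseteq> {\<one>}" by (rule generate_subgroup_incl) (rule triv_subgroup)
    then show False using ne gen H.one_closed by auto
  qed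
  then obtain d where d: "d \<in> H" "d \<in> \<Delta>" "d \<noteq> \<one>" by blast
  define EE VV where "EE = eorb ` keys \<omega>" and "VV = vorb ` Vw"
  have fin: "finite EE" "finite VV" using finite_Vw by (simp_all add: EE_def VV_def)
  define rep where "rep \<epsilon> = (SOME e. e \<in> keys \<omega> \<and> eorb e = \<epsilon>)" for \<epsilon>
  have rep: "rep \<epsilon> \<in> keys \<omega>" "eorb (rep \<epsilon>) = \<epsilon>" if "\<epsilon> \<in> EE" for \<epsilon>
    using someI_ex[of "\<lambda>e. e \<in> keys \<omega> \<and> eorb e = \<epsilon>"] that by (auto simp: EE_def rep_def)
  \<comment> \<open>Row \<open>None\<close> is orthogonality to \<open>\<omega>\<close>, row
    \<open>Some \<nu>\<close> is conservation at the vertex orbit \<open>\<nu>\<close>. The orbit of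
    the identity gets no row, so there are only \<open>card VV\<close> equations; the potential used
    below is zero there.\<close>
  define B :: "'a set option \<Rightarrow> ('a \<times> 'x) set \<Rightarrow> int" where
    "B j \<epsilon> = (case j of None \<Rightarrow> (\<Sum>e \<in> {e \<in> keys \<omega>. eorb e = \<epsilon>}. lookup \<omega> e)
      | Some \<nu> \<Rightarrow> (if vorb (tip (rep \<epsilon>)) = \<nu> then 1 else 0) - (if vorb (fst (rep \<epsilon>)) = \<nu> then 1 else 0))" for j \<epsilon>
  define J where "J = insert None (Some ` (VV - {vorb \<one>}))"
  have "vorb \<one> \<in> VV" using one_Vw by (simp add: VV_def)
  then have "card VV > 0" using fin by (auto simp: card_gt_0_iff)
  have "card J = card VV" using fin \<open>vorb \<one> \<in> VV\<close> \<open>card VV > 0\<close> by (simp add: J_def card_image)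
  then have "card J < card EE" using more_edges_than_vertices[OF d] by (simp add: EE_def VV_def)
  then obtain x where x: "\<exists>\<epsilon> \<in> EE. x \<epsilon> \<noteq> 0" and Bx: "\<And>j. j \<in> J \<Longrightarrow> (\<Sum>\<epsilon> \<in> EE. B j \<epsilon> * x \<epsilon>) = 0"
    using underdetermined_system[of J EE B] fin by (auto simp: J_def)
  define c where "c e = x (eorb e)" for e
  have c_shift: "c (shift h e) = c e" if "h \<in> H" "fst e \<in> carrier G" for h e
    using eorb_shift[OF that] by (simp add: c_def)
  have c_\<omega>: "lin c \<omega> = 0"
  proof -
    have "lin c \<omega> = (\<Sum>\<epsilon> \<in> EE. \<Sum>e \<in> {e \<in> keys \<omega>. eorb e = \<epsilon>}. lookup \<omega> e * c e)"
      unfolding lin_def EE_def by (rule sum.image_gen) simp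
    also have "\<dots> = (\<Sum>\<epsilon> \<in> EE. B None \<epsilon> * x \<epsilon>)"
      by (rule sum.cong) (auto simp: B_def c_def sum_distrib_right)
    also have "\<dots> = 0" by (rule Bx) (simp add: J_def)
    finally show ?thesis .
  qed
  have c_shc: "lin c (shc h z) = lin c z" if "h \<in> H" "fst ` keys z \<subseteq> carrier G" for h z
    unfolding shc_def lin_frag_extend by (rule lin_cong) (use c_shift that in auto)
  \<comment> \<open>By invariance \<open>c\<close> vanishes on all translates of
    \<open>\<omega>\<close>; descent extends this to all cycles in \<open>cells H\<close>.\<close>
  have c_cycle: "lin c z = 0" if "bd z = 0" "keys z \<subseteq> cells H" for z
  proof (rule int_functional_zero_descent[OF n, of "{z. bd z = 0 \<and> keys z \<subseteq> cells H}" "lin c"])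
    fix z assume "z \<in> {z. bd z = 0 \<and> keys z \<subseteq> cells H}"
    then have z: "bd z = 0" "keys z \<subseteq> cells H" by auto
    then obtain b where b: "keys b \<subseteq> H" "\<And>e. n dvd lookup (z - conv b \<omega>) e" using sp unfolding spanned_def by blast
    have "keys b \<subseteq> carrier G" using b(1) H.subset by blast
    then have "bd (conv b \<omega>) = 0" by (rule bd_conv_cycle[OF _ \<omega>_closed' bd_\<omega>])
    then have "bd (z - conv b \<omega>) = 0" using z by (simp add: bd_diff)
    then obtain z' where z': "bd z' = 0" "keys z' \<subseteq> keys (z - conv b \<omega>)" "z - conv b \<omega> = frag_cmul n z'"
      using divisible_cycle b(2) by blast
    have "lin c (conv b \<omega>) = lin (\<lambda>g. lin c (shc g \<omega>)) b" by (simp add: conv_def lin_frag_extend)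
    also have "\<dots> = 0" by (rule lin_zero) (use c_shc[OF _ \<omega>_closed'] b(1) c_\<omega> in auto)
    finally have "lin c z = n * lin c z'" using z'(3) lin_diff[of c z "conv b \<omega>"] by (simp add: lin_cmul)
    moreover have "keys z' \<subseteq> cells H" using z'(2) z(2) keys_diff[of z "conv b \<omega>"] keys_conv_cells[OF b(1)] by blast
    ultimately show "\<exists>z' \<in> {z. bd z = 0 \<and> keys z \<subseteq> cells H}. lin c z = n * lin c z'" using z'(1) by blast
  qed (use that in auto)
  have unique: "lin c (ch \<one> u) = lin c (ch \<one> u')"
    if "edges \<one> u \<subseteq> cells H" "edges \<one> u' \<subseteq> cells H" "wv u = wv u'" for u u'
  proof -
    have "keys (ch \<one> u - ch \<one> u') \<subseteq> cells H"
      using that keys_ch[of \<one> u] keys_ch[of \<one> u'] keys_diff[of "ch \<one> u" "ch \<one> u'"] by blast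
    moreover have "bd (ch \<one> u - ch \<one> u') = 0" using that by (simp add: bd_diff bd_ch)
    ultimately have "lin c (ch \<one> u - ch \<one> u') = 0" using c_cycle by blast
    then show ?thesis by (simp add: lin_diff)
  qed
  \<comment> \<open>A potential for \<open>c\<close>: integration along a path from the identity,
    independent of the path since \<open>c\<close> vanishes on cycles.\<close>
  define f where "f v = lin c (ch \<one> (SOME u. edges \<one> u \<subseteq> cells H \<and> wv u = v))" for v
  have f: "f v = lin c (ch \<one> u)" if "edges \<one> u \<subseteq> cells H" "wv u = v" for u v
  proof -
    have "edges \<one> u \<subseteq> cells H \<and> wv u = v" using that by simp
    from someI[of "\<lambda>u. edges \<one> u \<subseteq> cells H \<and> wv u = v", OF this] that show ?thesis
      unfolding f_def by (intro unique) auto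
  qed
  have cells_inv: "shift h ` U \<subseteq> cells H" if h: "h \<in> H" and U: "U \<subseteq> cells H" for h U
  proof
    fix y assume "y \<in> shift h ` U"
    then obtain i where i: "i \<in> cells H" "y = shift h i" using U by blast
    from i(1) obtain g e where "g \<in> H" "e \<in> keys \<omega>" "i = shift g e" by (rule cellsE)
    then show "y \<in> cells H" using h i(2) cellsI[of "h \<otimes> g" H e] \<omega>_closed[of e] by (simp add: shift_shift)
  qed
  have pathV: "\<exists>u. edges \<one> u \<subseteq> cells H \<and> wv u = p" if p: "p \<in> Vw" for p
  proof -
    obtain a b where ab: "w = a @ b" "p = wv a" using p unfolding Vw_def by blast
    have "edges \<one> a \<subseteq> keys \<omega>" unfolding keys_\<omega> using ab(1) edges_append[of \<one> a b] by simp
    also have "\<dots> \<subseteq> cells H"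
    proof
      fix e assume "e \<in> keys \<omega>"
      then show "e \<in> cells H" using cellsI[of \<one> H e] \<omega>_closed by simp
    qed
    finally show ?thesis using ab by blast
  qed
  have translate: "edges (h \<otimes> \<one>) u \<subseteq> cells H" if "h \<in> H" "edges \<one> u \<subseteq> cells H" for h u
    using edges_shift[of h \<one> u] cells_inv[OF that] that(1) by simp
  have pathD: "\<exists>u. edges \<one> u \<subseteq> cells H \<and> wv u = p \<otimes> inv q"
    if pq: "p \<in> Vw" "q \<in> Vw" and h: "p \<otimes> inv q \<in> H" for p q
  proof -
    obtain a b where a: "edges \<one> a \<subseteq> cells H" "wv a = p" and b: "edges \<one> b \<subseteq> cells H" "wv b = q"
      using pathV pq by blast
    have "p = p \<otimes> inv q \<otimes> \<one> \<otimes> wv b" using pq b Vw_closed by (simp add: m_assoc)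
    then have "edges p (winv b) \<subseteq> cells H"
      using edges_winv[of "p \<otimes> inv q \<otimes> \<one>" b] translate[OF h b(1)] h by simp
    then have "edges \<one> (a @ winv b) \<subseteq> cells H" using a Vw_closed[OF pq(1)] by (simp add: edges_append)
    moreover have "wv (a @ winv b) = p \<otimes> inv q" using a b by (simp add: wv_append wv_winv)
    ultimately show ?thesis by blast
  qed
  have pathH: "\<exists>u. edges \<one> u \<subseteq> cells H \<and> wv u = h" if h: "h \<in> H" for h
  proof -
    have "h \<in> generate G (\<Delta> \<inter> H)" using h gen by simp
    then show ?thesis
    proof (induction rule: generate.induct)
      case one
      then show ?case by (intro exI[of _ "[]"]) simp
    next
      case (incl h)
      then show ?case using pathD by (auto simp: \<Delta>_def)
    next
      case (inv h)
      then obtain p q where pq: "p \<in> Vw" "q \<in> Vw" "h = p \<otimes> inv q" by (auto simp: \<Delta>_def)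
      have "inv h = q \<otimes> inv p" using pq Vw_closed by (simp add: inv_mult_group)
      moreover have "inv h \<in> H" using inv by simp
      ultimately show ?case using pathD[OF pq(2,1)] by simp
    next
      case (eng h k)
      then obtain a b where a: "edges \<one> a \<subseteq> cells H" "wv a = h" and b: "edges \<one> b \<subseteq> cells H" "wv b = k" by blast
      have hk: "h \<in> H" using eng(1) gen by simp
      have "edges \<one> (a @ b) \<subseteq> cells H" using a translate[OF hk b(1)] hk by (simp add: edges_append)
      moreover have "wv (a @ b) = h \<otimes> k" using a b by (simp add: wv_append)
      ultimately show ?case by blast
    qed
  qed
  have f_mult: "f (h \<otimes> v) = f h + f v" if h: "h \<in> H" and v: "\<exists>u. edges \<one> u \<subseteq> cells H \<and> wv u = v" for h v
  proof -
    obtain a where a: "edges \<one> a \<subseteq> cells H" "wv a = h" using pathH h by blast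
    obtain b where b: "edges \<one> b \<subseteq> cells H" "wv b = v" using v by blast
    have "edges \<one> (a @ b) \<subseteq> cells H" using a translate[OF h b(1)] h by (simp add: edges_append)
    moreover have "wv (a @ b) = h \<otimes> v" using a b by (simp add: wv_append)
    ultimately have "f (h \<otimes> v) = lin c (ch \<one> (a @ b))" by (rule f)
    also have "\<dots> = lin c (ch \<one> a) + lin c (ch (h \<otimes> \<one>) b)" using a h by (simp add: ch_append lin_add)
    also have "lin c (ch (h \<otimes> \<one>) b) = lin c (ch \<one> b)"
      using h ch_shift[of h \<one> b] c_shc[OF h, of "ch \<one> b"] keys_ch[of \<one> b] edges_closed[of \<one> b] by auto
    finally show ?thesis using f a b by simp
  qed
  have "\<exists>h \<in> H. f h \<noteq> 0"
  proof (rule ccontr)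
    assume "\<not> ?thesis"
    then have f0: "f h = 0" if "h \<in> H" for h using that by blast
    \<comment> \<open>A potential that vanishes on \<open>H\<close> is constant on vertex orbits, so
      it descends to the quotient graph and makes \<open>x\<close> a coboundary.\<close>
    define Fn where "Fn \<nu> = f (SOME v. v \<in> \<nu>)" for \<nu>
    have Fn: "Fn (vorb p) = f p" if p: "p \<in> Vw" for p
    proof -
      have "p \<in> vorb p" using Vw_closed[OF p] by (auto simp: vorb_def intro!: image_eqI[of _ _ \<one>])
      then have "(SOME v. v \<in> vorb p) \<in> vorb p" by (rule someI)
      then obtain h where "h \<in> H" "(SOME v. v \<in> vorb p) = h \<otimes> p" by (auto simp: vorb_def)
      then show ?thesis using f_mult[OF _ pathV[OF p]] f0 by (simp add: Fn_def)
    qed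
    have c_eq: "c e = f (tip e) - f (fst e)" if e: "e \<in> keys \<omega>" for e
    proof -
      obtain a where a: "edges \<one> a \<subseteq> cells H" "wv a = fst e" using pathV \<omega>_Vw e by blast
      have "edge (fst e) (snd e, True) = e" by (simp add: edge_def)
      moreover have "e \<in> cells H" using cellsI[of \<one> H e] \<omega>_closed e by simp
      ultimately have "edges \<one> (a @ [(snd e, True)]) \<subseteq> cells H" using a \<omega>_closed e by (simp add: edges_append)
      moreover have "wv (a @ [(snd e, True)]) = tip e" using a by (simp add: wv_append tip_def lval_def)
      ultimately have "f (tip e) = lin c (ch \<one> (a @ [(snd e, True)]))" by (rule f)
      also have "\<dots> = lin c (ch \<one> a) + c e"
        using a \<omega>_closed e \<open>edge (fst e) (snd e, True) = e\<close> by (simp add: ch_append lin_add sg_def)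
      finally show ?thesis using f[OF a] by simp
    qed
    have "Fn (vorb \<one>) = 0" using Fn[OF one_Vw] f0[OF H.one_closed] by simp
    have x_eq: "x \<epsilon> = (\<Sum>\<nu> \<in> VV - {vorb \<one>}. B (Some \<nu>) \<epsilon> * Fn \<nu>)" if \<epsilon>: "\<epsilon> \<in> EE" for \<epsilon>
    proof -
      let ?t = "vorb (tip (rep \<epsilon>))" and ?s = "vorb (fst (rep \<epsilon>))"
      have ts: "?t \<in> VV" "?s \<in> VV" using rep[OF \<epsilon>] \<omega>_Vw by (auto simp: VV_def)
      have "x \<epsilon> = c (rep \<epsilon>)" using rep[OF \<epsilon>] by (simp add: c_def)
      also have "\<dots> = Fn ?t - Fn ?s" using c_eq rep[OF \<epsilon>] Fn \<omega>_Vw by simp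
      also have "\<dots> = (\<Sum>\<nu> \<in> VV. (if ?t = \<nu> then Fn \<nu> else 0) - (if ?s = \<nu> then Fn \<nu> else 0))"
        using ts fin by (simp add: sum_subtractf)
      also have "\<dots> = (\<Sum>\<nu> \<in> VV. B (Some \<nu>) \<epsilon> * Fn \<nu>)"
        by (rule sum.cong) (auto simp: B_def)
      also have "\<dots> = (\<Sum>\<nu> \<in> VV - {vorb \<one>}. B (Some \<nu>) \<epsilon> * Fn \<nu>)"
        using fin \<open>vorb \<one> \<in> VV\<close> \<open>Fn (vorb \<one>) = 0\<close> by (simp add: sum.remove)
      finally show ?thesis .
    qed
    have "(\<Sum>\<epsilon> \<in> EE. x \<epsilon> * x \<epsilon>) = (\<Sum>\<epsilon> \<in> EE. \<Sum>\<nu> \<in> VV - {vorb \<one>}. Fn \<nu> * (B (Some \<nu>) \<epsilon> * x \<epsilon>))"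
      by (rule sum.cong[OF refl], subst x_eq) (auto simp: sum_distrib_left mult_ac)
    also have "\<dots> = (\<Sum>\<nu> \<in> VV - {vorb \<one>}. Fn \<nu> * (\<Sum>\<epsilon> \<in> EE. B (Some \<nu>) \<epsilon> * x \<epsilon>))"
      by (subst sum.swap) (simp add: sum_distrib_left)
    also have "\<dots> = 0" by (rule sum.neutral) (use Bx in \<open>auto simp: J_def\<close>)
    finally have "\<forall>\<epsilon> \<in> EE. x \<epsilon> * x \<epsilon> = 0" using fin by (subst (asm) sum_nonneg_eq_0_iff) auto
    then show False using x by auto
  qed
  then show ?thesis using f_mult pathH pathV by blast
qed

end

end

subsection \<open>Closed paths are trivial\<close>

context cell_system
begin

text \<open>Each nonempty level is a left translate of the kernel. A level can be merged with an
  adjacent interval because the enlarged interval is spanned, and a finite path meets only finitely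
  many levels.\<close>

lemma good_levels:
  fixes f :: "'a \<Rightarrow> int"
  assumes H: "subgroup H G" and f_mult: "\<And>h k. h \<in> H \<Longrightarrow> k \<in> H \<Longrightarrow> f (h \<otimes> k) = f h + f k"
    and f: "\<And>h p. h \<in> H \<Longrightarrow> p \<in> Vw \<Longrightarrow> f (h \<otimes> p) = f h + f p"
    and sp: "spanned H" and ker: "good (cells {h \<in> H. f h = 0})"
  shows "good (cells H)"
proof -
  interpret H: subgroup H G by (rule H)
  have f_one: "f \<one> = 0" using f_mult[OF H.one_closed H.one_closed] by simp
  have f_inv: "f (inv h) = - f h" if "h \<in> H" for h
    using f_mult[OF that H.m_inv_closed[OF that]] that f_one by simp
  have level: "good (cells {h \<in> H. f h = j})" for j
  proof (cases "{h \<in> H. f h = j} = {}")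
    case True
    have "good {}"
      unfolding good_def
    proof (intro ballI allI impI)
      fix v u assume "edges v u \<subseteq> {}"
      then show "Q.wv u = \<one>\<^bsub>Q\<^esub>" by (cases u) auto
    qed
    then show ?thesis unfolding True by (simp add: cells_def)
  next
    case False
    then obtain t where t: "t \<in> H" "f t = j" by blast
    have "{h \<in> H. f h = j} = (\<otimes>) t ` {h \<in> H. f h = 0}"
    proof (intro equalityI subsetI)
      fix h assume h: "h \<in> {h \<in> H. f h = j}"
      then have "h = t \<otimes> (inv t \<otimes> h)" "inv t \<otimes> h \<in> {h \<in> H. f h = 0}"
        using t f_mult[OF H.m_inv_closed[OF t(1)]] f_inv by (auto simp: inv_cancel_left)
      then show "h \<in> (\<otimes>) t ` {h \<in> H. f h = 0}" by (rule image_eqI)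
    qed (use t f_mult in auto)
    then show ?thesis using good_translate[OF _ _ ker, of t] t H.subset by auto
  qed
  have interval: "good (cells {h \<in> H. i \<le> f h \<and> f h \<le> i + int k})" for i k
  proof (induction k)
    case 0
    have "{h \<in> H. i \<le> f h \<and> f h \<le> i + int 0} = {h \<in> H. f h = i}" by auto
    then show ?case using level[of i] by (simp only:)
  next
    case (Suc k)
    have "(i \<le> x \<and> x \<le> i + int (Suc k)) \<longleftrightarrow> (i \<le> x \<and> x \<le> i + int k) \<or> x = i + int (Suc k)" for x
      by auto
    then have eq: "{h \<in> H. i \<le> f h \<and> f h \<le> i + int (Suc k)} =
      {h \<in> H. i \<le> f h \<and> f h \<le> i + int k} \<union> {h \<in> H. f h = i + int (Suc k)}" by blast
    show ?case unfolding eq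
    proof (rule good_merge_cells)
      show "spanned ({h \<in> H. i \<le> f h \<and> f h \<le> i + int k} \<union> {h \<in> H. f h = i + int (Suc k)})"
        unfolding eq[symmetric] by (rule spanned_interval[OF H f sp])
      show "{h \<in> H. i \<le> f h \<and> f h \<le> i + int k} \<inter> {h \<in> H. f h = i + int (Suc k)} = {}" by auto
    qed (use Suc level H.subset in blast)+
  qed
  show ?thesis unfolding good_def
  proof (intro ballI allI impI)
    fix v u assume v: "v \<in> carrier G" and e: "edges v u \<subseteq> cells H" and c: "wv u = \<one>"
    have "\<forall>e \<in> edges v u. \<exists>g. g \<in> H \<and> e \<in> cells {g}" using e unfolding cells_def by blast
    then obtain g where g: "\<And>e. e \<in> edges v u \<Longrightarrow> g e \<in> H \<and> e \<in> cells {g e}" by metis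
    define m where "m = Max (insert 0 ((\<lambda>e. \<bar>f (g e)\<bar>) ` edges v u))"
    have m: "\<bar>f (g e)\<bar> \<le> m" if "e \<in> edges v u" for e unfolding m_def using that by (intro Max_ge) auto
    have "m \<ge> 0" unfolding m_def by (intro Max_ge) auto
    have "edges v u \<subseteq> cells {h \<in> H. - m \<le> f h \<and> f h \<le> - m + int (nat (2 * m))}"
    proof
      fix e assume e: "e \<in> edges v u"
      have "{g e} \<subseteq> {h \<in> H. - m \<le> f h \<and> f h \<le> - m + int (nat (2 * m))}" using m[OF e] g[OF e] \<open>m \<ge> 0\<close> by auto
      from cells_mono[OF this] show "e \<in> cells {h \<in> H. - m \<le> f h \<and> f h \<le> - m + int (nat (2 * m))}"
        using g[OF e] by blast
    qed
    then show "Q.wv u = \<one>\<^bsub>Q\<^esub>" using goodD[OF interval v _ c] by blast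
  qed
qed

lemma good_subgroup: "subgroup H G \<Longrightarrow> spanned H \<Longrightarrow> good (cells H)"
proof (induction "card (\<Delta> \<inter> H)" arbitrary: H rule: less_induct)
  case less
  \<comment> \<open>Passing to \<open>H'\<close> makes the union connected and leaves the measure
    unchanged.\<close>
  define H' where "H' = generate G (\<Delta> \<inter> H)"
  note comp = component_subgroup[OF less.prems(1) H'_def] component_subset[OF less.prems(1) H'_def]
    component_\<Delta>[OF less.prems(1) H'_def]
  have sp: "spanned H'" by (rule spanned_component[OF less.prems(1) H'_def less.prems(2)])
  have gen: "H' = generate G (\<Delta> \<inter> H')" using comp(3) H'_def by simp
  interpret H': subgroup H' G by (rule comp(1))
  have "good (cells H')"
  proof (cases "H' = {\<one>}")
    case True
    then show ?thesis using good_single by simp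
  next
    case False
    obtain f :: "'a \<Rightarrow> int" where f: "\<And>h k. h \<in> H' \<Longrightarrow> k \<in> H' \<Longrightarrow> f (h \<otimes> k) = f h + f k"
      "\<And>h p. h \<in> H' \<Longrightarrow> p \<in> Vw \<Longrightarrow> f (h \<otimes> p) = f h + f p" "\<exists>h \<in> H'. f h \<noteq> 0"
      using exists_height[OF comp(1) gen False sp] by blast
    define K where "K = {h \<in> H'. f h = 0}"
    have f_one: "f \<one> = 0" using f(1)[OF H'.one_closed H'.one_closed] by simp
    have f_inv: "f (inv h) = - f h" if "h \<in> H'" for h
      using f(1)[OF that H'.m_inv_closed[OF that]] that f_one by simp
    have K: "subgroup K G"
    proof (rule subgroupI)
      show "K \<noteq> {}" unfolding K_def using f_one H'.one_closed by blast
    qed (use f(1) f_inv H'.subset in \<open>auto simp: K_def\<close>)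
    have "{h \<in> H'. 0 \<le> f h \<and> f h \<le> 0} = K" by (auto simp: K_def)
    then have spK: "spanned K" using spanned_interval[OF comp(1) f(2) sp, of 0 0] by simp
    \<comment> \<open>Otherwise all generators of \<open>H'\<close> would lie in the kernel of a
      nonzero homomorphism.\<close>
    have "\<Delta> \<inter> K \<noteq> \<Delta> \<inter> H"
    proof
      assume "\<Delta> \<inter> K = \<Delta> \<inter> H"
      then have "\<Delta> \<inter> H \<subseteq> K" by auto
      then have "H' \<subseteq> K" unfolding H'_def by (rule generate_subgroup_incl[OF _ K])
      then show False using f(3) by (auto simp: K_def)
    qed
    moreover have "\<Delta> \<inter> K \<subseteq> \<Delta> \<inter> H" using comp(2) by (auto simp: K_def)
    ultimately have "card (\<Delta> \<inter> K) < card (\<Delta> \<inter> H)" using finite_\<Delta> by (intro psubset_card_mono) auto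
    from less.hyps[OF this K spK] have "good (cells K)" .
    then have "good (cells {h \<in> H'. f h = 0})" unfolding K_def .
    show ?thesis
    proof (rule good_levels[where f = f, OF comp(1) _ _ sp])
      show "good (cells {h \<in> H'. f h = 0})" by fact
    qed (fact f(1), fact f(2))
  qed
  then show ?case by (rule good_component[OF less.prems(1) H'_def])
qed

text \<open>The coefficient of a cycle at an edge outside all translates can be divided by
  \<open>n\<close> without end. So these edges form a forest, and merging it with the good union of
  all translates gives the whole graph over \<open>S\<close>.\<close>

theorem closed_word_trivial:
  assumes S: "fst ` set w \<subseteq> S"
    and sp: "\<And>z. bd z = 0 \<Longrightarrow> keys z \<subseteq> carrier G \<times> S \<Longrightarrow>
      \<exists>b. keys b \<subseteq> carrier G \<and> (\<forall>e. n dvd lookup (z - conv b \<omega>) e)"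
    and u: "fst ` set u \<subseteq> S" "wv u = \<one>"
  shows "Q.wv u = \<one>\<^bsub>Q\<^esub>"
proof -
  let ?X = "carrier G \<times> S"
  define U where "U = cells (carrier G)"
  define V where "V = ?X - U"
  have "keys \<omega> \<subseteq> ?X"
    unfolding keys_\<omega> using S by (intro edges_subset) auto
  then have U: "U \<subseteq> ?X" by (auto simp: U_def mem_Times_iff shift_def elim!: cellsE)
  have UV: "U \<union> V = ?X" using U by (auto simp: V_def)
  have decomp: "\<exists>b z'. keys b \<subseteq> carrier G \<and> bd z' = 0 \<and> keys z' \<subseteq> ?X \<and> z = conv b \<omega> + frag_cmul n z'"
    if z: "bd z = 0" "keys z \<subseteq> ?X" for z
  proof -
    obtain b where b: "keys b \<subseteq> carrier G" "\<And>e. n dvd lookup (z - conv b \<omega>) e" using sp[OF z] by blast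
    have "bd (conv b \<omega>) = 0" by (rule bd_conv_cycle[OF b(1) \<omega>_closed' bd_\<omega>])
    then have "bd (z - conv b \<omega>) = 0" using z by (simp add: bd_diff)
    then obtain z' where z': "bd z' = 0" "keys z' \<subseteq> keys (z - conv b \<omega>)" "z - conv b \<omega> = frag_cmul n z'"
      using divisible_cycle b(2) by blast
    have "keys z' \<subseteq> ?X"
      using z'(2) keys_diff[of z "conv b \<omega>"] z(2) keys_conv_cells[OF b(1)] U unfolding U_def by blast
    moreover have "z = conv b \<omega> + frag_cmul n z'" using z'(3) by (simp add: algebra_simps)
    ultimately show ?thesis using b(1) z'(1) by blast
  qed
  have "spanned (carrier G)"
    unfolding spanned_def using sp U unfolding U_def by blast
  then have gU: "good U" unfolding U_def by (rule good_subgroup[OF subgroup_self])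
  have gV: "good V"
  proof (rule good_forest)
    fix z assume z: "bd z = 0" "keys z \<subseteq> V"
    have "lookup z e = 0" if e: "e \<in> V" for e
    proof (rule int_functional_zero_descent[OF n, of "{z. bd z = 0 \<and> keys z \<subseteq> ?X}" "\<lambda>z. lookup z e"])
      fix z assume "z \<in> {z. bd z = 0 \<and> keys z \<subseteq> ?X}"
      then obtain b z' where b: "keys b \<subseteq> carrier G" "bd z' = 0" "keys z' \<subseteq> ?X" "z = conv b \<omega> + frag_cmul n z'"
        using decomp by blast
      have "e \<notin> keys (conv b \<omega>)" using keys_conv_cells[OF b(1)] e by (auto simp: V_def U_def)
      then have "lookup z e = n * lookup z' e"
        by (simp add: b(4) lookup_add not_in_keys_iff_lookup_eq_zero)
      then show "\<exists>z' \<in> {z. bd z = 0 \<and> keys z \<subseteq> ?X}. lookup z e = n * lookup z' e" using b by blast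
    qed (use z in \<open>auto simp: V_def\<close>)
    then show "z = 0" using z(2) by (intro poly_mapping_eqI) (auto simp flip: not_in_keys_iff_lookup_eq_zero)
  qed
  have "good (U \<union> V)"
  proof (rule good_merge[OF _ _ n _ gU gV])
    show "fst ` U \<subseteq> carrier G" "fst ` V \<subseteq> carrier G" using UV by auto
    fix z assume "bd z = 0" "keys z \<subseteq> U \<union> V"
    then obtain b z' where b: "keys b \<subseteq> carrier G" "bd z' = 0" "keys z' \<subseteq> ?X" "z = conv b \<omega> + frag_cmul n z'"
      using decomp UV by metis
    have "bd (conv b \<omega>) = 0" by (rule bd_conv_cycle[OF b(1) \<omega>_closed' bd_\<omega>])
    moreover have "keys (conv b \<omega>) \<subseteq> U" using keys_conv_cells[OF b(1)] by (simp add: U_def)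
    ultimately show "\<exists>z1 z2 z'. bd z1 = 0 \<and> bd z2 = 0 \<and> bd z' = 0 \<and> keys z1 \<subseteq> U \<and> keys z2 \<subseteq> V \<and>
        keys z' \<subseteq> U \<union> V \<and> z = z1 + z2 + frag_cmul n z'"
      using b UV by (intro exI[of _ "conv b \<omega>"] exI[of _ 0] exI[of _ z']) auto
  qed
  moreover have "edges \<one> u \<subseteq> U \<union> V"
    unfolding UV using u(1) by (intro edges_subset) auto
  ultimately show ?thesis using goodD u(2) by blast
qed

end

subsection \<open>Simple cycles in the support of a cycle\<close>

context marked_group
begin

text \<open>A walk along edges visible modulo \<open>n\<close> can always be continued without
  backtracking: at a dead end, one edge alone would determine the boundary modulo \<open>n\<close>.
  Finiteness forces a repeated vertex, and a shortest return is simple.\<close>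

lemma exists_simple_cycle:
  fixes n :: int
  assumes z: "bd z = 0" "keys z \<subseteq> carrier G \<times> S" and n: "\<exists>e. \<not> n dvd lookup z e"
  obtains v u where "v \<in> carrier G" "simple u" "edges v u \<subseteq> {e. \<not> n dvd lookup z e}" "fst ` set u \<subseteq> S"
proof -
  define E where "E = {e. \<not> n dvd lookup z e}"
  have EK: "E \<subseteq> keys z" by (auto simp: E_def in_keys_iff)
  then have Ec: "fst e \<in> carrier G" "snd e \<in> S" if "e \<in> E" for e using z(2) that by auto
  have nxt: "\<exists>l'. l' \<noteq> linv l \<and> edge (v \<otimes> lv l) l' \<in> E" if v: "v \<in> carrier G" and e: "edge v l \<in> E" for v l
  proof (rule ccontr)
    assume "\<not> ?thesis"
    then have no: "l' = linv l" if "edge (v \<otimes> lv l) l' \<in> E" for l' using that by blast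
    define t where "t = v \<otimes> lv l"
    have t: "t \<in> carrier G" using v by (simp add: t_def)
    define e0 where "e0 = edge v l"
    \<comment> \<open>Signed incidence with the dead end \<open>t\<close>, so that
      \<open>lin d z\<close> is the boundary coefficient at \<open>t\<close>.\<close>
    define d :: "'a \<times> 'x \<Rightarrow> int" where "d e = (if tip e = t then 1 else 0) - (if fst e = t then 1 else 0)" for e
    have fst_t: "(snd e, True) = linv l" if "e \<in> E" "fst e = t" for e
    proof (rule no)
      have "edge t (snd e, True) = e" using that(2) by (simp add: edge_def prod_eq_iff)
      then show "edge (v \<otimes> lv l) (snd e, True) \<in> E" using that(1) by (simp add: t_def)
    qed
    have tip_t: "(snd e, False) = linv l" if "e \<in> E" "tip e = t" for e
    proof (rule no)
      have "t \<otimes> inv (\<sigma> (snd e)) = fst e" using that(2)[symmetric] Ec[OF that(1)] by (simp add: tip_def m_assoc)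
      then have "edge t (snd e, False) = e" by (simp add: edge_def prod_eq_iff)
      then show "edge (v \<otimes> lv l) (snd e, False) \<in> E" using that(1) by (simp add: t_def)
    qed
    have same: "e = e0" if "e \<in> E" "d e \<noteq> 0" for e
    proof -
      have "fst e = t \<or> tip e = t" using that(2) by (auto simp: d_def split: if_splits)
      then have "edge t (linv l) = e"
      proof
        assume "fst e = t"
        then show ?thesis using fst_t[OF that(1)] by (simp add: edge_def prod_eq_iff flip: fst_t[OF that(1)])
      next
        assume a: "tip e = t"
        have "t \<otimes> inv (\<sigma> (snd e)) = fst e" using a[symmetric] Ec[OF that(1)] by (simp add: tip_def m_assoc)
        then show ?thesis using tip_t[OF that(1) a] by (simp add: edge_def prod_eq_iff flip: tip_t[OF that(1) a])
      qed
      then show ?thesis using v by (simp add: t_def e0_def)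
    qed
    have e0E: "e0 \<in> E" using e by (simp add: e0_def)
    have d0: "d e0 = 1 \<or> d e0 = -1"
    proof -
      have "fst e0 = t \<or> tip e0 = t" using v by (auto simp: e0_def t_def tip_edge fst_edge)
      \<comment> \<open>A loop at \<open>t\<close> would leave two continuations, only one of which
        backtracks.\<close>
      moreover have "\<not> (fst e0 = t \<and> tip e0 = t)" using fst_t[OF e0E] tip_t[OF e0E] by (metis Pair_inject)
      ultimately show ?thesis by (auto simp: d_def)
    qed
    have "0 = lookup (bd z) t" using z by simp
    also have "\<dots> = lin d z"
      unfolding bd_def lookup_frag_extend by (rule lin_cong) (auto simp: d_def lookup_minus)
    also have "\<dots> = lookup z e0 * d e0 + (\<Sum>e \<in> keys z - {e0}. lookup z e * d e)"
      unfolding lin_def using e0E EK by (intro sum.remove) auto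
    finally have "lookup z e0 * d e0 = - (\<Sum>e \<in> keys z - {e0}. lookup z e * d e)" by simp
    moreover have "n dvd (\<Sum>e \<in> keys z - {e0}. lookup z e * d e)"
    proof (rule dvd_sum)
      fix e assume "e \<in> keys z - {e0}"
      then have "e \<notin> E \<or> d e = 0" using same by blast
      then show "n dvd lookup z e * d e" by (auto simp: E_def)
    qed
    ultimately have "n dvd lookup z e0 * d e0" by simp
    then have "n dvd lookup z e0" using d0 by auto
    then show False using e0E by (simp add: E_def)
  qed
  obtain e where e: "e \<in> E" using n by (auto simp: E_def)
  define step where "step = (\<lambda>(v, l). (v \<otimes> lv l, SOME l'. l' \<noteq> linv l \<and> edge (v \<otimes> lv l) l' \<in> E))"
  define dart where "dart k = (step ^^ k) (fst e, (snd e, True))" for k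
  define V where "V k = fst (dart k)" for k
  define L where "L k = snd (dart k)" for k
  have inv: "V k \<in> carrier G \<and> edge (V k) (L k) \<in> E" for k
  proof (induction k)
    case 0
    then show ?case using e Ec by (simp add: V_def L_def dart_def edge_def)
  next
    case (Suc k)
    have "dart (Suc k) = (V k \<otimes> lv (L k), SOME l'. l' \<noteq> linv (L k) \<and> edge (V k \<otimes> lv (L k)) l' \<in> E)"
      by (simp add: dart_def V_def L_def step_def split_beta)
    then show ?case using someI_ex[OF nxt[of "V k" "L k"]] Suc by (simp add: V_def[of "Suc k"] L_def[of "Suc k"])
  qed
  have Suc: "V (Suc k) = V k \<otimes> lv (L k)" "L (Suc k) \<noteq> linv (L k)" for k
  proof -
    have "dart (Suc k) = (V k \<otimes> lv (L k), SOME l'. l' \<noteq> linv (L k) \<and> edge (V k \<otimes> lv (L k)) l' \<in> E)"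
      by (simp add: dart_def V_def L_def step_def split_beta)
    then show "V (Suc k) = V k \<otimes> lv (L k)" "L (Suc k) \<noteq> linv (L k)"
      using someI_ex[OF nxt[of "V k" "L k"]] inv[of k] by (simp_all add: V_def[of "Suc k"] L_def[of "Suc k"])
  qed
  have seg: "V (i + k) = V i \<otimes> wv (map L [i..<i + k])" for i k
  proof (induction k)
    case (Suc k)
    then show ?case using Suc.IH inv[of i] by (simp add: Suc(1) \<open>\<And>k. V (Suc k) = V k \<otimes> lv (L k)\<close> wv_append m_assoc)
  qed (use inv in simp)
  have seg_edges: "edges (V i) (map L [i..<i + k]) \<subseteq> E" for i k
  proof (induction k)
    case (Suc k)
    then show ?case using inv[of i] inv[of "i + k"] by (simp add: edges_append seg[symmetric])
  qed simp
  have "finite E" by (rule finite_subset[OF EK]) simp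
  moreover have "range V \<subseteq> fst ` E \<union> tip ` E"
  proof
    fix v assume "v \<in> range V"
    then obtain k where k: "v = V k" by blast
    have "v = fst (edge (V k) (L k)) \<or> v = tip (edge (V k) (L k))"
      using inv[of k] by (auto simp: k tip_edge fst_edge)
    then show "v \<in> fst ` E \<union> tip ` E" using inv[of k] by blast
  qed
  ultimately have "finite (range V)" by (auto intro: finite_subset)
  then have "\<not> inj V" using finite_imageD infinite_UNIV_nat by blast
  then obtain i0 j0 where ij0: "V i0 = V j0" "i0 < j0"
    unfolding inj_def by (metis linorder_neqE_nat)
  \<comment> \<open>The minimum runs over all starting indices, so no proper segment of the chosen
    one closes up.\<close>
  define k where "k = (LEAST k. k > 0 \<and> (\<exists>i. V i = V (i + k)))"
  have "\<exists>k. k > 0 \<and> (\<exists>i. V i = V (i + k))" using ij0 by (intro exI[of _ "j0 - i0"] conjI exI[of _ i0]) auto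
  from LeastI_ex[OF this] obtain i where k: "k > 0" "V i = V (i + k)" unfolding k_def by blast
  have k_min: "k \<le> m" if "m > 0" "V j = V (j + m)" for j m
    unfolding k_def by (rule Least_le) (use that in blast)
  define u where "u = map L [i..<i + k]"
  have len: "length u = k" by (simp add: u_def)
  have one: "wv (map L [j..<j + m]) = \<one> \<longleftrightarrow> V j = V (j + m)" for j m
  proof -
    have "V j \<otimes> wv (map L [j..<j + m]) = V j \<longleftrightarrow> wv (map L [j..<j + m]) = \<one>"
      using inv[of j] by (intro l_cancel_one) auto
    then show ?thesis unfolding seg[symmetric] by auto
  qed
  have "simple u" unfolding simple_def
  proof (intro conjI allI impI)
    show "u \<noteq> []" using len k by auto
    show "wv u = \<one>" using one k by (simp add: u_def)
    fix l show "u \<noteq> [l, linv l]"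
    proof
      assume a: "u = [l, linv l]"
      then have "k = 2" using len by simp
      then have "u = [L i, L (Suc i)]" by (simp add: u_def upt_rec)
      then show False using a Suc(2)[of i] by (metis list.inject)
    qed
  next
    fix a b c assume abc: "u = a @ b @ c" and b: "wv b = \<one>"
    show "b = [] \<or> a @ c = []"
    proof (rule disjCI)
      assume ac: "a @ c \<noteq> []"
      have "b = take (length b) (drop (length a) u)" using abc by simp
      also have "\<dots> = map L [i + length a..<i + length a + length b]"
        using arg_cong[OF abc, of length] unfolding len by (simp add: u_def drop_map take_map take_upt)
      finally have "V (i + length a) = V (i + length a + length b)" using b one by metis
      then have "length b = 0 \<or> k \<le> length b" using k_min by blast
      moreover have "length b < k" using abc len ac by (cases a; cases c) auto
      ultimately show "b = []" by auto
    qed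
  qed
  moreover have "edges (V i) u \<subseteq> E" using seg_edges by (simp add: u_def)
  moreover have "fst ` set u \<subseteq> S"
  proof -
    have "fst ` set u = snd ` edges (V i) u" by (simp add: snd_edges)
    also have "\<dots> \<subseteq> S" using Ec(2) \<open>edges (V i) u \<subseteq> E\<close> by (intro image_subsetI) blast
    finally show ?thesis .
  qed
  ultimately show thesis using that[of "V i" u] inv[of i] unfolding E_def by blast
qed

end

subsection \<open>Fox calculus\<close>

declare mult_FactGroup [simp del] one_FactGroup [simp del]

text \<open>Free reduction; it serves to show that the chain of a word depends only on the element
  of the free group.\<close>

primrec red :: "('x \<times> bool) list \<Rightarrow> ('x \<times> bool) list" where
  "red [] = []"
| "red (l # u) = (case red u of [] \<Rightarrow> [l] | m # r \<Rightarrow> if m = linv l then r else l # m # r)"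

lemma set_red: "set (red u) \<subseteq> set u"
  by (induction u) (auto split: list.splits if_splits)

lemma reduced_red: "reduced_word (red u)"
proof (induction u)
  case (Cons l u)
  then show ?case
    by (auto simp: reduced_word_def successively_Cons linv_def prod_eq_iff split: list.splits if_splits)
qed (simp add: reduced_word_def)

context marked_group
begin

lemma ch_red: "v \<in> carrier G \<Longrightarrow> ch v (red u) = ch v u" and wv_red: "wv (red u) = wv u"
proof -
  show w: "wv (red u) = wv u" for u
  proof (induction u)
    case (Cons l u)
    show ?case
    proof (cases "red u")
      case (Cons m r)
      then show ?thesis using Cons.IH[symmetric] by (auto simp: inv_cancel_left m_assoc)
    qed (use Cons.IH in simp)
  qed simp
  show "v \<in> carrier G \<Longrightarrow> ch v (red u) = ch v u"
  proof (induction u arbitrary: v)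
    case (Cons l u)
    show ?case
    proof (cases "red u")
      case (Cons m r)
      have "frag_cmul (sg l) y + frag_cmul (- sg l) y = 0" for y :: "'a \<times> 'x \<Rightarrow>\<^sub>0 int"
        by (simp flip: frag_cmul_distrib)
      then show ?thesis using Cons Cons.IH[of "v \<otimes> lv l", symmetric] Cons.prems
        by (auto simp: m_assoc add.assoc[symmetric])
    qed (use Cons.IH[of "v \<otimes> lv l", symmetric] Cons.prems in simp)
  qed simp
qed

end

section \<open>Words in the basis and Fox derivatives\<close>

locale free_quotient = normal N F for N and F (structure) +
  fixes S assumes basis: "free_basis F S"
begin

definition \<iota> where "\<iota> x = (if x \<in> S then x else \<one>)"

definition \<pi> where "\<pi> f = N #> f"

definition \<sigma> where "\<sigma> x = (if x \<in> S then \<pi> x else N)"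

lemma S_closed: "x \<in> S \<Longrightarrow> x \<in> carrier F"
  using basis by (auto simp: free_basis_def)

lemma \<pi>_closed [simp, intro]: "f \<in> carrier F \<Longrightarrow> \<pi> f \<in> carrier (F Mod N)"
  by (auto simp: \<pi>_def FactGroup_def RCOSETS_def)

lemma \<pi>_mult: "f \<in> carrier F \<Longrightarrow> g \<in> carrier F \<Longrightarrow> \<pi> (f \<otimes> g) = \<pi> f \<otimes>\<^bsub>F Mod N\<^esub> \<pi> g"
  by (simp add: \<pi>_def FactGroup_def rcos_sum)

lemma \<pi>_hom: "group_hom F (F Mod N) \<pi>"
  by (intro group_hom.intro group_hom_axioms.intro is_group factorgroup_is_group homI) (auto simp: \<pi>_mult)

lemma \<pi>_one_iff: "f \<in> carrier F \<Longrightarrow> \<pi> f = \<one>\<^bsub>F Mod N\<^esub> \<longleftrightarrow> f \<in> N"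
  using rcos_self[OF _ subgroup_axioms, of f] rcos_const[OF is_group] by (auto simp: \<pi>_def FactGroup_def)

lemma \<pi>_surj: "g \<in> carrier (F Mod N) \<Longrightarrow> \<exists>f \<in> carrier F. \<pi> f = g"
  by (auto simp: \<pi>_def FactGroup_def RCOSETS_def)

sublocale I: marked_group F \<iota>
  by unfold_locales (auto simp: \<iota>_def S_closed)

sublocale C: marked_group "F Mod N" \<sigma>
proof (intro marked_group.intro marked_group_axioms.intro factorgroup_is_group)
  fix x show "\<sigma> x \<in> carrier (F Mod N)"
    using monoid.one_closed[OF group.is_monoid[OF factorgroup_is_group]] S_closed
    by (auto simp: \<sigma>_def one_FactGroup)
qed

definition Sword :: "('a \<times> bool) list \<Rightarrow> bool" where "Sword u \<longleftrightarrow> fst ` set u \<subseteq> S"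

lemma Sword_simps [simp]: "Sword []" "Sword (l # u) \<longleftrightarrow> fst l \<in> S \<and> Sword u" "Sword (u @ u') \<longleftrightarrow> Sword u \<and> Sword u'"
  by (auto simp: Sword_def)

lemma Sword_winv [simp]: "Sword (winv u) \<longleftrightarrow> Sword u"
  by (induction u) (auto simp: winv_Cons)

lemma word_value_I: "Sword u \<Longrightarrow> word_value F u = I.wv u"
  by (induction u) (auto simp: letter_value_def lval_def \<iota>_def)

lemma wv_quotient: "Sword u \<Longrightarrow> C.wv u = \<pi> (I.wv u)"
proof (induction u)
  case Nil
  then show ?case using \<pi>_one_iff[of \<one>] by simp
next
  case (Cons l u)
  interpret h: group_hom F "F Mod N" \<pi> by (rule \<pi>_hom)
  have "C.lv l = \<pi> (I.lv l)" using Cons.prems by (auto simp: lval_def \<sigma>_def \<iota>_def S_closed)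
  then show ?case using Cons by simp
qed

lemma red_eqI: assumes "Sword u" "Sword u'" "I.wv u = I.wv u'" shows "red u = red u'"
proof -
  have *: "red u \<in> {u \<in> lists (S \<times> UNIV). reduced_word u}" if "Sword u" for u :: "('a \<times> bool) list"
    using that set_red[of u] reduced_red[of u] by (fastforce simp: Sword_def lists_eq_set)
  have sr: "Sword (red u)" if "Sword u" for u using set_red[of u] that by (auto simp: Sword_def)
  have "inj_on (word_value F) {u \<in> lists (S \<times> UNIV). reduced_word u}"
    using basis by (simp add: free_basis_def bij_betw_def)
  moreover have "word_value F (red u) = word_value F (red u')"
    using assms sr by (simp add: word_value_I I.wv_red)
  ultimately show ?thesis using * assms by (meson inj_onD)
qed

lemma ch_eqI: "Sword u \<Longrightarrow> Sword u' \<Longrightarrow> I.wv u = I.wv u' \<Longrightarrow> v \<in> carrier (F Mod N) \<Longrightarrow> C.ch v u = C.ch v u'"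
  using red_eqI[of u u'] C.ch_red by metis

lemma Sword_ex: assumes "x \<in> carrier F" shows "\<exists>u. Sword u \<and> I.wv u = x"
proof -
  have "x \<in> word_value F ` {u \<in> lists (S \<times> UNIV). reduced_word u}"
    using basis assms by (simp add: free_basis_def bij_betw_def)
  then obtain u where u: "u \<in> lists (S \<times> UNIV)" "word_value F u = x" by blast
  then have "Sword u" by (auto simp: Sword_def lists_eq_set)
  then show ?thesis using u word_value_I by metis
qed

definition wd where "wd x = (SOME u. Sword u \<and> I.wv u = x)"

lemma wd: assumes "x \<in> carrier F" shows "Sword (wd x)" "I.wv (wd x) = x"
  using someI_ex[OF Sword_ex[OF assms]] by (auto simp: wd_def)

text \<open>Fox derivatives with values in the integral group ring of \<open>F Mod N\<close>: the
  entry at \<open>(g, s)\<close> is the coefficient of \<open>g\<close> in the derivative with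
  respect to \<open>s\<close>. By \<open>fox_wv\<close> any word for \<open>x\<close> gives the same
  chain.\<close>

definition fox :: "'a \<Rightarrow> ('a set \<times> 'a \<Rightarrow>\<^sub>0 int)" where "fox x = C.ch \<one>\<^bsub>F Mod N\<^esub> (wd x)"

lemma fox_wv: "Sword u \<Longrightarrow> fox (I.wv u) = C.ch \<one>\<^bsub>F Mod N\<^esub> u"
  unfolding fox_def by (rule ch_eqI) (auto simp: wd)

lemma keys_fox: assumes "x \<in> carrier F" shows "keys (fox x) \<subseteq> carrier (F Mod N) \<times> S"
proof -
  have "C.edges \<one>\<^bsub>F Mod N\<^esub> (wd x) \<subseteq> carrier (F Mod N) \<times> S"
    using wd[OF assms] by (intro C.edges_subset) (auto simp: Sword_def)
  then show ?thesis using C.keys_ch unfolding fox_def by blast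
qed

text \<open>The product rule of Fox calculus: the path for \<open>y\<close> is read from the vertex
  where the path for \<open>x\<close> ends. On \<open>N\<close> the translation is trivial and
  \<open>fox\<close> becomes additive.\<close>

lemma fox_mult:
  assumes "x \<in> carrier F" "y \<in> carrier F"
  shows "fox (x \<otimes> y) = fox x + C.shc (\<pi> x) (fox y)"
proof -
  have "fox (x \<otimes> y) = C.ch \<one>\<^bsub>F Mod N\<^esub> (wd x @ wd y)"
    using fox_wv[of "wd x @ wd y"] assms by (simp add: wd I.wv_append)
  also have "\<dots> = fox x + C.ch (\<pi> x \<otimes>\<^bsub>F Mod N\<^esub> \<one>\<^bsub>F Mod N\<^esub>) (wd y)"
    using assms by (simp add: C.ch_append fox_def wv_quotient wd)
  also have "\<dots> = fox x + C.shc (\<pi> x) (fox y)"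
    using assms by (subst C.ch_shift) (auto simp: fox_def)
  finally show ?thesis .
qed

lemma shc_one: "fst ` keys z \<subseteq> carrier (F Mod N) \<Longrightarrow> C.shc \<one>\<^bsub>F Mod N\<^esub> z = z"
proof -
  assume "fst ` keys z \<subseteq> carrier (F Mod N)"
  then have "C.shc \<one>\<^bsub>F Mod N\<^esub> z = frag_extend frag_of z"
    unfolding C.shc_def by (intro frag_extend_eq) auto
  then show ?thesis using frag_expansion[of z] by simp
qed

lemma fox_closed: "x \<in> carrier F \<Longrightarrow> fst ` keys (fox x) \<subseteq> carrier (F Mod N)"
  using keys_fox[of x] by auto

lemma fox_mult_N: "x \<in> N \<Longrightarrow> y \<in> carrier F \<Longrightarrow> fox (x \<otimes> y) = fox x + fox y"
  using fox_mult[of x y] \<pi>_one_iff[of x] shc_one[OF fox_closed, of y] by simp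

lemma fox_one [simp]: "fox \<one> = 0"
  using fox_wv[of "[]"] by simp

lemma fox_inv: "x \<in> N \<Longrightarrow> fox (inv x) = - fox x"
  using fox_mult_N[of x "inv x"] by (simp add: eq_neg_iff_add_eq_0 add.commute)

lemma fox_int_pow: assumes x: "x \<in> N" shows "fox (x [^] (k::int)) = frag_cmul k (fox x)"
proof -
  have nat: "fox (x [^] (k::nat)) = frag_cmul (int k) (fox x)" for k
  proof (induction k)
    case (Suc k)
    have "x [^] k \<in> N" using x by (induction k) auto
    then show ?case using Suc x by (simp add: fox_mult_N frag_cmul_distrib algebra_simps)
  qed simp
  show ?thesis
  proof (cases k rule: int_cases2)
    case (nonneg m)
    then show ?thesis using nat by (simp add: int_pow_int)
  next
    case (nonpos m)
    have "x [^] m \<in> N" using x by (induction m) auto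
    then show ?thesis using nat[of m] x nonpos by (simp add: int_pow_neg int_pow_int fox_inv)
  qed
qed

lemma bd_fox: "x \<in> N \<Longrightarrow> C.bd (fox x) = 0"
proof -
  assume x: "x \<in> N"
  have "\<one>\<^bsub>F Mod N\<^esub> \<otimes>\<^bsub>F Mod N\<^esub> C.wv (wd x) = \<one>\<^bsub>F Mod N\<^esub>"
    using x wd[of x] \<pi>_one_iff[of x] by (simp add: wv_quotient)
  then show ?thesis unfolding fox_def by (subst C.bd_ch) auto
qed

text \<open>The loop \<open>x\<close> returns to its starting vertex, so the paths for
  \<open>f\<close> and for its inverse run over the same edges with opposite signs.\<close>

lemma fox_conj:
  assumes "x \<in> N" "f \<in> carrier F"
  shows "fox (f \<otimes> x \<otimes> inv f) = C.shc (\<pi> f) (fox x)"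
proof -
  interpret h: group_hom F "F Mod N" \<pi> by (rule \<pi>_hom)
  have px: "\<pi> x = \<one>\<^bsub>F Mod N\<^esub>" using assms \<pi>_one_iff by auto
  have "0 = fox (f \<otimes> inv f)" using assms by simp
  also have "\<dots> = fox f + C.shc (\<pi> f) (fox (inv f))" using assms by (intro fox_mult) auto
  finally have 0: "fox f + C.shc (\<pi> f) (fox (inv f)) = 0" by simp
  have "fox (f \<otimes> x \<otimes> inv f) = fox f + C.shc (\<pi> f) (fox x) + C.shc (\<pi> f) (fox (inv f))"
    using assms px by (simp add: fox_mult)
  then show ?thesis using 0 by (simp add: algebra_simps add_eq_0_iff)
qed

text \<open>Closed paths at the base point realise all cycles: close up every edge by chosen paths to its
  end points; the contributions of these paths cancel along a cycle.\<close>

lemma cycle_is_fox: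
  assumes "C.bd z = 0" "keys z \<subseteq> carrier (F Mod N) \<times> S"
  shows "\<exists>x \<in> N. fox x = z"
proof -
  define \<tau> where "\<tau> g = (SOME f. f \<in> carrier F \<and> \<pi> f = g)" for g
  have \<tau>: "\<tau> g \<in> carrier F" "\<pi> (\<tau> g) = g" if "g \<in> carrier (F Mod N)" for g
    using someI_ex[of "\<lambda>f. f \<in> carrier F \<and> \<pi> f = g"] \<pi>_surj[OF that] by (auto simp: \<tau>_def)
  interpret h: group_hom F "F Mod N" \<pi> by (rule \<pi>_hom)
  define W where "W = frag_extend (\<lambda>g. fox (\<tau> g))"
  \<comment> \<open>The correction term makes the claim hold for chains that are not cycles, so that
    induction over chains applies.\<close>
  have "\<exists>x \<in> N. fox x = z - W (C.bd z)"
    using assms(2)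
  proof (induction z rule: frag_induction)
    case zero
    show ?case by (intro bexI[of _ \<one>]) (auto simp: W_def)
  next
    case (one e)
    obtain g s where e: "e = (g, s)" by (cases e)
    have g: "g \<in> carrier (F Mod N)" and s: "s \<in> S" "s \<in> carrier F" using one e S_closed by auto
    have tip: "C.tip e = g \<otimes>\<^bsub>F Mod N\<^esub> \<pi> s" using s by (simp add: C.tip_def e \<sigma>_def)
    then have t: "C.tip e \<in> carrier (F Mod N)" using g s by simp
    define y where "y = \<tau> (C.tip e)"
    have y: "y \<in> carrier F" "\<pi> y = C.tip e" using \<tau>[OF t] by (auto simp: y_def)
    define x where "x = \<tau> g \<otimes> s \<otimes> inv y"
    have "fox s = C.ch \<one>\<^bsub>F Mod N\<^esub> [(s, True)]"
      using fox_wv[of "[(s, True)]"] s by (simp add: lval_def \<iota>_def)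
    then have fs: "fox s = frag_of (\<one>\<^bsub>F Mod N\<^esub>, s)" by (simp add: C.edge_def C.sg_def)
    have xc: "x \<in> carrier F" using \<tau>[OF g] s y by (simp add: x_def)
    have "\<pi> x = \<one>\<^bsub>F Mod N\<^esub>" using \<tau>[OF g] s y g by (simp add: x_def tip)
    then have xN: "x \<in> N" using \<pi>_one_iff[OF xc] by simp
    have "x \<otimes> y = \<tau> g \<otimes> s" using \<tau>[OF g] s y by (simp add: x_def m_assoc)
    then have "fox x + fox y = fox (\<tau> g) + C.shc g (fox s)"
      using fox_mult_N[OF xN y(1)] fox_mult[of "\<tau> g" s] \<tau>[OF g] s by simp
    also have "C.shc g (fox s) = frag_of e" using g by (simp add: fs C.shift_def e)
    finally have "fox x = frag_of e - W (C.bd (frag_of e))"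
      by (simp add: W_def C.bd_def frag_extend_diff y_def e algebra_simps)
    then show ?case using xN by blast
  next
    case (diff a b)
    then obtain x y where xy: "x \<in> N" "fox x = a - W (C.bd a)" "y \<in> N" "fox y = b - W (C.bd b)" by blast
    have "fox (x \<otimes> inv y) = (a - b) - W (C.bd (a - b))"
      using xy by (simp add: fox_mult_N fox_inv C.bd_diff W_def frag_extend_diff)
    then show ?case using xy by (intro bexI[of _ "x \<otimes> inv y"]) auto
  qed
  then show ?thesis using assms(1) by (simp add: W_def)
qed

text \<open>Sending an edge to the class of the loop that it forms together with coset representatives
  of its end points inverts \<open>fox\<close> on the abelianization.\<close>

lemma fox_zero_derived:
  assumes x: "x \<in> N" and 0: "fox x = 0"
  shows "x \<in> derived F N"
proof -
  define D where "D = derived F N"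
  interpret D: normal D F unfolding D_def by (rule derived_is_normal) (rule normal_axioms)
  have nrm: "N \<lhd> F" by (rule normal_axioms)
  define A where "A = abelianization F N"
  interpret A: comm_group A
  proof -
    interpret A: group A unfolding A_def by (rule group_abelianization[OF nrm])
    show "comm_group A"
    proof (rule A.group_comm_groupI)
      fix a b assume "a \<in> carrier A" "b \<in> carrier A"
      then obtain m k where mk: "m \<in> N" "k \<in> N" "a = D #> m" "b = D #> k"
        by (auto simp: A_def D_def carrier_abelianization)
      have "m \<otimes> k \<otimes> inv m \<otimes> inv k \<in> D"
        unfolding D_def derived_def using mk by (intro generate.incl) blast
      then have "(m \<otimes> k) \<otimes> inv (k \<otimes> m) \<in> D" using mk by (simp add: inv_mult_group m_assoc)
      then have "D #> (m \<otimes> k) = D #> (k \<otimes> m)"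
        using mk by (intro repr_independence[OF _ _ D.subgroup_axioms, symmetric])
          (auto simp: r_coset_def m_assoc intro!: bexI[of _ "(m \<otimes> k) \<otimes> inv (k \<otimes> m)"])
      then show "a \<otimes>\<^bsub>A\<^esub> b = b \<otimes>\<^bsub>A\<^esub> a" using mk abelianization_mult[OF nrm]
        by (simp add: A_def D_def)
    qed
  qed
  have Dm: "D #> m \<in> carrier A" if "m \<in> N" for m using that by (auto simp: A_def D_def carrier_abelianization)
  have Dmult: "D #> (m \<otimes> k) = (D #> m) \<otimes>\<^bsub>A\<^esub> (D #> k)" if "m \<in> N" "k \<in> N" for m k
    using abelianization_mult[OF nrm that] by (simp add: A_def D_def)
  define \<tau> where "\<tau> g = (SOME f. f \<in> carrier F \<and> \<pi> f = g)" for g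
  have \<tau>: "\<tau> g \<in> carrier F" "\<pi> (\<tau> g) = g" if "g \<in> carrier (F Mod N)" for g
    using someI_ex[of "\<lambda>f. f \<in> carrier F \<and> \<pi> f = g"] \<pi>_surj[OF that] by (auto simp: \<tau>_def)
  interpret h: group_hom F "F Mod N" \<pi> by (rule \<pi>_hom)
  have loop: "\<tau> g \<otimes> f \<otimes> inv (\<tau> (g \<otimes>\<^bsub>F Mod N\<^esub> \<pi> f)) \<in> N" if "g \<in> carrier (F Mod N)" "f \<in> carrier F" for g f
    by (subst \<pi>_one_iff[symmetric]) (use that \<tau> in \<open>auto\<close>)
  define \<nu> where "\<nu> e = D #> (\<tau> (fst e) \<otimes> snd e \<otimes> inv (\<tau> (C.tip e)))" for e
  have tip: "C.tip (g, s) = g \<otimes>\<^bsub>F Mod N\<^esub> \<pi> s" if "s \<in> S" for g s using that by (simp add: C.tip_def \<sigma>_def)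
  have "\<nu> ` (carrier (F Mod N) \<times> S) \<subseteq> carrier A" using loop S_closed Dm by (auto simp: \<nu>_def tip)
  then obtain k where k: "k \<in> hom (free_Abelian_group (carrier (F Mod N) \<times> S)) A"
    "\<And>e. e \<in> carrier (F Mod N) \<times> S \<Longrightarrow> k (frag_of e) = \<nu> e"
    using A.free_Abelian_group_universal by blast
  interpret k: group_hom "free_Abelian_group (carrier (F Mod N) \<times> S)" A k
    by (intro group_hom.intro group_hom_axioms.intro) (auto simp: k A.is_group)
  \<comment> \<open>Representatives of the intermediate vertices telescope; those of the two end
    points remain.\<close>
  have kch: "k (C.ch v u) = D #> (\<tau> v \<otimes> I.wv u \<otimes> inv (\<tau> (v \<otimes>\<^bsub>F Mod N\<^esub> C.wv u)))"
    if "Sword u" "v \<in> carrier (F Mod N)" for u v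
    using that
  proof (induction u arbitrary: v)
    case Nil
    then show ?case using k.hom_one \<tau> by (simp add: coset_mult_one[OF D.subset]) (simp add: A_def abelianization_def FactGroup_def D_def)
  next
    case (Cons l u)
    obtain s b where l: "l = (s, b)" by (cases l)
    have s: "s \<in> S" "s \<in> carrier F" using Cons.prems l S_closed by auto
    have Cl: "C.lv l = \<pi> (I.lv l)" using wv_quotient[of "[l]"] s by (simp add: l)
    define v' where "v' = v \<otimes>\<^bsub>F Mod N\<^esub> C.lv l"
    have v': "v' \<in> carrier (F Mod N)" using Cons.prems by (simp add: v'_def)
    let ?e = "C.edge v l"
    have e: "?e \<in> carrier (F Mod N) \<times> S" using Cons.prems s by (simp add: mem_Times_iff l)
    have rest: "keys (C.ch v' u) \<subseteq> carrier (F Mod N) \<times> S"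
      using C.keys_ch[of v' u] C.edges_subset[OF v', of u S] Cons.prems by (auto simp: Sword_def)
    have first: "k (frag_cmul (C.sg l) (frag_of ?e)) = D #> (\<tau> v \<otimes> I.lv l \<otimes> inv (\<tau> v'))"
    proof (cases b)
      case True
      then have "?e = (v, s)" by (simp add: C.edge_def l)
      then show ?thesis using k(2)[OF e] s True
        by (simp add: C.sg_def l \<nu>_def tip v'_def \<iota>_def lval_def \<sigma>_def)
    next
      case False
      then have l': "I.lv l = inv s" "C.sg l = -1" using s by (simp_all add: l lval_def \<iota>_def C.sg_def)
      have vs: "v' = v \<otimes>\<^bsub>F Mod N\<^esub> inv\<^bsub>F Mod N\<^esub> \<pi> s" using Cl s l' by (simp add: v'_def)
      then have ee: "?e = (v', s)" using False s by (simp add: C.edge_def l \<sigma>_def)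
      have tv: "C.tip ?e = v" using Cons.prems s by (simp add: ee tip vs C.m_assoc)
      have m: "\<tau> v' \<otimes> s \<otimes> inv (\<tau> v) \<in> N"
        using loop[OF v' s(2)] tv ee tip[OF s(1), of v'] by simp
      have "k (- frag_of ?e) = inv\<^bsub>A\<^esub> (\<nu> ?e)"
        using k.hom_inv[of "frag_of ?e"] e k(2)[OF e] by simp
      also have "\<nu> ?e = D #> (\<tau> v' \<otimes> s \<otimes> inv (\<tau> v))" using tv ee by (simp add: \<nu>_def)
      also have "inv\<^bsub>A\<^esub> \<dots> = D #> inv (\<tau> v' \<otimes> s \<otimes> inv (\<tau> v))"
      proof (rule A.inv_equality)
        show "(D #> inv (\<tau> v' \<otimes> s \<otimes> inv (\<tau> v))) \<otimes>\<^bsub>A\<^esub> (D #> (\<tau> v' \<otimes> s \<otimes> inv (\<tau> v))) = \<one>\<^bsub>A\<^esub>"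
          using Dmult[OF subgroup.m_inv_closed[OF subgroup_axioms m] m] m
          by (simp add: coset_mult_one[OF D.subset]) (simp add: A_def abelianization_def FactGroup_def D_def)
      qed (use Dm m in auto)
      also have "inv (\<tau> v' \<otimes> s \<otimes> inv (\<tau> v)) = \<tau> v \<otimes> I.lv l \<otimes> inv (\<tau> v')"
        using s \<tau>[OF v'] \<tau>[of v] Cons.prems by (simp add: l' inv_mult_group m_assoc)
      finally show ?thesis by (simp add: l')
    qed
    have N1: "\<tau> v \<otimes> I.lv l \<otimes> inv (\<tau> v') \<in> N" using loop[of v "I.lv l"] Cons.prems by (simp add: v'_def Cl)
    have N2: "\<tau> v' \<otimes> I.wv u \<otimes> inv (\<tau> (v' \<otimes>\<^bsub>F Mod N\<^esub> C.wv u)) \<in> N"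
      using loop[OF v', of "I.wv u"] Cons.prems by (simp add: wv_quotient)
    have "k (C.ch v (l # u)) = k (frag_cmul (C.sg l) (frag_of ?e)) \<otimes>\<^bsub>A\<^esub> k (C.ch v' u)"
      using k.hom_mult[of "frag_cmul (C.sg l) (frag_of ?e)" "C.ch v' u"] e rest keys_cmul[of "C.sg l" "frag_of ?e"]
      by (auto simp: v'_def subset_eq)
    also have "\<dots> = (D #> (\<tau> v \<otimes> I.lv l \<otimes> inv (\<tau> v'))) \<otimes>\<^bsub>A\<^esub> (D #> (\<tau> v' \<otimes> I.wv u \<otimes> inv (\<tau> (v' \<otimes>\<^bsub>F Mod N\<^esub> C.wv u))))"
      using first Cons.IH[OF _ v'] Cons.prems by simp
    also have "\<dots> = D #> ((\<tau> v \<otimes> I.lv l \<otimes> inv (\<tau> v')) \<otimes> (\<tau> v' \<otimes> I.wv u \<otimes> inv (\<tau> (v' \<otimes>\<^bsub>F Mod N\<^esub> C.wv u))))"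
      using Dmult[OF N1 N2] by simp
    also have "(\<tau> v \<otimes> I.lv l \<otimes> inv (\<tau> v')) \<otimes> (\<tau> v' \<otimes> I.wv u \<otimes> inv (\<tau> (v' \<otimes>\<^bsub>F Mod N\<^esub> C.wv u))) =
        \<tau> v \<otimes> I.wv (l # u) \<otimes> inv (\<tau> (v \<otimes>\<^bsub>F Mod N\<^esub> C.wv (l # u)))"
      using \<tau>[OF v'] \<tau>[of v] \<tau>(1)[of "v' \<otimes>\<^bsub>F Mod N\<^esub> C.wv u"] v' Cons.prems
      by (simp add: m_assoc inv_cancel_left v'_def C.m_assoc)
    finally show ?case .
  qed
  let ?t = "\<tau> \<one>\<^bsub>F Mod N\<^esub>"
  have t: "?t \<in> carrier F" using \<tau> by simp
  have xc: "x \<in> carrier F" using x by simp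
  have "C.wv (wd x) = \<one>\<^bsub>F Mod N\<^esub>" using wd[OF xc] \<pi>_one_iff[OF xc] x by (simp add: wv_quotient)
  then have "k (fox x) = D #> (?t \<otimes> x \<otimes> inv ?t)"
    using kch[of "wd x" "\<one>\<^bsub>F Mod N\<^esub>"] wd[OF xc] by (simp add: fox_def)
  moreover have "k (fox x) = D" using k.hom_one by (simp add: 0) (simp add: A_def abelianization_def FactGroup_def D_def)
  ultimately have "D #> (?t \<otimes> x \<otimes> inv ?t) = D" by simp
  then have "?t \<otimes> x \<otimes> inv ?t \<in> D"
    using t xc rcos_self[OF _ D.subgroup_axioms, of "?t \<otimes> x \<otimes> inv ?t"] by simp
  then have "inv ?t \<otimes> (?t \<otimes> x \<otimes> inv ?t) \<otimes> ?t \<in> D" using D.inv_op_closed1 t by simp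
  then show ?thesis using t xc by (simp add: m_assoc inv_cancel_left D_def)
qed

end

subsection \<open>Coefficients in a domain over a right ordered group\<close>

no_notation ideal_prod (infixl "\<cdot>\<index>" 80)

lemma finite_has_maximum:
  assumes lo: "strict_linear_order_on B lt" and "finite A" "A \<noteq> {}" "A \<subseteq> B"
  shows "\<exists>m \<in> A. \<forall>x \<in> A. x \<noteq> m \<longrightarrow> (x, m) \<in> lt"
  using assms(2-4)
proof (induction A rule: finite_ne_induct)
  case (insert a A)
  then obtain m where m: "m \<in> A" "\<And>x. x \<in> A \<Longrightarrow> x \<noteq> m \<Longrightarrow> (x, m) \<in> lt" by auto
  have tr: "trans lt" and tot: "total_on B lt" using lo by (auto simp: strict_linear_order_on_def)
  have "a \<noteq> m" using insert m by auto
  then consider "(a, m) \<in> lt" | "(m, a) \<in> lt"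
    using tot insert.prems m(1) by (auto simp: total_on_def)
  then show ?case
  proof cases
    case 1
    then show ?thesis using m by (intro bexI[of _ m]) auto
  next
    case 2
    then have "(x, a) \<in> lt" if "x \<in> A" for x using m(2)[OF that] transD[OF tr] by (cases "x = m") auto
    then show ?thesis by (intro bexI[of _ a]) auto
  qed
qed simp

definition right_invariant_order :: "('g, 'b) monoid_scheme \<Rightarrow> ('g \<times> 'g) set \<Rightarrow> bool"
  where "right_invariant_order G lt \<longleftrightarrow> strict_linear_order_on (carrier G) lt \<and>
    (\<forall>a \<in> carrier G. \<forall>b \<in> carrier G. \<forall>g \<in> carrier G. (a, b) \<in> lt \<longrightarrow> (a \<otimes>\<^bsub>G\<^esub> g, b \<otimes>\<^bsub>G\<^esub> g) \<in> lt)"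

lemma right_invariant_order_converse:
  "right_invariant_order G lt \<Longrightarrow> right_invariant_order G (lt\<inverse>)"
  by (auto simp: right_invariant_order_def strict_linear_order_on_def irrefl_def total_on_def)

text \<open>Left multiplication need not be monotone, so \<open>p\<close> is chosen to make
  \<open>g \<otimes> p\<close> maximal, not \<open>p\<close> itself. If
  \<open>h \<otimes> q = g \<otimes> p\<close> with \<open>h\<close> below \<open>g\<close>, right
  invariance puts \<open>g \<otimes> p\<close> below \<open>g \<otimes> q\<close>.\<close>

lemma (in group) right_order_maximal_product:
  assumes lo: "right_invariant_order G lt"
    and A: "finite A" "A \<subseteq> carrier G" and P: "finite P" "P \<noteq> {}" "P \<subseteq> carrier G"
    and g: "g \<in> A" "\<And>h. h \<in> A \<Longrightarrow> h \<noteq> g \<Longrightarrow> (h, g) \<in> lt"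
  shows "\<exists>p \<in> P. (\<forall>h \<in> A. \<forall>q \<in> P. h \<otimes> q = g \<otimes> p \<longrightarrow> h = g \<and> q = p) \<and>
    (\<forall>q \<in> P. q \<noteq> p \<longrightarrow> (g \<otimes> q, g \<otimes> p) \<in> lt)"
proof -
  have so: "strict_linear_order_on (carrier G) lt" and
    inv: "\<And>a b c. a \<in> carrier G \<Longrightarrow> b \<in> carrier G \<Longrightarrow> c \<in> carrier G \<Longrightarrow> (a, b) \<in> lt \<Longrightarrow> (a \<otimes> c, b \<otimes> c) \<in> lt"
    using lo by (auto simp: right_invariant_order_def)
  have tr: "trans lt" and irr: "irrefl lt" using so by (auto simp: strict_linear_order_on_def)
  have gc: "g \<in> carrier G" using g A by auto
  obtain m where m: "m \<in> (\<otimes>) g ` P" "\<And>x. x \<in> (\<otimes>) g ` P \<Longrightarrow> x \<noteq> m \<Longrightarrow> (x, m) \<in> lt"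
    using finite_has_maximum[OF so, of "(\<otimes>) g ` P"] P gc by auto
  then obtain p where p: "p \<in> P" "m = g \<otimes> p" by blast
  have mx: "(g \<otimes> q, g \<otimes> p) \<in> lt" if "q \<in> P" "q \<noteq> p" for q
    using m(2)[of "g \<otimes> q"] p that P gc by (auto simp: subset_eq)
  have uniq: "h = g \<and> q = p" if h: "h \<in> A" and q: "q \<in> P" and e: "h \<otimes> q = g \<otimes> p" for h q
  proof -
    have c: "h \<in> carrier G" "q \<in> carrier G" "p \<in> carrier G" using h q p A P by auto
    have hg: "h = g"
    proof (rule ccontr)
      assume "h \<noteq> g"
      then have 1: "(g \<otimes> p, g \<otimes> q) \<in> lt" using inv[OF c(1) gc c(2) g(2)[OF h]] e by simp
      then have "q \<noteq> p" using irr by (auto simp: irrefl_def)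
      then show False using mx[OF q] 1 transD[OF tr] irr by (auto simp: irrefl_def)
    qed
    then show ?thesis using e c gc by simp
  qed
  show ?thesis by (intro bexI[OF _ p(1)] conjI ballI impI) (simp_all add: uniq[THEN conjunct1] uniq[THEN conjunct2] mx)
qed

lemma (in group) right_orderable_unique_products:
  assumes "right_orderable G"
  shows "unique_products G"
proof -
  obtain lt where lo: "right_invariant_order G lt"
    using assms by (auto simp: right_orderable_def right_invariant_order_def)
  then have so: "strict_linear_order_on (carrier G) lt" by (simp add: right_invariant_order_def)
  show ?thesis unfolding unique_products_def
  proof (intro allI impI)
    fix A P assume a: "finite A" "finite P" "A \<noteq> {}" "P \<noteq> {}" "A \<subseteq> carrier G" "P \<subseteq> carrier G"
    obtain g where g: "g \<in> A" "\<And>h. h \<in> A \<Longrightarrow> h \<noteq> g \<Longrightarrow> (h, g) \<in> lt"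
      using finite_has_maximum[OF so a(1,3,5)] by blast
    show "\<exists>g \<in> A. \<exists>p \<in> P. \<forall>g' \<in> A. \<forall>p' \<in> P. g' \<otimes> p' = g \<otimes> p \<longrightarrow> g' = g \<and> p' = p"
      using right_order_maximal_product[OF lo a(1,5,2,4,6) g] g(1) by blast
  qed
qed

section \<open>Integer multiples in a possibly noncommutative domain\<close>

context nc_domain
begin

text \<open>An integer, \<open>0\<close> for infinite additive order, so that divisibility by
  \<open>char\<close> expresses vanishing in every characteristic.\<close>

definition char :: int where "char = int (group.ord (add_monoid R) \<one>)"

lemma int_mult_eq: "a \<in> carrier R \<Longrightarrow> [(k::int)] \<cdot> a = ([k] \<cdot> \<one>) \<otimes> a"
  using add_pow_ldistr_int[of \<one> a k] by simp

lemma int_mult_one_zero: "[k] \<cdot> \<one> = \<zero> \<longleftrightarrow> char dvd k"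
  unfolding char_def by (rule add.int_pow_eq_id[OF one_closed])

lemma int_mult_char: "a \<in> carrier R \<Longrightarrow> char dvd k \<Longrightarrow> [k] \<cdot> a = \<zero>"
  using int_mult_one_zero[of k] by (subst int_mult_eq) simp_all

text \<open>\<open>[k] \<cdot> a\<close> is \<open>[k] \<cdot> \<one>\<close> times
  \<open>a\<close>, so without zero divisors all nonzero elements share the additive order of
  one.\<close>

lemma int_mult_zero_iff: "a \<in> carrier R \<Longrightarrow> a \<noteq> \<zero> \<Longrightarrow> [k] \<cdot> a = \<zero> \<longleftrightarrow> char dvd k"
  using int_mult_eq[of a k] no_zero_divisors[of "[k] \<cdot> \<one>" a] int_mult_one_zero[of k] by auto

lemma char_not_one: "\<not> char dvd 1"
  using int_mult_one_zero[of 1] one_not_zero by simp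

lemma finsum_diff:
  assumes "finite I" "\<And>i. i \<in> I \<Longrightarrow> f i \<in> carrier R" "\<And>i. i \<in> I \<Longrightarrow> g i \<in> carrier R"
  shows "(\<Oplus>i \<in> I. f i \<ominus> g i) = (\<Oplus>i \<in> I. f i) \<ominus> (\<Oplus>i \<in> I. g i)"
  using assms
proof (induction I rule: finite_induct)
  case empty
  then show ?case by (simp add: minus_eq)
next
  case (insert i I)
  have c: "(\<Oplus>i \<in> I. f i) \<in> carrier R" "(\<Oplus>i \<in> I. g i) \<in> carrier R" using insert by auto
  have "(\<Oplus>i \<in> insert i I. f i \<ominus> g i) = (f i \<ominus> g i) \<oplus> ((\<Oplus>i \<in> I. f i) \<ominus> (\<Oplus>i \<in> I. g i))"
    using insert by (simp add: Pi_def)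
  also have "\<dots> = (f i \<oplus> (\<Oplus>i \<in> I. f i)) \<ominus> (g i \<oplus> (\<Oplus>i \<in> I. g i))"
    using insert c by (simp add: minus_eq minus_add a_ac)
  finally show ?case using insert by (simp add: Pi_def)
qed

end

section \<open>Chains with coefficients in \<open>R\<close>\<close>

locale coefficient_setting = marked_group G \<sigma> + R: nc_domain R
  for G :: "('a, 'c) monoid_scheme" (structure) and \<sigma> :: "'x \<Rightarrow> 'a" and R :: "('r, 'd) ring_scheme" +
  fixes S :: "'x set"
begin

definition finite_coeff :: "('a \<Rightarrow> 'r) \<Rightarrow> bool"
  where "finite_coeff a \<longleftrightarrow> finite {g. a g \<noteq> \<zero>\<^bsub>R\<^esub>} \<and> (\<forall>g. a g \<noteq> \<zero>\<^bsub>R\<^esub> \<longrightarrow> g \<in> carrier G) \<and> (\<forall>g. a g \<in> carrier R)"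

text \<open>The coefficient at \<open>e\<close> of the product of a group ring element with an
  integral chain. Integers act centrally, so noncommutativity of \<open>R\<close> does not
  show.\<close>

definition rconv :: "('a \<Rightarrow> 'r) \<Rightarrow> ('a \<times> 'x \<Rightarrow>\<^sub>0 int) \<Rightarrow> 'a \<times> 'x \<Rightarrow> 'r"
  where "rconv a z e = (\<Oplus>\<^bsub>R\<^esub>g \<in> {g. a g \<noteq> \<zero>\<^bsub>R\<^esub>}. [(lookup z (shift (inv g) e))] \<cdot>\<^bsub>R\<^esub> a g)"

lemma rconv_superset:
  assumes "finite_coeff a" "finite T" "{g. a g \<noteq> \<zero>\<^bsub>R\<^esub>} \<subseteq> T"
  shows "rconv a z e = (\<Oplus>\<^bsub>R\<^esub>g \<in> T. [(lookup z (shift (inv g) e))] \<cdot>\<^bsub>R\<^esub> a g)"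
  unfolding rconv_def
  by (rule R.add.finprod_mono_neutral_cong_left) (use assms in \<open>auto simp: finite_coeff_def\<close>)

lemma rconv_closed: "finite_coeff a \<Longrightarrow> rconv a z e \<in> carrier R"
  unfolding rconv_def by (rule R.finsum_closed) (auto simp: finite_coeff_def)

lemma rconv_single:
  assumes a: "finite_coeff a" and g: "g \<in> carrier G"
    and z: "\<And>h. a h \<noteq> \<zero>\<^bsub>R\<^esub> \<Longrightarrow> h \<noteq> g \<Longrightarrow> R.char dvd lookup z (shift (inv h) e)"
  shows "rconv a z e = [(lookup z (shift (inv g) e))] \<cdot>\<^bsub>R\<^esub> a g"
proof -
  let ?T = "insert g {g. a g \<noteq> \<zero>\<^bsub>R\<^esub>}"
  have ac: "a h \<in> carrier R" for h using a by (simp add: finite_coeff_def)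
  have fT: "finite ?T" using a by (simp add: finite_coeff_def)
  have "rconv a z e = (\<Oplus>\<^bsub>R\<^esub>h \<in> ?T. [(lookup z (shift (inv h) e))] \<cdot>\<^bsub>R\<^esub> a h)"
    by (rule rconv_superset[OF a fT]) blast
  also have "\<dots> = (\<Oplus>\<^bsub>R\<^esub>h \<in> ?T. if g = h then [(lookup z (shift (inv h) e))] \<cdot>\<^bsub>R\<^esub> a h else \<zero>\<^bsub>R\<^esub>)"
  proof (rule R.finsum_cong'[OF refl])
    show "(\<lambda>h. if g = h then [(lookup z (shift (inv h) e))] \<cdot>\<^bsub>R\<^esub> a h else \<zero>\<^bsub>R\<^esub>) \<in> ?T \<rightarrow> carrier R"
      using ac by auto
    fix h assume "h \<in> ?T"
    then show "[(lookup z (shift (inv h) e))] \<cdot>\<^bsub>R\<^esub> a h =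
        (if g = h then [(lookup z (shift (inv h) e))] \<cdot>\<^bsub>R\<^esub> a h else \<zero>\<^bsub>R\<^esub>)"
      using R.int_mult_char[OF ac z[of h]] by auto
  qed
  also have "\<dots> = [(lookup z (shift (inv g) e))] \<cdot>\<^bsub>R\<^esub> a g"
    by (rule R.add.finprod_singleton[OF _ fT]) (use ac in auto)
  finally show ?thesis .
qed

lemma finite_coeff_update:
  assumes "finite_coeff a" "g \<in> carrier G" "s \<in> carrier R"
  shows "finite_coeff (a(g := s))"
proof -
  have "{h. (a(g := s)) h \<noteq> \<zero>\<^bsub>R\<^esub>} \<subseteq> insert g {h. a h \<noteq> \<zero>\<^bsub>R\<^esub>}" by auto
  moreover have "finite (insert g {h. a h \<noteq> \<zero>\<^bsub>R\<^esub>})" using assms by (simp add: finite_coeff_def)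
  ultimately have "finite {h. (a(g := s)) h \<noteq> \<zero>\<^bsub>R\<^esub>}" by (rule finite_subset)
  then show ?thesis using assms by (auto simp: finite_coeff_def)
qed

lemma rconv_update:
  assumes a: "finite_coeff a" and g: "g \<in> carrier G" and s: "s \<in> carrier R"
  shows "rconv (a(g := a g \<oplus>\<^bsub>R\<^esub> s)) z e = rconv a z e \<oplus>\<^bsub>R\<^esub> [(lookup z (shift (inv g) e))] \<cdot>\<^bsub>R\<^esub> s"
proof -
  let ?a = "a(g := a g \<oplus>\<^bsub>R\<^esub> s)"
  let ?U = "{g. a g \<noteq> \<zero>\<^bsub>R\<^esub>} - {g}"
  let ?k = "lookup z (shift (inv g) e)"
  have ac: "a h \<in> carrier R" for h using a by (simp add: finite_coeff_def)
  have fin: "finite ?U" using a by (simp add: finite_coeff_def)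
  have a': "finite_coeff ?a" using a g s ac by (intro finite_coeff_update) auto
  have "rconv ?a z e = (\<Oplus>\<^bsub>R\<^esub>h \<in> insert g ?U. [(lookup z (shift (inv h) e))] \<cdot>\<^bsub>R\<^esub> ?a h)"
    by (rule rconv_superset[OF a']) (use fin in auto)
  also have "\<dots> = [?k] \<cdot>\<^bsub>R\<^esub> (a g \<oplus>\<^bsub>R\<^esub> s) \<oplus>\<^bsub>R\<^esub> (\<Oplus>\<^bsub>R\<^esub>h \<in> ?U. [(lookup z (shift (inv h) e))] \<cdot>\<^bsub>R\<^esub> ?a h)"
    using fin ac s by (subst R.finsum_insert) auto
  also have "(\<Oplus>\<^bsub>R\<^esub>h \<in> ?U. [(lookup z (shift (inv h) e))] \<cdot>\<^bsub>R\<^esub> ?a h) = (\<Oplus>\<^bsub>R\<^esub>h \<in> ?U. [(lookup z (shift (inv h) e))] \<cdot>\<^bsub>R\<^esub> a h)"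
    by (rule R.finsum_cong') (use ac in auto)
  also have "[?k] \<cdot>\<^bsub>R\<^esub> (a g \<oplus>\<^bsub>R\<^esub> s) = [?k] \<cdot>\<^bsub>R\<^esub> a g \<oplus>\<^bsub>R\<^esub> [?k] \<cdot>\<^bsub>R\<^esub> s"
    using ac s by (simp add: R.add.int_pow_distrib)
  also have "([?k] \<cdot>\<^bsub>R\<^esub> a g \<oplus>\<^bsub>R\<^esub> [?k] \<cdot>\<^bsub>R\<^esub> s) \<oplus>\<^bsub>R\<^esub> (\<Oplus>\<^bsub>R\<^esub>h \<in> ?U. [(lookup z (shift (inv h) e))] \<cdot>\<^bsub>R\<^esub> a h) =
      ([?k] \<cdot>\<^bsub>R\<^esub> a g \<oplus>\<^bsub>R\<^esub> (\<Oplus>\<^bsub>R\<^esub>h \<in> ?U. [(lookup z (shift (inv h) e))] \<cdot>\<^bsub>R\<^esub> a h)) \<oplus>\<^bsub>R\<^esub> [?k] \<cdot>\<^bsub>R\<^esub> s"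
    using ac s by (simp add: R.a_ac R.finsum_closed Pi_def)
  also have "[?k] \<cdot>\<^bsub>R\<^esub> a g \<oplus>\<^bsub>R\<^esub> (\<Oplus>\<^bsub>R\<^esub>h \<in> ?U. [(lookup z (shift (inv h) e))] \<cdot>\<^bsub>R\<^esub> a h) =
      (\<Oplus>\<^bsub>R\<^esub>h \<in> insert g ?U. [(lookup z (shift (inv h) e))] \<cdot>\<^bsub>R\<^esub> a h)"
    using fin ac by (subst R.finsum_insert) auto
  also have "\<dots> = rconv a z e" by (rule rconv_superset[OF a, symmetric]) (use fin in auto)
  finally show ?thesis .
qed

text \<open>The integer \<open>m\<close> moves from the chain into the coefficients, and multiples
  of the characteristic vanish.\<close>

lemma rconv_scale:
  assumes a: "finite_coeff a" and z: "\<And>e. R.char dvd (lookup z e - m * lookup y e)"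
  shows "finite_coeff (\<lambda>g. [m] \<cdot>\<^bsub>R\<^esub> a g)" "rconv a z e = rconv (\<lambda>g. [m] \<cdot>\<^bsub>R\<^esub> a g) y e"
proof -
  have ac: "a h \<in> carrier R" for h using a by (simp add: finite_coeff_def)
  have sub: "{g. [m] \<cdot>\<^bsub>R\<^esub> a g \<noteq> \<zero>\<^bsub>R\<^esub>} \<subseteq> {g. a g \<noteq> \<zero>\<^bsub>R\<^esub>}" by auto
  have "finite {g. [m] \<cdot>\<^bsub>R\<^esub> a g \<noteq> \<zero>\<^bsub>R\<^esub>}"
    by (rule finite_subset[OF sub]) (use a in \<open>simp add: finite_coeff_def\<close>)
  then show f: "finite_coeff (\<lambda>g. [m] \<cdot>\<^bsub>R\<^esub> a g)" using a sub ac unfolding finite_coeff_def by blast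
  have "[(lookup z e)] \<cdot>\<^bsub>R\<^esub> a g = [(lookup y e)] \<cdot>\<^bsub>R\<^esub> ([m] \<cdot>\<^bsub>R\<^esub> a g)" for e g
  proof -
    have "[(lookup z e)] \<cdot>\<^bsub>R\<^esub> a g = [((lookup z e - m * lookup y e) + m * lookup y e)] \<cdot>\<^bsub>R\<^esub> a g" by simp
    also have "\<dots> = [(lookup z e - m * lookup y e)] \<cdot>\<^bsub>R\<^esub> a g \<oplus>\<^bsub>R\<^esub> [(m * lookup y e)] \<cdot>\<^bsub>R\<^esub> a g"
      using ac by (intro R.add.int_pow_mult)
    also have "\<dots> = [(m * lookup y e)] \<cdot>\<^bsub>R\<^esub> a g" using ac z by (simp add: R.int_mult_char)
    finally show ?thesis using ac by (simp add: R.add.int_pow_pow)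
  qed
  then have "rconv a z e = (\<Oplus>\<^bsub>R\<^esub>g \<in> {g. a g \<noteq> \<zero>\<^bsub>R\<^esub>}. [(lookup y (shift (inv g) e))] \<cdot>\<^bsub>R\<^esub> ([m] \<cdot>\<^bsub>R\<^esub> a g))"
    by (simp add: rconv_def)
  also have "\<dots> = rconv (\<lambda>g. [m] \<cdot>\<^bsub>R\<^esub> a g) y e"
    by (rule rconv_superset[OF f _ sub, symmetric]) (use a in \<open>simp add: finite_coeff_def\<close>)
  finally show "rconv a z e = rconv (\<lambda>g. [m] \<cdot>\<^bsub>R\<^esub> a g) y e" .
qed

text \<open>The left group ring submodule generated by \<open>z\<close>, built by adding one
  monomial multiple at a time so that closure properties follow by induction. Values outside
  \<open>carrier G \<times> S\<close> are left open.\<close>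

inductive rspan :: "('a \<times> 'x \<Rightarrow>\<^sub>0 int) \<Rightarrow> ('a \<times> 'x \<Rightarrow> 'r) \<Rightarrow> bool" for z where
  rspan_zero: "(\<And>e. e \<in> carrier G \<times> S \<Longrightarrow> y e = \<zero>\<^bsub>R\<^esub>) \<Longrightarrow> rspan z y"
| rspan_step: "rspan z y \<Longrightarrow> s \<in> carrier R \<Longrightarrow> g \<in> carrier G \<Longrightarrow>
    (\<And>e. e \<in> carrier G \<times> S \<Longrightarrow> y' e = y e \<oplus>\<^bsub>R\<^esub> [(lookup z (shift (inv g) e))] \<cdot>\<^bsub>R\<^esub> s) \<Longrightarrow> rspan z y'"

lemma rspan_closed: "rspan z y \<Longrightarrow> e \<in> carrier G \<times> S \<Longrightarrow> y e \<in> carrier R"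
  by (induction rule: rspan.induct) auto

lemma rspan_cong: "rspan z y \<Longrightarrow> (\<And>e. e \<in> carrier G \<times> S \<Longrightarrow> y' e = y e) \<Longrightarrow> rspan z y'"
proof (induction arbitrary: y' rule: rspan.induct)
  case (rspan_zero y)
  then show ?case by (intro rspan.rspan_zero) simp
next
  case (rspan_step y s g y1)
  then show ?case by (intro rspan.rspan_step[of z y s g y']) auto
qed

lemma rspan_add:
  assumes "rspan z y" "rspan z y'"
  shows "rspan z (\<lambda>e. y e \<oplus>\<^bsub>R\<^esub> y' e)"
  using assms(2)
proof (induction rule: rspan.induct)
  case (rspan_zero y')
  then show ?case by (intro rspan_cong[OF assms(1)]) (use rspan_closed[OF assms(1)] in auto)
next
  case (rspan_step y2 s g y1)
  show ?case
    by (rule rspan.rspan_step[OF rspan_step.IH rspan_step.hyps(2,3)])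
      (use rspan_step rspan_closed[OF assms(1)] rspan_closed[OF rspan_step.hyps(1)] in \<open>simp add: R.a_assoc\<close>)
qed

lemma rspan_neg: "rspan z y \<Longrightarrow> rspan z (\<lambda>e. \<ominus>\<^bsub>R\<^esub> y e)"
proof (induction rule: rspan.induct)
  case (rspan_zero y')
  then show ?case by (intro rspan.rspan_zero) simp
next
  case (rspan_step y s g y1)
  show ?case
  proof (rule rspan.rspan_step[OF rspan_step.IH, of "\<ominus>\<^bsub>R\<^esub> s" g])
    fix e assume e: "e \<in> carrier G \<times> S"
    show "\<ominus>\<^bsub>R\<^esub> y1 e = (\<ominus>\<^bsub>R\<^esub> y e) \<oplus>\<^bsub>R\<^esub> [(lookup z (shift (inv g) e))] \<cdot>\<^bsub>R\<^esub> (\<ominus>\<^bsub>R\<^esub> s)"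
      using rspan_step.hyps(2,3) rspan_step.hyps(4)[OF e] rspan_closed[OF rspan_step.hyps(1) e]
      by (simp add: R.minus_add R.add.int_pow_inv)
  qed (use rspan_step in auto)
qed

text \<open>Left multiplication by the monomial with coefficient \<open>b\<close> at
  \<open>h\<close> turns a summand with coefficient \<open>s\<close> at \<open>g\<close> into one
  with coefficient \<open>b \<otimes> s\<close> at \<open>h \<otimes> g\<close>.\<close>

lemma rspan_translate:
  assumes "rspan z y" and b: "b \<in> carrier R" and h: "h \<in> carrier G"
  shows "rspan z (\<lambda>e. b \<otimes>\<^bsub>R\<^esub> y (shift (inv h) e))"
  using assms(1)
proof (induction rule: rspan.induct)
  case (rspan_zero y)
  then show ?case using b h by (intro rspan.rspan_zero) (auto simp: shift_def)
next
  case (rspan_step y s g y1)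
  show ?case
  proof (rule rspan.rspan_step[OF rspan_step.IH, of "b \<otimes>\<^bsub>R\<^esub> s" "h \<otimes> g"])
    fix e assume e: "e \<in> carrier G \<times> S"
    then have e': "shift (inv h) e \<in> carrier G \<times> S" using h by (auto simp: shift_def)
    have "shift (inv (h \<otimes> g)) e = shift (inv g) (shift (inv h) e)"
      using e h rspan_step.hyps(3) by (auto simp: shift_def inv_mult_group m_assoc)
    then show "b \<otimes>\<^bsub>R\<^esub> y1 (shift (inv h) e) = b \<otimes>\<^bsub>R\<^esub> y (shift (inv h) e) \<oplus>\<^bsub>R\<^esub>
        [(lookup z (shift (inv (h \<otimes> g)) e))] \<cdot>\<^bsub>R\<^esub> (b \<otimes>\<^bsub>R\<^esub> s)"
      using rspan_step.hyps(2) rspan_step.hyps(4)[OF e'] rspan_closed[OF rspan_step.hyps(1) e'] b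
      by (simp add: R.r_distr R.add_pow_rdistr_int)
  qed (use rspan_step b h in auto)
qed

lemma rspan_finsum:
  assumes "finite I" "\<And>i. i \<in> I \<Longrightarrow> rspan z (y i)"
  shows "rspan z (\<lambda>e. \<Oplus>\<^bsub>R\<^esub>i \<in> I. y i e)"
  using assms
proof (induction I rule: finite_induct)
  case empty
  then show ?case by (intro rspan_zero) simp
next
  case (insert i I)
  then have "rspan z (\<lambda>e. y i e \<oplus>\<^bsub>R\<^esub> (\<Oplus>\<^bsub>R\<^esub>i \<in> I. y i e))" by (intro rspan_add) auto
  then show ?case
  proof (rule rspan_cong)
    fix e assume e: "e \<in> carrier G \<times> S"
    have "y j e \<in> carrier R" if "j \<in> insert i I" for j using rspan_closed[OF insert.prems[OF that] e] .
    then show "(\<Oplus>\<^bsub>R\<^esub>i \<in> insert i I. y i e) = y i e \<oplus>\<^bsub>R\<^esub> (\<Oplus>\<^bsub>R\<^esub>i \<in> I. y i e)"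
      using insert.hyps by (intro R.finsum_insert) auto
  qed
qed

lemma rspan_rconv: "rspan z y \<Longrightarrow> \<exists>a. finite_coeff a \<and> (\<forall>e \<in> carrier G \<times> S. y e = rconv a z e)"
proof (induction rule: rspan.induct)
  case (rspan_zero y)
  then show ?case by (intro exI[of _ "\<lambda>_. \<zero>\<^bsub>R\<^esub>"]) (auto simp: finite_coeff_def rconv_def)
next
  case (rspan_step y s g y1)
  then obtain a where a: "finite_coeff a" "\<forall>e \<in> carrier G \<times> S. y e = rconv a z e" by blast
  have "a g \<in> carrier R" using a by (simp add: finite_coeff_def)
  then have f: "finite_coeff (a(g := a g \<oplus>\<^bsub>R\<^esub> s))" using a rspan_step by (intro finite_coeff_update) auto
  show ?case
  proof (intro exI[of _ "a(g := a g \<oplus>\<^bsub>R\<^esub> s)"] conjI ballI f)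
    fix e assume e: "e \<in> carrier G \<times> S"
    show "y1 e = rconv (a(g := a g \<oplus>\<^bsub>R\<^esub> s)) z e"
      unfolding rconv_update[OF a(1) rspan_step.hyps(3,2)] rspan_step.hyps(4)[OF e] bspec[OF a(2) e] ..
  qed
qed

text \<open>The largest element of the support of \<open>a\<close>, if it exceeds \<open>\<one>\<close>, moves the largest edges of \<open>z\<close>
  out of the support of \<open>z\<close>.\<close>

lemma no_larger_coefficient:
  assumes lo: "right_invariant_order G lt" and a: "finite_coeff a"
    and z: "keys z \<subseteq> carrier G \<times> S" "\<exists>e. \<not> R.char dvd lookup z e"
    and supp: "\<And>e. e \<in> carrier G \<times> S \<Longrightarrow> R.char dvd lookup z e \<Longrightarrow> rconv a z e = \<zero>\<^bsub>R\<^esub>"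
    and g: "a g \<noteq> \<zero>\<^bsub>R\<^esub>" "(\<one>, g) \<in> lt"
  shows False
proof -
  have so: "strict_linear_order_on (carrier G) lt" and
    inv: "\<And>a b c. a \<in> carrier G \<Longrightarrow> b \<in> carrier G \<Longrightarrow> c \<in> carrier G \<Longrightarrow> (a, b) \<in> lt \<Longrightarrow> (a \<otimes> c, b \<otimes> c) \<in> lt"
    using lo by (auto simp: right_invariant_order_def)
  have tr: "trans lt" and irr: "irrefl lt" using so by (auto simp: strict_linear_order_on_def)
  define A where "A = {g. a g \<noteq> \<zero>\<^bsub>R\<^esub>}"
  have A: "finite A" "A \<subseteq> carrier G" "A \<noteq> {}" and ac: "\<And>h. a h \<in> carrier R" using a g by (auto simp: A_def finite_coeff_def)
  obtain m where m: "m \<in> A" "\<And>h. h \<in> A \<Longrightarrow> h \<noteq> m \<Longrightarrow> (h, m) \<in> lt"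
    using finite_has_maximum[OF so A(1,3,2)] by blast
  have m1: "(\<one>, m) \<in> lt" using m(2)[of g] g transD[OF tr] by (cases "g = m") (auto simp: A_def)
  obtain p0 x where px: "\<not> R.char dvd lookup z (p0, x)" using z(2) by auto
  define P where "P = {p. \<not> R.char dvd lookup z (p, x)}"
  have Pk: "(p, x) \<in> keys z" if "p \<in> P" for p using that by (auto simp: P_def in_keys_iff)
  have x: "x \<in> S" using z(1) Pk[of p0] px by (auto simp: P_def)
  have "P \<subseteq> fst ` keys z" using Pk by force
  moreover have "fst ` keys z \<subseteq> carrier G" using z(1) by auto
  moreover have "finite (fst ` keys z)" by simp
  ultimately have P: "finite P" "P \<noteq> {}" "P \<subseteq> carrier G" using px finite_subset by (blast, auto simp: P_def)
  obtain p where p: "p \<in> P" "\<And>h q. h \<in> A \<Longrightarrow> q \<in> P \<Longrightarrow> h \<otimes> q = m \<otimes> p \<Longrightarrow> h = m \<and> q = p"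
    "\<And>q. q \<in> P \<Longrightarrow> q \<noteq> p \<Longrightarrow> (m \<otimes> q, m \<otimes> p) \<in> lt"
    using right_order_maximal_product[OF lo A(1,2) P m] by metis
  have mc: "m \<in> carrier G" and pc: "p \<in> carrier G" using m p A P by auto
  have "rconv a z (m \<otimes> p, x) = [(lookup z (shift (inv m) (m \<otimes> p, x)))] \<cdot>\<^bsub>R\<^esub> a m"
  proof (rule rconv_single[OF a mc])
    fix h assume h: "a h \<noteq> \<zero>\<^bsub>R\<^esub>" "h \<noteq> m"
    then have hA: "h \<in> A" and hc: "h \<in> carrier G" using A by (auto simp: A_def)
    show "R.char dvd lookup z (shift (inv h) (m \<otimes> p, x))"
    proof (rule ccontr)
      assume "\<not> ?thesis"
      then have "inv h \<otimes> (m \<otimes> p) \<in> P" by (simp add: P_def shift_def)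
      moreover have "h \<otimes> (inv h \<otimes> (m \<otimes> p)) = m \<otimes> p" using hc mc pc by (simp add: inv_cancel_left)
      ultimately show False using p(2)[OF hA] h(2) by blast
    qed
  qed
  also have "shift (inv m) (m \<otimes> p, x) = (p, x)" using mc pc by (simp add: shift_def inv_cancel_left)
  finally have "rconv a z (m \<otimes> p, x) = [(lookup z (p, x))] \<cdot>\<^bsub>R\<^esub> a m" .
  moreover have "[(lookup z (p, x))] \<cdot>\<^bsub>R\<^esub> a m \<noteq> \<zero>\<^bsub>R\<^esub>"
    using R.int_mult_zero_iff[of "a m"] ac m p by (auto simp: A_def P_def)
  ultimately have "\<not> R.char dvd lookup z (m \<otimes> p, x)" using supp[of "(m \<otimes> p, x)"] mc pc x by auto
  then have mp: "m \<otimes> p \<in> P" by (simp add: P_def)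
  obtain q where q: "q \<in> P" "\<And>p. p \<in> P \<Longrightarrow> p \<noteq> q \<Longrightarrow> (p, q) \<in> lt"
    using finite_has_maximum[OF so P] by blast
  have qc: "q \<in> carrier G" using q P by auto
  \<comment> \<open>With \<open>q\<close> the largest origin,
    \<open>q < m q \<le> m p \<le> q\<close>: by right invariance, by the choice of
    \<open>p\<close>, and by maximality of \<open>q\<close>.\<close>
  have 1: "(q, m \<otimes> q) \<in> lt" using inv[OF one_closed mc qc m1] qc by simp
  have 2: "(m \<otimes> q, m \<otimes> p) \<in> lt \<or> q = p" using p(3)[OF q(1)] by blast
  have 3: "(m \<otimes> p, q) \<in> lt \<or> m \<otimes> p = q" using q(2)[OF mp] by blast
  have "(q, m \<otimes> p) \<in> lt" using 1 2 transD[OF tr] by blast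
  then have "(q, q) \<in> lt" using 3 transD[OF tr] by auto
  then show False using irr by (auto simp: irrefl_def)
qed

text \<open>The converse of a right invariant order is right invariant, so elements below the
  identity are excluded like those above it.\<close>

lemma coefficient_trivial_support:
  assumes lo: "right_orderable G" and a: "finite_coeff a"
    and z: "keys z \<subseteq> carrier G \<times> S" "\<exists>e. \<not> R.char dvd lookup z e"
    and supp: "\<And>e. e \<in> carrier G \<times> S \<Longrightarrow> R.char dvd lookup z e \<Longrightarrow> rconv a z e = \<zero>\<^bsub>R\<^esub>"
    and g: "a g \<noteq> \<zero>\<^bsub>R\<^esub>"
  shows "g = \<one>"
proof (rule ccontr)
  assume ne: "g \<noteq> \<one>"
  obtain lt where lt: "right_invariant_order G lt"
    using lo by (auto simp: right_orderable_def right_invariant_order_def)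
  have gc: "g \<in> carrier G" using a g by (auto simp: finite_coeff_def)
  have "(\<one>, g) \<in> lt \<or> (g, \<one>) \<in> lt"
    using lt ne gc by (auto simp: right_invariant_order_def strict_linear_order_on_def total_on_def)
  then show False
  proof
    assume "(\<one>, g) \<in> lt"
    then show False using no_larger_coefficient[OF lt a z _ g] supp by blast
  next
    assume "(g, \<one>) \<in> lt"
    then have "(\<one>, g) \<in> lt\<inverse>" by simp
    then show False using no_larger_coefficient[OF right_invariant_order_converse[OF lt] a z _ g] supp by blast
  qed
qed

text \<open>A unique product gives an edge to which a single coefficient \<open>a g\<close>
  contributes. The coefficient of \<open>y\<close> involved is a sign, so \<open>a g\<close> is an
  integer multiple of one; subtracting that multiple of a translate shrinks the support of
  \<open>a\<close>.\<close>

lemma integral_coefficients: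
  assumes up: "unique_products G" and y: "keys y \<subseteq> carrier G \<times> S" "y \<noteq> 0"
    and y1: "\<And>e. e \<in> keys y \<Longrightarrow> lookup y e = 1 \<or> lookup y e = -1"
    and a: "finite_coeff a" and z: "keys z \<subseteq> carrier G \<times> S"
    and eq: "\<And>e. e \<in> carrier G \<times> S \<Longrightarrow> [(lookup z e)] \<cdot>\<^bsub>R\<^esub> \<one>\<^bsub>R\<^esub> = rconv a y e"
  shows "\<exists>b. keys b \<subseteq> carrier G \<and> (\<forall>e. R.char dvd lookup (z - conv b y) e)"
  using a z eq
proof (induction "card {g. a g \<noteq> \<zero>\<^bsub>R\<^esub>}" arbitrary: a z)
  case 0
  then have "{g. a g \<noteq> \<zero>\<^bsub>R\<^esub>} = {}" by (auto simp: finite_coeff_def)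
  then have "rconv a y e = \<zero>\<^bsub>R\<^esub>" for e by (simp add: rconv_def)
  then have "R.char dvd lookup z e" if "e \<in> carrier G \<times> S" for e using 0(4)[OF that] R.int_mult_one_zero by simp
  moreover have "lookup z e = 0" if "e \<notin> carrier G \<times> S" for e using 0(3) that by (auto simp flip: not_in_keys_iff_lookup_eq_zero)
  ultimately have "R.char dvd lookup z e" for e by (cases "e \<in> carrier G \<times> S") auto
  then show ?case by (intro exI[of _ 0]) simp
next
  case (Suc k)
  define A where "A = {g. a g \<noteq> \<zero>\<^bsub>R\<^esub>}"
  have "A \<noteq> {}" using Suc(2) unfolding A_def by (metis card.empty nat.distinct(1))
  have "finite A" "A \<subseteq> carrier G" using Suc(3) by (auto simp: A_def finite_coeff_def)
  have ac: "a h \<in> carrier R" for h using Suc(3) by (simp add: finite_coeff_def)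
  obtain p0 x where px: "(p0, x) \<in> keys y" using y(2) by (metis keys_eq_empty ex_in_conv surj_pair)
  define P where "P = {p. (p, x) \<in> keys y}"
  have "P \<subseteq> fst ` keys y" by (force simp: P_def)
  moreover have "fst ` keys y \<subseteq> carrier G" using y(1) by auto
  moreover have "finite (fst ` keys y)" by simp
  ultimately have "finite P" "P \<noteq> {}" "P \<subseteq> carrier G" using px finite_subset by (blast, auto simp: P_def)
  moreover have "x \<in> S" using y(1) px by auto
  ultimately obtain g p where g: "g \<in> A" and p: "p \<in> P"
    and u: "\<And>h q. h \<in> A \<Longrightarrow> q \<in> P \<Longrightarrow> h \<otimes> q = g \<otimes> p \<Longrightarrow> h = g"
    using up[unfolded unique_products_def, rule_format, of A P] \<open>finite A\<close> \<open>A \<noteq> {}\<close> \<open>A \<subseteq> carrier G\<close> by metis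
  have gc: "g \<in> carrier G" and pc: "p \<in> carrier G" using g p \<open>A \<subseteq> carrier G\<close> \<open>P \<subseteq> carrier G\<close> by auto
  have x: "x \<in> S" using y(1) px by auto
  let ?e = "(g \<otimes> p, x)"
  have e: "?e \<in> carrier G \<times> S" using gc pc x by simp
  have "rconv a y ?e = [(lookup y (shift (inv g) ?e))] \<cdot>\<^bsub>R\<^esub> a g"
  proof (rule rconv_single[OF Suc(3) gc])
    fix h assume h: "a h \<noteq> \<zero>\<^bsub>R\<^esub>" "h \<noteq> g"
    then have hA: "h \<in> A" and hc: "h \<in> carrier G" using \<open>A \<subseteq> carrier G\<close> by (auto simp: A_def)
    have "h \<otimes> (inv h \<otimes> (g \<otimes> p)) = g \<otimes> p" using hc gc pc by (simp add: inv_cancel_left)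
    then have "inv h \<otimes> (g \<otimes> p) \<notin> P" using u[OF hA] h(2) by blast
    then have "lookup y (shift (inv h) ?e) = 0" by (simp add: P_def shift_def in_keys_iff)
    then show "R.char dvd lookup y (shift (inv h) ?e)" by simp
  qed
  also have "shift (inv g) ?e = (p, x)" using gc pc by (simp add: shift_def inv_cancel_left)
  finally have ag: "[(lookup z ?e)] \<cdot>\<^bsub>R\<^esub> \<one>\<^bsub>R\<^esub> = [(lookup y (p, x))] \<cdot>\<^bsub>R\<^esub> a g" using Suc(5)[OF e] by simp
  define c where "c = lookup y (p, x) * lookup z ?e"
  have yy: "lookup y (p, x) * lookup y (p, x) = 1" using y1[of "(p, x)"] p by (auto simp: P_def)
  have "[c] \<cdot>\<^bsub>R\<^esub> \<one>\<^bsub>R\<^esub> = [(lookup y (p, x))] \<cdot>\<^bsub>R\<^esub> ([(lookup z ?e)] \<cdot>\<^bsub>R\<^esub> \<one>\<^bsub>R\<^esub>)"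
    by (simp add: c_def R.add.int_pow_pow mult.commute)
  also have "\<dots> = [(lookup y (p, x) * lookup y (p, x))] \<cdot>\<^bsub>R\<^esub> a g" unfolding ag using ac by (simp add: R.add.int_pow_pow)
  finally have c: "[c] \<cdot>\<^bsub>R\<^esub> \<one>\<^bsub>R\<^esub> = a g" using yy ac by simp
  define a' where "a' = a(g := \<zero>\<^bsub>R\<^esub>)"
  define z' where "z' = z - frag_cmul c (shc g y)"
  have a': "finite_coeff a'" using Suc(3) gc by (auto simp: a'_def intro: finite_coeff_update)
  have "{h. a' h \<noteq> \<zero>\<^bsub>R\<^esub>} = A - {g}" by (auto simp: a'_def A_def)
  then have card: "k = card {h. a' h \<noteq> \<zero>\<^bsub>R\<^esub>}" using Suc(2) g \<open>finite A\<close> by (simp add: A_def)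
  have ks: "keys (shc g y) \<subseteq> carrier G \<times> S"
    using keys_shc[of g y] y(1) gc by (fastforce simp: shift_def)
  have z': "keys z' \<subseteq> carrier G \<times> S"
    using keys_diff[of z "frag_cmul c (shc g y)"] keys_cmul[of c "shc g y"] ks Suc(4) by (auto simp: z'_def)
  have "[(lookup z' e)] \<cdot>\<^bsub>R\<^esub> \<one>\<^bsub>R\<^esub> = rconv a' y e" if e: "e \<in> carrier G \<times> S" for e
  proof -
    let ?l = "lookup y (shift (inv g) e)"
    have "lookup (shc g y) e = ?l" using e gc y(1) by (intro lookup_shc) auto
    then have "lookup z' e = lookup z e - ?l * c" by (simp add: z'_def lookup_minus mult.commute)
    then have "[(lookup z' e)] \<cdot>\<^bsub>R\<^esub> \<one>\<^bsub>R\<^esub> = [(lookup z e)] \<cdot>\<^bsub>R\<^esub> \<one>\<^bsub>R\<^esub> \<ominus>\<^bsub>R\<^esub> [(c * ?l)] \<cdot>\<^bsub>R\<^esub> \<one>\<^bsub>R\<^esub>"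
      by (simp add: R.add.int_pow_diff R.minus_eq mult.commute)
    also have "[(c * ?l)] \<cdot>\<^bsub>R\<^esub> \<one>\<^bsub>R\<^esub> = [?l] \<cdot>\<^bsub>R\<^esub> a g" by (simp add: c[symmetric] R.add.int_pow_pow)
    also have "[(lookup z e)] \<cdot>\<^bsub>R\<^esub> \<one>\<^bsub>R\<^esub> = rconv a y e" by (rule Suc(5)[OF e])
    also have "a = a'(g := a' g \<oplus>\<^bsub>R\<^esub> a g)" using ac by (auto simp: a'_def)
    also have "rconv (a'(g := a' g \<oplus>\<^bsub>R\<^esub> a g)) y e = rconv a' y e \<oplus>\<^bsub>R\<^esub> [?l] \<cdot>\<^bsub>R\<^esub> a g"
      by (rule rconv_update[OF a' gc ac])
    finally have "[(lookup z' e)] \<cdot>\<^bsub>R\<^esub> \<one>\<^bsub>R\<^esub> = (rconv a' y e \<oplus>\<^bsub>R\<^esub> [?l] \<cdot>\<^bsub>R\<^esub> a g) \<ominus>\<^bsub>R\<^esub> [?l] \<cdot>\<^bsub>R\<^esub> (a'(g := a' g \<oplus>\<^bsub>R\<^esub> a g)) g" .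
    then show ?thesis using ac rconv_closed[OF a'] by (simp add: R.minus_eq R.a_assoc R.r_neg a'_def)
  qed
  then obtain b where b: "keys b \<subseteq> carrier G" "\<And>e. R.char dvd lookup (z' - conv b y) e"
    using Suc(1)[OF card a' z'] by blast
  have "z' - conv b y = z - conv (b + frag_cmul c (frag_of g)) y"
    by (simp add: z'_def conv_add conv_cmul algebra_simps)
  moreover have "keys (b + frag_cmul c (frag_of g)) \<subseteq> carrier G"
    using keys_add[of b "frag_cmul c (frag_of g)"] keys_cmul[of c "frag_of g"] b(1) gc by auto
  ultimately show ?case using b(2) by (intro exI[of _ "b + frag_cmul c (frag_of g)"]) auto
qed

end

subsection \<open>From the relation module to chains\<close>

lemma (in ring) sum_diff_zero:
  assumes "a \<in> carrier R" "b \<in> carrier R"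
  shows "a \<oplus> b \<ominus> a \<ominus> b = \<zero>"
proof -
  have "a \<oplus> b \<ominus> a \<ominus> b = (a \<oplus> \<ominus> a) \<oplus> (b \<oplus> \<ominus> b)" using assms by (simp add: minus_eq a_ac)
  then show ?thesis using assms by (simp add: r_neg)
qed

locale relation_setting = free_quotient N F S + R: nc_domain R
  for N and F (structure) and S and R :: "('r, 'd) ring_scheme"
begin

sublocale C: coefficient_setting "F Mod N" \<sigma> R S
  by unfold_locales

abbreviation A where "A \<equiv> abelianization F N"
abbreviation T where "T \<equiv> tensor_free R A"
abbreviation K where "K \<equiv> tensor_kernel R A"
abbreviation M where "M \<equiv> relation_module R F N"
abbreviation cls where "cls x \<equiv> derived F N #> x"

lemma normal_N: "N \<lhd> F" by (rule normal_axioms)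

lemma group_A: "group A" by (rule group_abelianization[OF normal_N])

lemma cls_closed: "x \<in> N \<Longrightarrow> cls x \<in> carrier A"
  by (simp add: carrier_abelianization)

lemma A_cases: assumes "m \<in> carrier A" obtains x where "x \<in> N" "m = cls x"
  using assms by (auto simp: carrier_abelianization)

lemma cls_mult: "x \<in> N \<Longrightarrow> y \<in> N \<Longrightarrow> cls x \<otimes>\<^bsub>A\<^esub> cls y = cls (x \<otimes> y)"
  by (rule abelianization_mult[OF normal_N])

lemma K_normal: "K \<lhd> T"
  by (rule tensor_kernel_normal[OF R.ring_axioms group.is_monoid[OF group_A]])

sublocale KT: normal K T by (rule K_normal)

lemma derived_N: "derived F N \<subseteq> N"
  by (rule derived_incl[OF subset_refl subgroup_axioms])

lemma fox_derived: assumes "x \<in> derived F N" shows "fox x = 0"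
proof -
  have comm: "fox h = 0 \<and> h \<in> N" if "h \<in> derived_set F N" for h
  proof -
    from that obtain a b where ab: "a \<in> N" "b \<in> N" "h = a \<otimes> b \<otimes> inv a \<otimes> inv b" by blast
    then show ?thesis by (simp add: fox_mult_N fox_inv)
  qed
  have "x \<in> generate F (derived_set F N)" using assms by (simp add: derived_def)
  then have "fox x = 0 \<and> x \<in> N"
  proof (induction rule: generate.induct)
    case one
    show ?case by simp
  next
    case (incl h)
    then show ?case by (rule comm)
  next
    case (inv h)
    from comm[OF inv] show ?case using fox_inv[of h] by simp
  next
    case (eng g h)
    then show ?case using fox_mult_N[of g h] by simp
  qed
  then show ?thesis by simp
qed

section \<open>Fox coordinates on the tensor product\<close>

definition foxA where "foxA m = fox (SOME x. x \<in> N \<and> m = cls x)"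

lemma foxA_cls: assumes x: "x \<in> N" shows "foxA (cls x) = fox x"
proof -
  interpret D: normal "derived F N" F by (rule derived_is_normal[OF normal_N])
  have "\<exists>y. y \<in> N \<and> cls x = cls y" using x by blast
  from someI_ex[OF this] obtain y where y: "y \<in> N" "cls x = cls y" "foxA (cls x) = fox y"
    unfolding foxA_def by blast
  have "x \<in> cls x" using x rcos_self[OF _ D.subgroup_axioms] by simp
  then have "x \<in> cls y" using y(2) by simp
  then obtain d where d: "d \<in> derived F N" "x = d \<otimes> y" by (auto simp: r_coset_def)
  then have "fox x = fox d + fox y" using derived_N y by (auto simp: fox_mult_N)
  then show ?thesis using y(3) fox_derived[OF d(1)] by simp
qed

lemma foxA_mult: "m \<in> carrier A \<Longrightarrow> k \<in> carrier A \<Longrightarrow> foxA (m \<otimes>\<^bsub>A\<^esub> k) = foxA m + foxA k"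
  by (auto elim!: A_cases simp: cls_mult foxA_cls fox_mult_N)

lemma keys_foxA: "m \<in> carrier A \<Longrightarrow> keys (foxA m) \<subseteq> carrier (F Mod N) \<times> S"
proof -
  assume "m \<in> carrier A"
  then obtain x where "x \<in> N" "m = cls x" by (rule A_cases)
  then show ?thesis using keys_fox[of x] by (simp add: foxA_cls)
qed

lemma foxA_conj:
  assumes g: "g \<in> carrier (F Mod N)" and m: "m \<in> carrier A"
  shows "foxA (coset_conj F g m) = C.shc g (foxA m)"
proof -
  obtain f where f: "f \<in> carrier F" "\<pi> f = g" using \<pi>_surj[OF g] by blast
  obtain x where x: "x \<in> N" "m = cls x" using m by (rule A_cases)
  have "coset_conj F g m = cls (f \<otimes> x \<otimes> inv f)"
    using coset_conj_eq[OF normal_N f(1) x(1)] f x by (simp add: \<pi>_def)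
  then show ?thesis using fox_conj[OF x(1) f(1)] foxA_cls inv_op_closed2[OF f(1) x(1)] f x by simp
qed

text \<open>The coefficient at \<open>e\<close> of the \<open>R\<close>-chain belonging to a tensor,
  defined on representatives by the universal property of the free abelian group; it descends to the
  tensor product by \<open>coef_kernel\<close>.\<close>

definition coef :: "'a set \<times> 'a \<Rightarrow> ('r \<times> 'a set \<Rightarrow>\<^sub>0 int) \<Rightarrow> 'r" where
  "coef e = (SOME h. h \<in> hom T (add_monoid R) \<and>
    (\<forall>s \<in> carrier R. \<forall>m \<in> carrier A. h (frag_of (s, m)) = [(lookup (foxA m) e)] \<cdot>\<^bsub>R\<^esub> s))"

lemma coef: "coef e \<in> hom T (add_monoid R)"
  and coef_of: "s \<in> carrier R \<Longrightarrow> m \<in> carrier A \<Longrightarrow> coef e (frag_of (s, m)) = [(lookup (foxA m) e)] \<cdot>\<^bsub>R\<^esub> s"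
proof -
  have "(\<lambda>(s, m). [(lookup (foxA m) e)] \<cdot>\<^bsub>R\<^esub> s) ` (carrier R \<times> carrier A) \<subseteq> carrier (add_monoid R)" by auto
  then obtain h where "h \<in> hom T (add_monoid R)"
    "\<And>p. p \<in> carrier R \<times> carrier A \<Longrightarrow> h (frag_of p) = (\<lambda>(s, m). [(lookup (foxA m) e)] \<cdot>\<^bsub>R\<^esub> s) p"
    using comm_group.free_Abelian_group_universal[OF R.a_comm_group] by blast
  then have "\<exists>h. h \<in> hom T (add_monoid R) \<and>
    (\<forall>s \<in> carrier R. \<forall>m \<in> carrier A. h (frag_of (s, m)) = [(lookup (foxA m) e)] \<cdot>\<^bsub>R\<^esub> s)"
    by (intro exI[of _ h]) auto
  from someI_ex[OF this] show "coef e \<in> hom T (add_monoid R)"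
    "s \<in> carrier R \<Longrightarrow> m \<in> carrier A \<Longrightarrow> coef e (frag_of (s, m)) = [(lookup (foxA m) e)] \<cdot>\<^bsub>R\<^esub> s"
    unfolding coef_def by blast+
qed

lemma coef_hom: "group_hom T (add_monoid R) (coef e)"
  by (intro group_hom.intro group_hom_axioms.intro coef R.add.is_group) simp

lemma coef_closed: "c \<in> carrier T \<Longrightarrow> coef e c \<in> carrier R"
  using hom_in_carrier[OF coef, of c e] by simp

lemma coef_add: "c \<in> carrier T \<Longrightarrow> d \<in> carrier T \<Longrightarrow> coef e (c + d) = coef e c \<oplus>\<^bsub>R\<^esub> coef e d"
  using hom_mult[OF coef, of c d e] by simp

lemma coef_0: "coef e 0 = \<zero>\<^bsub>R\<^esub>"
  using group_hom.hom_one[OF coef_hom, of e] by simp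

lemma coef_diff: assumes "c \<in> carrier T" "d \<in> carrier T" shows "coef e (c - d) = coef e c \<ominus>\<^bsub>R\<^esub> coef e d"
proof -
  have "keys (c - d) \<subseteq> carrier R \<times> carrier A" using keys_diff[of c d] assms by auto
  then have cd: "c - d \<in> carrier T" by simp
  have "coef e c = coef e (c - d) \<oplus>\<^bsub>R\<^esub> coef e d" using coef_add[OF cd assms(2), of e] by simp
  then show ?thesis using coef_closed[OF cd, of e] coef_closed[OF assms(2), of e]
    by (simp add: R.minus_eq R.a_assoc R.r_neg)
qed

lemma coef_kernel: assumes "c \<in> K" shows "coef e c = \<zero>\<^bsub>R\<^esub>"
proof -
  interpret A: group A by (rule group_A)
  interpret h: group_hom T "add_monoid R" "coef e" by (rule coef_hom)
  have fr: "frag_of (s, m) \<in> carrier T" if "s \<in> carrier R" "m \<in> carrier A" for s m using that by simp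
  have dc: "x - y \<in> carrier T" if "x \<in> carrier T" "y \<in> carrier T" for x y
    using keys_diff[of x y] that by auto
  have "tensor_relators R A \<subseteq> kernel T (add_monoid R) (coef e)"
  proof
    fix x assume x: "x \<in> tensor_relators R A"
    have xc: "x \<in> carrier T" using x tensor_relators_closed[OF R.ring_axioms A.is_monoid] by blast
    have "coef e x = \<zero>\<^bsub>R\<^esub>"
      using x unfolding tensor_relators_def
    proof
      assume "x \<in> {frag_of (s \<oplus>\<^bsub>R\<^esub> t, m) - frag_of (s, m) - frag_of (t, m) | s t m.
        s \<in> carrier R \<and> t \<in> carrier R \<and> m \<in> carrier A}"
      then obtain s t m where stm: "x = frag_of (s \<oplus>\<^bsub>R\<^esub> t, m) - frag_of (s, m) - frag_of (t, m)"
        "s \<in> carrier R" "t \<in> carrier R" "m \<in> carrier A" by blast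
      have "coef e x = coef e (frag_of (s \<oplus>\<^bsub>R\<^esub> t, m)) \<ominus>\<^bsub>R\<^esub> coef e (frag_of (s, m)) \<ominus>\<^bsub>R\<^esub> coef e (frag_of (t, m))"
        unfolding stm(1) using stm fr dc by (simp only: coef_diff R.a_closed)
      also have "\<dots> = \<zero>\<^bsub>R\<^esub>"
        using stm by (simp add: coef_of R.add.int_pow_distrib R.sum_diff_zero)
      finally show ?thesis .
    next
      assume "x \<in> {frag_of (s, m \<otimes>\<^bsub>A\<^esub> n) - frag_of (s, m) - frag_of (s, n) | s m n.
        s \<in> carrier R \<and> m \<in> carrier A \<and> n \<in> carrier A}"
      then obtain s m n where smn: "x = frag_of (s, m \<otimes>\<^bsub>A\<^esub> n) - frag_of (s, m) - frag_of (s, n)"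
        "s \<in> carrier R" "m \<in> carrier A" "n \<in> carrier A" by blast
      have "coef e x = coef e (frag_of (s, m \<otimes>\<^bsub>A\<^esub> n)) \<ominus>\<^bsub>R\<^esub> coef e (frag_of (s, m)) \<ominus>\<^bsub>R\<^esub> coef e (frag_of (s, n))"
        unfolding smn(1) using smn fr dc by (simp only: coef_diff A.m_closed)
      also have "\<dots> = \<zero>\<^bsub>R\<^esub>"
        using smn by (simp add: coef_of foxA_mult lookup_add R.add.int_pow_mult R.sum_diff_zero)
      finally show ?thesis .
    qed
    then show "x \<in> kernel T (add_monoid R) (coef e)" using xc by (simp add: kernel_def)
  qed
  then have "K \<subseteq> kernel T (add_monoid R) (coef e)"
    unfolding tensor_kernel_def by (rule group.generate_subgroup_incl[OF group_free_Abelian_group _ h.subgroup_kernel])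
  then show ?thesis using assms by (auto simp: kernel_def)
qed

abbreviation L where "L \<equiv> tensor_lift_action R (coset_conj F)"

lemma group_ring_D:
  assumes "b \<in> carrier (group_ring R (F Mod N))"
  shows "finite {g. b g \<noteq> \<zero>\<^bsub>R\<^esub>}" "b g \<noteq> \<zero>\<^bsub>R\<^esub> \<Longrightarrow> g \<in> carrier (F Mod N)" "b g \<in> carrier R"
proof -
  show "finite {g. b g \<noteq> \<zero>\<^bsub>R\<^esub>}" and 1: "b g \<noteq> \<zero>\<^bsub>R\<^esub> \<Longrightarrow> g \<in> carrier (F Mod N)"
    using assms by (auto simp: group_ring_def)
  show "b g \<in> carrier R" using assms by (cases "g \<in> carrier (F Mod N)") (auto simp: group_ring_def)
qed

lemma coef_sum:
  "finite I \<Longrightarrow> (\<And>i. i \<in> I \<Longrightarrow> f i \<in> carrier T) \<Longrightarrow> coef e (\<Sum>i \<in> I. f i) = (\<Oplus>\<^bsub>R\<^esub>i \<in> I. coef e (f i))"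
proof (induction I rule: finite_induct)
  case empty
  then show ?case by (simp add: coef_0)
next
  case (insert i I)
  have "(\<Sum>i \<in> I. f i) \<in> carrier T" using insert by (intro sum_closed_free_Abelian_group) auto
  then show ?case using insert coef_closed by (simp add: coef_add Pi_def)
qed

lemma lift_closed:
  assumes b: "b \<in> carrier (group_ring R (F Mod N))" and c: "c \<in> carrier T"
  shows "L b c \<in> carrier T"
proof -
  have "keys c \<subseteq> carrier R \<times> carrier A" using c by simp
  then show ?thesis
  proof (induction c rule: frag_induction)
    case (one p)
    obtain s m where p: "p = (s, m)" by (cases p)
    then have sm: "s \<in> carrier R" "m \<in> carrier A" using one by auto
    have "(\<Sum>g \<in> {g. b g \<noteq> \<zero>\<^bsub>R\<^esub>}. frag_of (b g \<otimes>\<^bsub>R\<^esub> s, coset_conj F g m)) \<in> carrier T"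
      by (rule sum_closed_free_Abelian_group)
        (use sm group_ring_D[OF b] coset_conj_closed_mult(1)[OF normal_N _ sm(2) sm(2)] in simp)
    then show ?case by (simp add: p tensor_lift_action_def)
  next
    case (diff x y)
    then show ?case using keys_diff[of "L b x" "L b y"] by (auto simp: tensor_lift_action_def frag_extend_diff)
  qed (simp add: tensor_lift_action_def)
qed

text \<open>Linearity over the group ring: \<open>foxA\<close> turns conjugation into translation,
  and scalars multiply coefficients from the left.\<close>

lemma coef_lift:
  assumes b: "b \<in> carrier (group_ring R (F Mod N))" and c: "c \<in> carrier T"
    and e: "e \<in> carrier (F Mod N) \<times> S"
  shows "coef e (L b c) = (\<Oplus>\<^bsub>R\<^esub>g \<in> {g. b g \<noteq> \<zero>\<^bsub>R\<^esub>}. b g \<otimes>\<^bsub>R\<^esub> coef (C.shift (inv\<^bsub>F Mod N\<^esub> g) e) c)"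
proof -
  note b' = group_ring_D[OF b]
  have "keys c \<subseteq> carrier R \<times> carrier A" using c by simp
  then have "c \<in> carrier T \<and> coef e (L b c) = (\<Oplus>\<^bsub>R\<^esub>g \<in> {g. b g \<noteq> \<zero>\<^bsub>R\<^esub>}. b g \<otimes>\<^bsub>R\<^esub> coef (C.shift (inv\<^bsub>F Mod N\<^esub> g) e) c)"
  proof (induction c rule: frag_induction)
    case zero
    show ?case using b' by (simp add: tensor_lift_action_def coef_0)
  next
    case (one p)
    obtain s m where p: "p = (s, m)" by (cases p)
    then have sm: "s \<in> carrier R" "m \<in> carrier A" using one by auto
    have cl: "frag_of (b g \<otimes>\<^bsub>R\<^esub> s, coset_conj F g m) \<in> carrier T" if "b g \<noteq> \<zero>\<^bsub>R\<^esub>" for g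
      using sm b'(2)[OF that] b'(3) coset_conj_closed_mult(1)[OF normal_N _ sm(2) sm(2)] by simp
    have "coef e (L b (frag_of p)) = (\<Oplus>\<^bsub>R\<^esub>g \<in> {g. b g \<noteq> \<zero>\<^bsub>R\<^esub>}. coef e (frag_of (b g \<otimes>\<^bsub>R\<^esub> s, coset_conj F g m)))"
      using coef_sum[OF b'(1) cl] by (simp add: p tensor_lift_action_def)
    also have "\<dots> = (\<Oplus>\<^bsub>R\<^esub>g \<in> {g. b g \<noteq> \<zero>\<^bsub>R\<^esub>}. b g \<otimes>\<^bsub>R\<^esub> coef (C.shift (inv\<^bsub>F Mod N\<^esub> g) e) (frag_of p))"
    proof (rule R.finsum_cong'[OF refl])
      show "(\<lambda>g. b g \<otimes>\<^bsub>R\<^esub> coef (C.shift (inv\<^bsub>F Mod N\<^esub> g) e) (frag_of p)) \<in> {g. b g \<noteq> \<zero>\<^bsub>R\<^esub>} \<rightarrow> carrier R"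
        using b' sm coef_closed by (auto simp: p)
      fix g assume "g \<in> {g. b g \<noteq> \<zero>\<^bsub>R\<^esub>}"
      then have g: "g \<in> carrier (F Mod N)" using b' by blast
      have "coef e (frag_of (b g \<otimes>\<^bsub>R\<^esub> s, coset_conj F g m)) = [(lookup (C.shc g (foxA m)) e)] \<cdot>\<^bsub>R\<^esub> (b g \<otimes>\<^bsub>R\<^esub> s)"
        using coef_of[of "b g \<otimes>\<^bsub>R\<^esub> s" "coset_conj F g m" e] sm b'(3) g
          coset_conj_closed_mult(1)[OF normal_N g sm(2) sm(2)] by (simp add: foxA_conj)
      also have "lookup (C.shc g (foxA m)) e = lookup (foxA m) (C.shift (inv\<^bsub>F Mod N\<^esub> g) e)"
        using keys_foxA[OF sm(2)] g e by (intro C.lookup_shc) auto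
      also have "[(lookup (foxA m) (C.shift (inv\<^bsub>F Mod N\<^esub> g) e))] \<cdot>\<^bsub>R\<^esub> (b g \<otimes>\<^bsub>R\<^esub> s) =
          b g \<otimes>\<^bsub>R\<^esub> coef (C.shift (inv\<^bsub>F Mod N\<^esub> g) e) (frag_of p)"
        using sm b'(3) by (simp add: p coef_of R.add_pow_rdistr_int)
      finally show "coef e (frag_of (b g \<otimes>\<^bsub>R\<^esub> s, coset_conj F g m)) =
          b g \<otimes>\<^bsub>R\<^esub> coef (C.shift (inv\<^bsub>F Mod N\<^esub> g) e) (frag_of p)" .
    qed
    finally show ?case using one by auto
  next
    case (diff x y)
    have dT: "x - y \<in> carrier T" using diff keys_diff[of x y] by auto
    have "coef e (L b (x - y)) = coef e (L b x) \<ominus>\<^bsub>R\<^esub> coef e (L b y)"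
      using diff lift_closed[OF b] coef_diff[of "L b x" "L b y" e]
      by (simp add: tensor_lift_action_def frag_extend_diff)
    also have "\<dots> = (\<Oplus>\<^bsub>R\<^esub>g \<in> {g. b g \<noteq> \<zero>\<^bsub>R\<^esub>}. b g \<otimes>\<^bsub>R\<^esub> coef (C.shift (inv\<^bsub>F Mod N\<^esub> g) e) x
        \<ominus>\<^bsub>R\<^esub> b g \<otimes>\<^bsub>R\<^esub> coef (C.shift (inv\<^bsub>F Mod N\<^esub> g) e) y)"
      using diff b' coef_closed by (simp add: R.finsum_diff)
    also have "\<dots> = (\<Oplus>\<^bsub>R\<^esub>g \<in> {g. b g \<noteq> \<zero>\<^bsub>R\<^esub>}. b g \<otimes>\<^bsub>R\<^esub> coef (C.shift (inv\<^bsub>F Mod N\<^esub> g) e) (x - y))"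
    proof (rule R.finsum_cong'[OF refl])
      show "(\<lambda>g. b g \<otimes>\<^bsub>R\<^esub> coef (C.shift (inv\<^bsub>F Mod N\<^esub> g) e) (x - y)) \<in> {g. b g \<noteq> \<zero>\<^bsub>R\<^esub>} \<rightarrow> carrier R"
        using b' coef_closed[OF dT] by auto
      fix g assume "g \<in> {g. b g \<noteq> \<zero>\<^bsub>R\<^esub>}"
      show "b g \<otimes>\<^bsub>R\<^esub> coef (C.shift (inv\<^bsub>F Mod N\<^esub> g) e) x \<ominus>\<^bsub>R\<^esub> b g \<otimes>\<^bsub>R\<^esub> coef (C.shift (inv\<^bsub>F Mod N\<^esub> g) e) y =
          b g \<otimes>\<^bsub>R\<^esub> coef (C.shift (inv\<^bsub>F Mod N\<^esub> g) e) (x - y)"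
        using diff b'(3)[of g] coef_closed by (simp add: coef_diff R.minus_eq R.r_distr R.r_minus)
    qed
    finally show ?case using dT by simp
  qed
  then show ?thesis by simp
qed

lemma carrier_M: "carrier M = carrier (tensor_group R A)"
  and zero_M: "\<zero>\<^bsub>M\<^esub> = K"
  and add_M: "x \<oplus>\<^bsub>M\<^esub> y = x <#>\<^bsub>T\<^esub> y"
  and smult_M: "b \<odot>\<^bsub>M\<^esub> x = (\<Union>c \<in> x. K #>\<^bsub>T\<^esub> L b c)"
  by (simp_all add: relation_module_def Let_def tensor_group_def FactGroup_def)

lemma M_coset: "c \<in> carrier T \<Longrightarrow> K #>\<^bsub>T\<^esub> c \<in> carrier M"
  by (auto simp: carrier_M tensor_group_def FactGroup_def RCOSETS_def)

lemma smult_coset: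
  assumes b: "b \<in> carrier (group_ring R (F Mod N))" and c: "c \<in> carrier T"
  shows "b \<odot>\<^bsub>M\<^esub> (K #>\<^bsub>T\<^esub> c) = K #>\<^bsub>T\<^esub> L b c"
proof -
  have eq: "K #>\<^bsub>T\<^esub> L b d = K #>\<^bsub>T\<^esub> L b c" if d: "d \<in> K #>\<^bsub>T\<^esub> c" for d
  proof -
    obtain k where k: "k \<in> K" "d = k + c" using d by (auto simp: r_coset_def)
    have "L b k \<in> K" by (rule tensor_lift_action_kernel[OF R.ring_axioms normal_N b k(1)])
    moreover have "L b d = L b k \<otimes>\<^bsub>T\<^esub> L b c" by (simp add: k tensor_lift_action_def frag_extend_add)
    ultimately have "L b d \<in> K #>\<^bsub>T\<^esub> L b c" by (auto simp: r_coset_def)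
    then show ?thesis using KT.repr_independence[OF _ lift_closed[OF b c] KT.subgroup_axioms] by blast
  qed
  have "c \<in> K #>\<^bsub>T\<^esub> c" by (rule KT.rcos_self[OF c KT.subgroup_axioms])
  then show ?thesis unfolding smult_M using eq by blast
qed

lemma coef_coset: assumes c: "c \<in> carrier T" and d: "d \<in> K #>\<^bsub>T\<^esub> c" shows "coef e d = coef e c"
proof -
  obtain k where k: "k \<in> K" "d = k + c" using d by (auto simp: r_coset_def)
  have "k \<in> carrier T" using KT.subset k(1) by blast
  then show ?thesis using coef_add[OF _ c, of k e] coef_kernel[OF k(1), of e] coef_closed[OF c, of e] k(2) by simp
qed

text \<open>The preimage, in the relation module, of the span of the cycle of \<open>r\<close>. It
  is a submodule containing the pure tensor of one and \<open>r\<close>, which reduces generation of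
  the module to a statement on chains.\<close>

definition spanned_by :: "'a set \<Rightarrow> ('r \<times> 'a set \<Rightarrow>\<^sub>0 int) set set" where
  "spanned_by r = {K #>\<^bsub>T\<^esub> c | c. c \<in> carrier T \<and> C.rspan (foxA r) (\<lambda>e. coef e c)}"

lemma submodule_spanned_by: "submodule (spanned_by r) (group_ring R (F Mod N)) M"
proof -
  interpret M: abelian_group M by (rule abelian_group_relation_module[OF R.ring_axioms normal_N])
  have sumT: "c + d \<in> carrier T" if "c \<in> carrier T" "d \<in> carrier T" for c d
    using that KT.m_closed[of c d] by simp
  have sub: "spanned_by r \<subseteq> carrier M" by (auto simp: spanned_by_def M_coset)
  have zero: "K \<in> spanned_by r"
  proof -
    have "K = K #>\<^bsub>T\<^esub> 0" using KT.coset_mult_one[OF KT.subset] by simp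
    moreover have "C.rspan (foxA r) (\<lambda>e. coef e 0)" by (intro C.rspan_zero) (simp add: coef_0)
    ultimately show ?thesis unfolding spanned_by_def by fastforce
  qed
  have addc: "(K #>\<^bsub>T\<^esub> c) \<oplus>\<^bsub>M\<^esub> (K #>\<^bsub>T\<^esub> d) = K #>\<^bsub>T\<^esub> (c + d)" if "c \<in> carrier T" "d \<in> carrier T" for c d
    unfolding add_M using KT.rcos_sum[OF that] by simp
  have add: "x \<oplus>\<^bsub>M\<^esub> y \<in> spanned_by r" if x: "x \<in> spanned_by r" and y: "y \<in> spanned_by r" for x y
  proof -
    obtain c where c: "x = K #>\<^bsub>T\<^esub> c" "c \<in> carrier T" "C.rspan (foxA r) (\<lambda>e. coef e c)"
      using x by (auto simp: spanned_by_def)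
    obtain d where d: "y = K #>\<^bsub>T\<^esub> d" "d \<in> carrier T" "C.rspan (foxA r) (\<lambda>e. coef e d)"
      using y by (auto simp: spanned_by_def)
    have "C.rspan (foxA r) (\<lambda>e. coef e (c + d))"
      by (rule C.rspan_cong[OF C.rspan_add[OF c(3) d(3)]]) (simp add: coef_add[OF c(2) d(2)])
    then show ?thesis unfolding spanned_by_def using sumT[OF c(2) d(2)] addc[OF c(2) d(2)] c(1) d(1) by blast
  qed
  have neg: "\<ominus>\<^bsub>M\<^esub> x \<in> spanned_by r" if x: "x \<in> spanned_by r" for x
  proof -
    obtain c where c: "x = K #>\<^bsub>T\<^esub> c" "c \<in> carrier T" "C.rspan (foxA r) (\<lambda>e. coef e c)"
      using x by (auto simp: spanned_by_def)
    have mc: "- c \<in> carrier T" using c(2) by simp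
    have "coef e (- c) = \<ominus>\<^bsub>R\<^esub> coef e c" for e
      using coef_diff[of 0 c e] c(2) coef_closed[OF c(2), of e] by (simp add: coef_0 R.minus_eq)
    then have "C.rspan (foxA r) (\<lambda>e. coef e (- c))" using C.rspan_neg[OF c(3)] by simp
    then have "K #>\<^bsub>T\<^esub> (- c) \<in> spanned_by r" unfolding spanned_by_def using mc by blast
    moreover have "\<ominus>\<^bsub>M\<^esub> x = K #>\<^bsub>T\<^esub> (- c)"
    proof (rule M.minus_equality)
      show "(K #>\<^bsub>T\<^esub> (- c)) \<oplus>\<^bsub>M\<^esub> x = \<zero>\<^bsub>M\<^esub>"
        using addc[OF mc c(2)] KT.coset_mult_one[OF KT.subset] by (simp add: c(1) zero_M)
    qed (use M_coset c mc in auto)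
    ultimately show ?thesis by simp
  qed
  have smult: "b \<odot>\<^bsub>M\<^esub> x \<in> spanned_by r" if b: "b \<in> carrier (group_ring R (F Mod N))" and x: "x \<in> spanned_by r" for b x
  proof -
    obtain c where c: "x = K #>\<^bsub>T\<^esub> c" "c \<in> carrier T" "C.rspan (foxA r) (\<lambda>e. coef e c)"
      using x by (auto simp: spanned_by_def)
    have "C.rspan (foxA r) (\<lambda>e. \<Oplus>\<^bsub>R\<^esub>g \<in> {g. b g \<noteq> \<zero>\<^bsub>R\<^esub>}. b g \<otimes>\<^bsub>R\<^esub> coef (C.shift (inv\<^bsub>F Mod N\<^esub> g) e) c)"
      by (rule C.rspan_finsum[OF group_ring_D(1)[OF b]], rule C.rspan_translate[OF c(3)])
        (use group_ring_D[OF b] in auto)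
    then have "C.rspan (foxA r) (\<lambda>e. coef e (L b c))"
      by (rule C.rspan_cong) (rule coef_lift[OF b c(2)])
    then show ?thesis unfolding spanned_by_def using smult_coset[OF b c(2)] lift_closed[OF b c(2)] c(1) by blast
  qed
  have "subgroup (spanned_by r) (add_monoid M)"
    by (rule M.add.subgroupI) (use sub zero add neg in auto)
  then show ?thesis using smult by (intro submodule.intro submodule_axioms.intro)
qed

lemma generated_rspan:
  assumes r: "r \<in> carrier A"
    and gen: "generated_submodule (group_ring R (F Mod N)) M {pure_tensor R A \<one>\<^bsub>R\<^esub> r} = carrier M"
    and x: "x \<in> N"
  shows "C.rspan (foxA r) (\<lambda>e. [(lookup (fox x) e)] \<cdot>\<^bsub>R\<^esub> \<one>\<^bsub>R\<^esub>)"
proof -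
  have fr: "frag_of (\<one>\<^bsub>R\<^esub>, m) \<in> carrier T" if "m \<in> carrier A" for m using that by simp
  have "C.rspan (foxA r) (\<lambda>e. coef e (frag_of (\<one>\<^bsub>R\<^esub>, r)))"
  proof (rule C.rspan_step[OF C.rspan_zero, of "\<lambda>_. \<zero>\<^bsub>R\<^esub>" "\<one>\<^bsub>R\<^esub>" "\<one>\<^bsub>F Mod N\<^esub>"])
    fix e assume "e \<in> carrier (F Mod N) \<times> S"
    then show "coef e (frag_of (\<one>\<^bsub>R\<^esub>, r)) = \<zero>\<^bsub>R\<^esub> \<oplus>\<^bsub>R\<^esub> [(lookup (foxA r) (C.shift (inv\<^bsub>F Mod N\<^esub> \<one>\<^bsub>F Mod N\<^esub>) e))] \<cdot>\<^bsub>R\<^esub> \<one>\<^bsub>R\<^esub>"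
      using r by (auto simp: coef_of)
  qed auto
  then have "pure_tensor R A \<one>\<^bsub>R\<^esub> r \<in> spanned_by r"
    unfolding spanned_by_def pure_tensor_def using fr[OF r] by blast
  then have "carrier M \<subseteq> spanned_by r"
    using gen submodule_spanned_by[of r] unfolding generated_submodule_def by blast
  moreover have "pure_tensor R A \<one>\<^bsub>R\<^esub> (cls x) \<in> carrier M"
    unfolding pure_tensor_def by (rule M_coset[OF fr[OF cls_closed[OF x]]])
  ultimately obtain c where c: "K #>\<^bsub>T\<^esub> frag_of (\<one>\<^bsub>R\<^esub>, cls x) = K #>\<^bsub>T\<^esub> c" "c \<in> carrier T"
    "C.rspan (foxA r) (\<lambda>e. coef e c)" unfolding spanned_by_def pure_tensor_def by blast
  have "frag_of (\<one>\<^bsub>R\<^esub>, cls x) \<in> K #>\<^bsub>T\<^esub> c"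
    unfolding c(1)[symmetric] by (rule KT.rcos_self[OF fr[OF cls_closed[OF x]] KT.subgroup_axioms])
  then have "coef e (frag_of (\<one>\<^bsub>R\<^esub>, cls x)) = coef e c" for e by (rule coef_coset[OF c(2)])
  then have "[(lookup (fox x) e)] \<cdot>\<^bsub>R\<^esub> \<one>\<^bsub>R\<^esub> = coef e c" for e
    using coef_of[OF R.one_closed cls_closed[OF x], of e] foxA_cls[OF x] by simp
  then show ?thesis using c(3) by simp
qed

end

subsection \<open>Normal generators\<close>

lemma (in group) normal_closure_normal:
  assumes "Y \<subseteq> carrier G"
  shows "normal_closure G Y \<lhd> G"
proof -
  have G: "carrier G \<lhd> G" using subgroup_self by (simp add: normal_inv_iff)
  have "subgroup (\<Inter> {H. H \<lhd> G \<and> Y \<subseteq> H}) G"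
    by (rule subgroups_Inter) (use G assms in \<open>auto dest: normal_imp_subgroup\<close>)
  then show ?thesis unfolding normal_closure_def
    by (auto simp: normal_inv_iff)
qed

lemma normal_closure_incl: "Y \<subseteq> normal_closure G Y"
  and normal_closure_least: "H \<lhd> G \<Longrightarrow> Y \<subseteq> H \<Longrightarrow> normal_closure G Y \<subseteq> H"
  by (auto simp: normal_closure_def)

section \<open>Pure tensors with left factor one, and the generator\<close>

context relation_setting
begin

abbreviation ptens where "ptens x \<equiv> pure_tensor R A \<one>\<^bsub>R\<^esub> (cls x)"

lemma group_tensor: "group (tensor_group R A)"
  unfolding tensor_group_def by (rule KT.factorgroup_is_group)

lemma pure_closed: "s \<in> carrier R \<Longrightarrow> m \<in> carrier A \<Longrightarrow> pure_tensor R A s m \<in> carrier (tensor_group R A)"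
  using M_coset[of "frag_of (s, m)"] by (simp add: carrier_M pure_tensor_def)

lemma coset_diff_eqI:
  assumes "c \<in> carrier T" "d \<in> carrier T" "c - d \<in> K"
  shows "K #>\<^bsub>T\<^esub> c = K #>\<^bsub>T\<^esub> d"
proof -
  have "c = (c - d) \<otimes>\<^bsub>T\<^esub> d" by simp
  then have "c \<in> K #>\<^bsub>T\<^esub> d" using assms(3) unfolding r_coset_def by blast
  then show ?thesis using KT.repr_independence[OF _ assms(2) KT.subgroup_axioms] by blast
qed

lemma tensor_mult:
  assumes "c \<in> carrier T" "d \<in> carrier T"
  shows "(K #>\<^bsub>T\<^esub> c) \<otimes>\<^bsub>tensor_group R A\<^esub> (K #>\<^bsub>T\<^esub> d) = K #>\<^bsub>T\<^esub> (c + d)"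
  using KT.rcos_sum[OF assms] by (simp add: tensor_group_def FactGroup_def)

lemma pure_add_left:
  assumes "s \<in> carrier R" "t \<in> carrier R" "m \<in> carrier A"
  shows "pure_tensor R A (s \<oplus>\<^bsub>R\<^esub> t) m = pure_tensor R A s m \<otimes>\<^bsub>tensor_group R A\<^esub> pure_tensor R A t m"
proof -
  have f: "frag_of (s, m) \<in> carrier T" "frag_of (t, m) \<in> carrier T" "frag_of (s \<oplus>\<^bsub>R\<^esub> t, m) \<in> carrier T"
    using assms by simp_all
  have "frag_of (s \<oplus>\<^bsub>R\<^esub> t, m) - frag_of (s, m) - frag_of (t, m) \<in> K"
    unfolding tensor_kernel_def tensor_relators_def by (rule generate.incl) (use assms in blast)
  then have "frag_of (s \<oplus>\<^bsub>R\<^esub> t, m) - (frag_of (s, m) + frag_of (t, m)) \<in> K" by (simp add: diff_diff_eq)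
  moreover have "frag_of (s, m) + frag_of (t, m) \<in> carrier T" using KT.m_closed[OF f(1,2)] by simp
  ultimately show ?thesis unfolding pure_tensor_def tensor_mult[OF f(1,2)] by (intro coset_diff_eqI f)
qed

lemma pure_add_right:
  assumes "s \<in> carrier R" "m \<in> carrier A" "k \<in> carrier A"
  shows "pure_tensor R A s (m \<otimes>\<^bsub>A\<^esub> k) = pure_tensor R A s m \<otimes>\<^bsub>tensor_group R A\<^esub> pure_tensor R A s k"
proof -
  interpret A: group A by (rule group_A)
  have f: "frag_of (s, m) \<in> carrier T" "frag_of (s, k) \<in> carrier T" "frag_of (s, m \<otimes>\<^bsub>A\<^esub> k) \<in> carrier T"
    using assms by simp_all
  have "frag_of (s, m \<otimes>\<^bsub>A\<^esub> k) - frag_of (s, m) - frag_of (s, k) \<in> K"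
    unfolding tensor_kernel_def tensor_relators_def by (rule generate.incl) (use assms in blast)
  then have "frag_of (s, m \<otimes>\<^bsub>A\<^esub> k) - (frag_of (s, m) + frag_of (s, k)) \<in> K" by (simp add: diff_diff_eq)
  moreover have "frag_of (s, m) + frag_of (s, k) \<in> carrier T" using KT.m_closed[OF f(1,2)] by simp
  ultimately show ?thesis unfolding pure_tensor_def tensor_mult[OF f(1,2)] by (intro coset_diff_eqI f)
qed

lemma ptens_mult: "x \<in> N \<Longrightarrow> y \<in> N \<Longrightarrow> ptens (x \<otimes> y) = ptens x \<otimes>\<^bsub>tensor_group R A\<^esub> ptens y"
  using pure_add_right[of "\<one>\<^bsub>R\<^esub>" "cls x" "cls y"] cls_mult[of x y] cls_closed by simp

lemma ptens_closed: "x \<in> N \<Longrightarrow> ptens x \<in> carrier (tensor_group R A)"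
  by (intro pure_closed cls_closed) auto

lemma N_pow: "y \<in> N \<Longrightarrow> y [^] (k::nat) \<in> N"
  by (induction k) auto

lemma ptens_one: "ptens \<one> = \<one>\<^bsub>tensor_group R A\<^esub>"
proof -
  interpret TG: group "tensor_group R A" by (rule group_tensor)
  have c: "ptens \<one> \<in> carrier (tensor_group R A)" by (rule ptens_closed) simp
  have "ptens (\<one> \<otimes> \<one>) = ptens \<one> \<otimes>\<^bsub>tensor_group R A\<^esub> ptens \<one>" by (rule ptens_mult) simp_all
  then have "ptens \<one> \<otimes>\<^bsub>tensor_group R A\<^esub> ptens \<one> = ptens \<one>" by (simp only: r_one one_closed)
  then show ?thesis unfolding TG.l_cancel_one[OF c c] .
qed

text \<open>The exponent can be moved to the left factor, where it annihilates one. In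
  characteristic zero the exponent is \<open>0\<close>.\<close>

lemma ptens_char_pow:
  assumes y: "y \<in> N"
  shows "ptens (y [^] nat R.char) = \<one>\<^bsub>tensor_group R A\<^esub>"
proof -
  interpret TG: group "tensor_group R A" by (rule group_tensor)
  let ?q = "\<lambda>s. pure_tensor R A s (cls y)"
  have q: "?q \<in> hom (add_monoid R) (tensor_group R A)"
    by (rule homI) (use pure_closed pure_add_left cls_closed[OF y] in auto)
  interpret q: group_hom "add_monoid R" "tensor_group R A" ?q
    by (intro group_hom.intro group_hom_axioms.intro q R.add.is_group TG.is_group)
  have pow: "ptens (y [^] (k::nat)) = ?q \<one>\<^bsub>R\<^esub> [^]\<^bsub>tensor_group R A\<^esub> k" for k
  proof (induction k)
    case 0
    then show ?case by (simp add: ptens_one)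
  next
    case (Suc k)
    then show ?case using ptens_mult[OF N_pow[OF y] y, of k] by simp
  qed
  have "?q \<one>\<^bsub>R\<^esub> [^]\<^bsub>tensor_group R A\<^esub> nat R.char = ?q (\<one>\<^bsub>R\<^esub> [^]\<^bsub>add_monoid R\<^esub> nat R.char)"
    using q.hom_nat_pow[of "\<one>\<^bsub>R\<^esub>" "nat R.char"] by simp
  also have "\<one>\<^bsub>R\<^esub> [^]\<^bsub>add_monoid R\<^esub> nat R.char = \<zero>\<^bsub>R\<^esub>"
    using R.int_mult_one_zero[of R.char] add_pow_int_ge[of R.char R "\<one>\<^bsub>R\<^esub>"]
    by (simp add: add_pow_def R.char_def)
  also have "?q \<zero>\<^bsub>R\<^esub> = \<one>\<^bsub>tensor_group R A\<^esub>" using q.hom_one by simp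
  finally show ?thesis using pow by simp
qed

text \<open>The difference of the Fox images is the characteristic times a cycle, and that cycle is
  \<open>fox v\<close> for some \<open>v\<close> in \<open>N\<close>. So \<open>x\<close> and
  \<open>y\<close> differ by a power of \<open>v\<close> and an element of the derived subgroup,
  both invisible in the tensor product.\<close>

lemma ptens_eqI:
  assumes x: "x \<in> N" and y: "y \<in> N" and eq: "\<And>e. R.char dvd lookup (fox x) e - lookup (fox y) e"
  shows "ptens x = ptens y"
proof -
  interpret TG: group "tensor_group R A" by (rule group_tensor)
  interpret D: normal "derived F N" F by (rule derived_is_normal[OF normal_N])
  have bd: "C.bd (fox x - fox y) = 0" using x y by (simp add: C.bd_diff bd_fox)
  have "R.char dvd lookup (fox x - fox y) e" for e using eq by (simp add: lookup_minus)
  then obtain z where z: "C.bd z = 0" "keys z \<subseteq> keys (fox x - fox y)" "fox x - fox y = frag_cmul R.char z"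
    using C.divisible_cycle[OF bd] by blast
  have "keys z \<subseteq> carrier (F Mod N) \<times> S"
    by (rule order.trans[OF z(2) order.trans[OF keys_diff Un_least]]) (use x y in \<open>auto intro!: keys_fox\<close>)
  then obtain v where v: "v \<in> N" "fox v = z" using cycle_is_fox[OF z(1)] by blast
  define k where "k = nat R.char"
  have k: "R.char = int k" by (simp add: k_def R.char_def)
  have vk: "v [^] k \<in> N" by (rule N_pow[OF v(1)])
  have fvk: "fox (v [^] k) = fox x - fox y" using fox_int_pow[OF v(1), of "int k"] v(2) z(3) k by (simp add: int_pow_int)
  define d where "d = x \<otimes> inv (v [^] k \<otimes> y)"
  have dN: "d \<in> N" using x vk y by (simp add: d_def)
  have "fox d = fox x - (fox (v [^] k) + fox y)"
    using x vk y by (simp add: d_def fox_mult_N fox_inv)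
  then have "fox d = 0" by (simp add: fvk)
  then have dD: "d \<in> derived F N" by (rule fox_zero_derived[OF dN])
  have xe: "x = d \<otimes> (v [^] k \<otimes> y)" using x vk y by (simp add: d_def m_assoc)
  have "cls x = cls (v [^] k \<otimes> y)"
  proof -
    have "x \<in> cls (v [^] k \<otimes> y)" using dD xe unfolding r_coset_def by blast
    then show ?thesis using repr_independence[OF _ _ D.subgroup_axioms, of x "v [^] k \<otimes> y"] vk y by simp
  qed
  then have "ptens x = ptens (v [^] k \<otimes> y)" by simp
  also have "\<dots> = ptens (v [^] k) \<otimes>\<^bsub>tensor_group R A\<^esub> ptens y" by (rule ptens_mult[OF vk y])
  also have "\<dots> = ptens y" using ptens_char_pow[OF v(1)] ptens_closed[OF y] by (simp add: k_def)
  finally show ?thesis .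
qed

text \<open>By descent there is no nonzero cycle, so the Cayley graph is a forest. With the free
  group itself as second group, closed words have trivial value.\<close>

lemma normal_subgroup_trivial:
  assumes "\<And>x e. x \<in> N \<Longrightarrow> R.char dvd lookup (fox x) e"
  shows "N = {\<one>}"
proof -
  let ?V = "carrier (F Mod N) \<times> S"
  interpret P: marked_pair "F Mod N" \<sigma> F \<iota> by unfold_locales
  have "P.good ?V"
  proof (rule P.good_forest)
    fix z assume z: "C.bd z = 0" "keys z \<subseteq> ?V"
    have "lookup z e = 0" for e
    proof (rule int_functional_zero_descent[OF R.char_not_one, of "{z. C.bd z = 0 \<and> keys z \<subseteq> ?V}" "\<lambda>z. lookup z e"])
      fix z assume "z \<in> {z. C.bd z = 0 \<and> keys z \<subseteq> ?V}"
      then have z: "C.bd z = 0" "keys z \<subseteq> ?V" by auto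
      then obtain x where "x \<in> N" "fox x = z" using cycle_is_fox by blast
      then have "\<And>e. R.char dvd lookup z e" using assms by blast
      then obtain z' where z': "C.bd z' = 0" "keys z' \<subseteq> keys z" "z = frag_cmul R.char z'"
        using C.divisible_cycle[OF z(1)] by blast
      have "lookup z e = R.char * lookup z' e" by (subst z'(3)) simp
      then show "\<exists>z' \<in> {z. C.bd z = 0 \<and> keys z \<subseteq> ?V}. lookup z e = R.char * lookup z' e"
        using z'(1,2) z(2) by blast
    qed (use z in auto)
    then show "z = 0" by (intro poly_mapping_eqI) simp
  qed
  moreover have "x = \<one>" if g: "P.good ?V" and x: "x \<in> N" for x
  proof -
    have xc: "x \<in> carrier F" using x by simp
    have "C.edges \<one>\<^bsub>F Mod N\<^esub> (wd x) \<subseteq> ?V"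
      using wd[OF xc] by (intro C.edges_subset) (auto simp: Sword_def)
    moreover have "C.wv (wd x) = \<one>\<^bsub>F Mod N\<^esub>" using wd[OF xc] \<pi>_one_iff[OF xc] x by (simp add: wv_quotient)
    ultimately have "I.wv (wd x) = \<one>" using P.goodD[OF g] C.one_closed by blast
    then show ?thesis using wd(2)[OF xc] by simp
  qed
  ultimately show ?thesis by auto
qed

text \<open>Elements of \<open>N\<close> are the values of closed words, and membership in
  \<open>V\<close> is tested in \<open>F Mod V\<close>, where the relator dies.\<close>

lemma normal_generator_of_simple_cycle:
  assumes ro: "right_orderable (F Mod N)"
    and u: "C.simple u" "Sword u" "v \<in> carrier (F Mod N)"
    and sp: "\<And>x. x \<in> N \<Longrightarrow> \<exists>a. C.finite_coeff a \<and>
      (\<forall>e \<in> carrier (F Mod N) \<times> S. [(lookup (fox x) e)] \<cdot>\<^bsub>R\<^esub> \<one>\<^bsub>R\<^esub> = C.rconv a (C.ch v u) e)"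
    and w: "V \<lhd> F" "I.wv u \<in> V"
  shows "N \<subseteq> V"
proof
  fix x assume x: "x \<in> N"
  interpret V: normal V F by (rule w(1))
  interpret QV: free_quotient V F S by (intro free_quotient.intro free_quotient_axioms.intro w(1) basis)
  have Qval: "QV.C.wv y = QV.\<pi> (I.wv y)" if "Sword y" for y
    using QV.wv_quotient[of y] QV.word_value_I[of y] word_value_I[of y] that by (simp add: QV.Sword_def Sword_def)
  have Q1: "QV.C.wv u = \<one>\<^bsub>F Mod V\<^esub>" using QV.\<pi>_one_iff[of "I.wv u"] w(2) by (simp add: Qval[OF u(2)])
  have up: "unique_products (F Mod N)" by (rule C.right_orderable_unique_products[OF ro])
  interpret cell: cell_system "F Mod N" \<sigma> "F Mod V" QV.\<sigma> u R.char
    by unfold_locales (use u Q1 up R.char_not_one in auto)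
  have om: "C.ch v u = C.shc v cell.\<omega>"
    using C.ch_shift[OF u(3) C.one_closed, of u] u(3) by (simp add: cell.\<omega>_def)
  have span: "\<exists>b. keys b \<subseteq> carrier (F Mod N) \<and> (\<forall>e. R.char dvd lookup (z - C.conv b cell.\<omega>) e)"
    if z: "C.bd z = 0" "keys z \<subseteq> carrier (F Mod N) \<times> S" for z
  proof -
    obtain y where y: "y \<in> N" "fox y = z" using cycle_is_fox[OF z] by blast
    obtain a where a: "C.finite_coeff a"
      "\<forall>e \<in> carrier (F Mod N) \<times> S. [(lookup (fox y) e)] \<cdot>\<^bsub>R\<^esub> \<one>\<^bsub>R\<^esub> = C.rconv a (C.ch v u) e" using sp[OF y(1)] by blast
    have k: "keys (C.ch v u) \<subseteq> carrier (F Mod N) \<times> S"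
      using C.keys_ch[of v u] C.edges_subset[OF u(3), of u S] u(2) by (auto simp: Sword_def)
    have "keys (C.ch v u) \<noteq> {}"
      unfolding C.keys_simple[OF u(1,3)] using u(1) by (cases u) (auto simp: C.simple_def)
    then have "C.ch v u \<noteq> 0" by auto
    then obtain b where b: "keys b \<subseteq> carrier (F Mod N)" "\<And>e. R.char dvd lookup (z - C.conv b (C.ch v u)) e"
      using C.integral_coefficients[OF up k _ _ a(1) z(2)] C.simple_lookup_cases[OF u(1,3)] C.keys_ch[of v u] a(2) y(2)
      by blast
    \<comment> \<open>The given cycle starts at \<open>v\<close>, but \<open>cell.\<omega>\<close>
      starts at the identity; right multiplication of the coefficients by \<open>v\<close>
      compensates.\<close>
    define b' where "b' = frag_extend (\<lambda>g. frag_of (g \<otimes>\<^bsub>F Mod N\<^esub> v)) b"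
    have "keys b' \<subseteq> carrier (F Mod N)"
      using keys_frag_extend[of "\<lambda>g. frag_of (g \<otimes>\<^bsub>F Mod N\<^esub> v)" b] b(1) u(3) by (auto simp: b'_def)
    moreover have "C.conv b' cell.\<omega> = C.conv b (C.ch v u)"
      unfolding b'_def using b(1)
    proof (induction b rule: frag_induction)
      case (one g)
      have "C.shc (g \<otimes>\<^bsub>F Mod N\<^esub> v) cell.\<omega> = C.ch (g \<otimes>\<^bsub>F Mod N\<^esub> v \<otimes>\<^bsub>F Mod N\<^esub> \<one>\<^bsub>F Mod N\<^esub>) u"
        using one u(3) C.ch_shift[of "g \<otimes>\<^bsub>F Mod N\<^esub> v" "\<one>\<^bsub>F Mod N\<^esub>" u] by (simp add: cell.\<omega>_def)
      then show ?case using one u(3) C.ch_shift[of g v u] by simp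
    qed (simp_all add: C.conv_diff frag_extend_diff)
    ultimately show ?thesis using b(2) by metis
  qed
  have xc: "x \<in> carrier F" using x by simp
  have "C.wv (wd x) = \<one>\<^bsub>F Mod N\<^esub>" using wd[OF xc] \<pi>_one_iff[OF xc] x by (simp add: wv_quotient)
  then have "QV.C.wv (wd x) = \<one>\<^bsub>F Mod V\<^esub>"
    using cell.closed_word_trivial[of S "wd x", OF _ span] u(2) wd[OF xc] by (simp add: Sword_def)
  then show "x \<in> V" using Qval[OF wd(1)[OF xc]] wd(2)[OF xc] QV.\<pi>_one_iff[OF xc] by simp
qed

theorem exists_normal_generator:
  assumes ro: "right_orderable (F Mod N)" and r: "r \<in> carrier A"
    and gen: "generated_submodule (group_ring R (F Mod N)) M {pure_tensor R A \<one>\<^bsub>R\<^esub> r} = carrier M"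
  shows "\<exists>w \<in> N. \<exists>k::nat. k > 0 \<and> ptens (w [^] k) = pure_tensor R A \<one>\<^bsub>R\<^esub> r \<and> normal_closure F {w} = N"
proof -
  obtain r0 where r0: "r0 \<in> N" "r = cls r0" using r by (rule A_cases)
  define z where "z = fox r0"
  have zr: "foxA r = z" using foxA_cls[OF r0(1)] by (simp add: z_def r0(2))
  have z: "C.bd z = 0" "keys z \<subseteq> carrier (F Mod N) \<times> S"
    using bd_fox[OF r0(1)] keys_fox[of r0] r0 by (simp_all add: z_def)
  have sp: "\<exists>a. C.finite_coeff a \<and> (\<forall>e \<in> carrier (F Mod N) \<times> S. [(lookup (fox x) e)] \<cdot>\<^bsub>R\<^esub> \<one>\<^bsub>R\<^esub> = C.rconv a z e)"
    if "x \<in> N" for x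
    using C.rspan_rconv[OF generated_rspan[OF r gen that]] unfolding zr .
  show ?thesis
  proof (cases "\<exists>e. \<not> R.char dvd lookup z e")
    case False
    \<comment> \<open>\<open>r\<close> is invisible modulo the characteristic, hence so is all of
      \<open>N\<close>. Then \<open>N\<close> is trivial, and \<open>w = \<one>\<close> with
      \<open>k = 1\<close> serves.\<close>
    have zdvd: "R.char dvd lookup z e" for e using False by blast
    have "R.char dvd lookup (fox x) e" if x: "x \<in> N" for x e
    proof (cases "e \<in> carrier (F Mod N) \<times> S")
      case True
      obtain a where a: "C.finite_coeff a" "[(lookup (fox x) e)] \<cdot>\<^bsub>R\<^esub> \<one>\<^bsub>R\<^esub> = C.rconv a z e"
        using sp[OF x] True by blast
      have "C.rconv a z e = [(lookup z (C.shift (inv\<^bsub>F Mod N\<^esub> \<one>\<^bsub>F Mod N\<^esub>) e))] \<cdot>\<^bsub>R\<^esub> a \<one>\<^bsub>F Mod N\<^esub>"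
        by (rule C.rconv_single[OF a(1) C.one_closed zdvd])
      also have "\<dots> = \<zero>\<^bsub>R\<^esub>" using a(1) zdvd by (intro R.int_mult_char) (auto simp: C.finite_coeff_def)
      finally show ?thesis using a(2) R.int_mult_one_zero by simp
    next
      case False
      then have "e \<notin> keys (fox x)" using keys_fox[of x] x by auto
      then show ?thesis by (simp add: not_in_keys_iff_lookup_eq_zero)
    qed
    then have N1: "N = {\<one>}" by (rule normal_subgroup_trivial)
    then have "r0 = \<one>" using r0 by simp
    moreover have "normal_closure F {\<one>} = N"
    proof
      show "normal_closure F {\<one>} \<subseteq> N" by (rule normal_closure_least[OF normal_N]) simp
      show "N \<subseteq> normal_closure F {\<one>}" using normal_closure_incl[of "{\<one>}" F] N1 by simp
    qed
    ultimately show ?thesis using r0(2) by (intro bexI[of _ \<one>] exI[of _ 1]) auto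
  next
    case True
    obtain v u where vu: "v \<in> carrier (F Mod N)" "C.simple u" "C.edges v u \<subseteq> {e. \<not> R.char dvd lookup z e}" "Sword u"
      using C.exists_simple_cycle[OF z True] unfolding Sword_def by blast
    define y where "y = C.ch v u"
    have ky: "keys y = C.edges v u" unfolding y_def by (rule C.keys_simple[OF vu(2,1)])
    have y1: "lookup y e = 1 \<or> lookup y e = -1" if "e \<in> keys y" for e
      unfolding y_def by (rule C.simple_lookup_cases[OF vu(2,1)]) (use that ky in simp)
    obtain f where f: "f \<in> carrier F" "\<pi> f = v" using \<pi>_surj[OF vu(1)] by blast
    have uN: "I.wv u \<in> N"
      using vu(2) wv_quotient[OF vu(4)] \<pi>_one_iff[of "I.wv u"] by (simp add: C.simple_def)
    \<comment> \<open>Conjugation by \<open>f\<close> moves the loop from the identity to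
      \<open>v\<close>, so the Fox image of \<open>x\<close> is the simple cycle itself.\<close>
    define x where "x = f \<otimes> I.wv u \<otimes> inv f"
    have xN: "x \<in> N" using inv_op_closed2[OF f(1) uN] by (simp add: x_def)
    have fx: "fox x = y"
      using fox_conj[OF uN f(1)] fox_wv[OF vu(4)] C.ch_shift[OF vu(1) C.one_closed, of u] f(2) vu(1) by (simp add: x_def y_def)
    obtain a where a: "C.finite_coeff a"
      "\<And>e. e \<in> carrier (F Mod N) \<times> S \<Longrightarrow> [(lookup y e)] \<cdot>\<^bsub>R\<^esub> \<one>\<^bsub>R\<^esub> = C.rconv a z e"
      using sp[OF xN] unfolding fx by blast
    have one: "g = \<one>\<^bsub>F Mod N\<^esub>" if "a g \<noteq> \<zero>\<^bsub>R\<^esub>" for g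
    proof (rule C.coefficient_trivial_support[OF ro a(1) z(2) True _ that])
      fix e assume e: "e \<in> carrier (F Mod N) \<times> S" "R.char dvd lookup z e"
      then have "lookup y e = 0" using vu(3) ky by (auto simp flip: not_in_keys_iff_lookup_eq_zero)
      then show "C.rconv a z e = \<zero>\<^bsub>R\<^esub>" using a(2)[OF e(1)] R.int_mult_one_zero[of 0] by simp
    qed
    \<comment> \<open>As \<open>a\<close> is supported at the identity, the simple cycle is edge by
      edge \<open>z\<close> times the scalar \<open>c\<close>.\<close>
    define c where "c = a \<one>\<^bsub>F Mod N\<^esub>"
    have c: "c \<in> carrier R" using a(1) by (simp add: c_def C.finite_coeff_def)
    have yc: "[(lookup y e)] \<cdot>\<^bsub>R\<^esub> \<one>\<^bsub>R\<^esub> = [(lookup z e)] \<cdot>\<^bsub>R\<^esub> c" if e: "e \<in> carrier (F Mod N) \<times> S" for e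
    proof -
      have "C.rconv a z e = [(lookup z (C.shift (inv\<^bsub>F Mod N\<^esub> \<one>\<^bsub>F Mod N\<^esub>) e))] \<cdot>\<^bsub>R\<^esub> a \<one>\<^bsub>F Mod N\<^esub>"
        by (rule C.rconv_single[OF a(1)]) (use one in auto)
      then show ?thesis using a(2)[OF e] e by (simp add: c_def mem_Times_iff)
    qed
    have "u \<noteq> []" using vu(2) by (simp add: C.simple_def)
    then have "keys y \<noteq> {}" unfolding ky by (cases u) auto
    then obtain e0 where e0: "e0 \<in> keys y" by blast
    have kS: "keys y \<subseteq> carrier (F Mod N) \<times> S"
      unfolding ky using C.edges_subset[OF vu(1), of u S] vu(4) by (simp add: Sword_def)
    \<comment> \<open>The coefficient of \<open>y\<close> at \<open>e0\<close> is its own inverse,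
      which makes the integer \<open>m\<close> an inverse of \<open>c\<close> in \<open>R\<close>.
      Hence \<open>z\<close> is \<open>m\<close> times \<open>y\<close> modulo the
      characteristic.\<close>
    define m where "m = lookup y e0 * lookup z e0"
    have "[m] \<cdot>\<^bsub>R\<^esub> c = [(lookup y e0)] \<cdot>\<^bsub>R\<^esub> ([(lookup z e0)] \<cdot>\<^bsub>R\<^esub> c)"
      using c by (simp add: m_def R.add.int_pow_pow mult.commute)
    also have "[(lookup z e0)] \<cdot>\<^bsub>R\<^esub> c = [(lookup y e0)] \<cdot>\<^bsub>R\<^esub> \<one>\<^bsub>R\<^esub>" using yc kS e0 by auto
    also have "[(lookup y e0)] \<cdot>\<^bsub>R\<^esub> ([(lookup y e0)] \<cdot>\<^bsub>R\<^esub> \<one>\<^bsub>R\<^esub>) = [(lookup y e0 * lookup y e0)] \<cdot>\<^bsub>R\<^esub> \<one>\<^bsub>R\<^esub>"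
      by (simp add: R.add.int_pow_pow)
    also have "\<dots> = \<one>\<^bsub>R\<^esub>" using y1[OF e0] by auto
    finally have mc: "[m] \<cdot>\<^bsub>R\<^esub> c = \<one>\<^bsub>R\<^esub>" .
    have c0: "c \<noteq> \<zero>\<^bsub>R\<^esub>" using mc R.one_not_zero by auto
    have m0: "m \<noteq> 0" using mc R.one_not_zero R.int_mult_char[OF c, of 0] by auto
    have cong: "R.char dvd lookup z e - m * lookup y e" for e
    proof (cases "e \<in> carrier (F Mod N) \<times> S")
      case True
      have "[(m * lookup y e)] \<cdot>\<^bsub>R\<^esub> c = [(lookup y e)] \<cdot>\<^bsub>R\<^esub> ([m] \<cdot>\<^bsub>R\<^esub> c)" using c by (simp add: R.add.int_pow_pow)
      also have "\<dots> = [(lookup z e)] \<cdot>\<^bsub>R\<^esub> c" unfolding mc by (rule yc[OF True])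
      finally have "[(lookup z e - m * lookup y e)] \<cdot>\<^bsub>R\<^esub> c = \<zero>\<^bsub>R\<^esub>"
        using c by (simp add: R.add.int_pow_diff R.r_neg)
      then show ?thesis using R.int_mult_zero_iff[OF c c0] by blast
    next
      case False
      then have "lookup z e = 0" "lookup y e = 0" using z(2) kS by (auto simp flip: not_in_keys_iff_lookup_eq_zero)
      then show ?thesis by simp
    qed
    \<comment> \<open>The exponent must be positive, so the sign of \<open>m\<close> is absorbed
      into \<open>w\<close>; inversion does not change the normal closure.\<close>
    define w where "w = (if m > 0 then x else inv x)"
    define k where "k = nat \<bar>m\<bar>"
    have wN: "w \<in> N" using xN by (simp add: w_def)
    have kpos: "k > 0" using m0 by (simp add: k_def)
    have fw: "fox (w [^] k) = frag_cmul m y"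
    proof -
      have "fox (w [^] k) = frag_cmul (int k) (fox w)" using fox_int_pow[OF wN, of "int k"] by (simp add: int_pow_int)
      moreover have "frag_cmul (- m) (- y) = frag_cmul m y" by (rule poly_mapping_eqI) simp
      ultimately show ?thesis using fox_inv[OF xN] fx by (auto simp: w_def k_def)
    qed
    have "ptens (w [^] k) = ptens r0"
    proof (rule ptens_eqI[OF N_pow[OF wN] r0(1)])
      fix e
      have "lookup (fox (w [^] k)) e - lookup (fox r0) e = - (lookup z e - m * lookup y e)"
        unfolding fw z_def by simp
      then show "R.char dvd lookup (fox (w [^] k)) e - lookup (fox r0) e" using cong by (metis dvd_minus_iff)
    qed
    moreover have "normal_closure F {w} = N"
    proof
      have wc: "w \<in> carrier F" using wN by simp
      show "normal_closure F {w} \<subseteq> N" using wN by (intro normal_closure_least[OF normal_N]) simp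
      define V where "V = normal_closure F {w}"
      have V: "V \<lhd> F" unfolding V_def by (rule normal_closure_normal) (use wc in simp)
      interpret V: normal V F by (rule V)
      have "w \<in> V" using normal_closure_incl[of "{w}" F] by (simp add: V_def)
      then have "inv w \<in> V" by (rule V.m_inv_closed)
      then have "x \<in> V" using \<open>w \<in> V\<close> xN by (cases "m > 0") (simp_all add: w_def)
      then have "inv f \<otimes> x \<otimes> f \<in> V" by (rule V.inv_op_closed1[OF f(1)])
      moreover have "inv f \<otimes> x \<otimes> f = I.wv u" using f(1) by (simp add: x_def m_assoc inv_cancel_left)
      ultimately have uV: "I.wv u \<in> V" by simp
      show "N \<subseteq> normal_closure F {w}"
        unfolding V_def[symmetric]
      proof (rule normal_generator_of_simple_cycle[OF ro vu(2,4,1) _ V uV])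
        fix t assume "t \<in> N"
        then obtain b where b: "C.finite_coeff b"
          "\<forall>e \<in> carrier (F Mod N) \<times> S. [(lookup (fox t) e)] \<cdot>\<^bsub>R\<^esub> \<one>\<^bsub>R\<^esub> = C.rconv b z e" using sp by blast
        then show "\<exists>a. C.finite_coeff a \<and>
            (\<forall>e \<in> carrier (F Mod N) \<times> S. [(lookup (fox t) e)] \<cdot>\<^bsub>R\<^esub> \<one>\<^bsub>R\<^esub> = C.rconv a (C.ch v u) e)"
          using C.rconv_scale[OF b(1) cong] unfolding y_def by (intro exI[of _ "\<lambda>g. [m] \<cdot>\<^bsub>R\<^esub> b g"]) auto
      qed
    qed
    ultimately show ?thesis using wN kpos r0(2) by blast
  qed
qed

end

theorem corollary1p9:
  fixes F :: "'a monoid" and N :: "'a set" and R :: "'r ring" and r :: "'a set"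
  assumes "free_group F" and "N \<lhd> F" and "nc_domain R"
    and "right_orderable (F Mod N)"
    and "r \<in> carrier (abelianization F N)"
    and "generated_submodule (group_ring R (F Mod N)) (relation_module R F N)
           {pure_tensor R (abelianization F N) \<one>\<^bsub>R\<^esub> r} = carrier (relation_module R F N)"
  shows "(\<exists>w \<in> N. \<exists>k::nat. k > 0 \<and>
            pure_tensor R (abelianization F N) \<one>\<^bsub>R\<^esub> (derived F N #>\<^bsub>F\<^esub> (w [^]\<^bsub>F\<^esub> k)) =
            pure_tensor R (abelianization F N) \<one>\<^bsub>R\<^esub> r \<and>
            normal_closure F {w} = N)
       \<and> one_relator_group TYPE('a) (F Mod N)"
proof -
  obtain S where S: "free_basis F S" using assms(1) by (auto simp: free_group_def)
  interpret relation_setting N F S R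
    by (intro relation_setting.intro free_quotient.intro free_quotient_axioms.intro assms S)
  have w: "\<exists>w \<in> N. \<exists>k::nat. k > 0 \<and> ptens (w [^]\<^bsub>F\<^esub> k) = pure_tensor R A \<one>\<^bsub>R\<^esub> r \<and> normal_closure F {w} = N"
    by (rule exists_normal_generator[OF assms(4-6)])
  then obtain w where "w \<in> N" "normal_closure F {w} = N" by blast
  then have "one_relator_group TYPE('a) (F Mod N)"
    unfolding one_relator_group_def using assms(1) by (intro exI[of _ F] exI[of _ w]) simp
  then show ?thesis using w by blast
qed

end
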